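(* Let $\{W(t)\}_{t\ge 0}$ be the Lévy Walk in $\mathbb R^m$ built from i.i.d. moving times $J_1,J_2,\dots$ and i.i.d. directions $\Lambda_1,\Lambda_2,\dots$, with $T(n)=\sum_{i=1}^n J_i$ and $S(n)=\sum_{i=1}^n J_i\Lambda_i$. Let $B(n)>0$ and $b(n)>0$ ($n\in\mathbb N$) be a spatial and a temporal scaling sequence and define the processes $$A_n(t)=B(n)\,S(\lfloor nt\rfloor),\qquad D_n(t)=b(n)\,T(\lfloor nt\rfloor),\qquad t\ge 0.$$ Suppose that, as $n\to\infty$, $\{(A_n(t),D_n(t))\}_{t\ge0}$ converges weakly in $\mathbb D(\mathbb R^{m+1})$ with respect to the $J_1$ topology to a process $\{(A(t),D(t))\}_{t\ge 0}$, and that $D$ has strictly increasing sample paths almost surely. Then the rescaled Lévy Walk $$W_n(t)=B(n)\,W(t/b(n)),\qquad t\ge0,$$ converges weakly in $\mathbb D(\mathbb R^m)$ with respect to the $M_1$ topology to the process $\{L(t)\}_{t\ge0}$ given by $$L(t)=\begin{cases}X(t) & \text{if } t\in\mathcal R(D),\\[4pt] X(t)+\dfrac{t-G(t)}{H(t)-G(t)}\,\bigl(Y(t)-X(t)\bigr) & \text{if } t\notin\mathcal R(D),\end{cases}$$ where $\mathcal R(D)=\{D(t):t\ge0\}\subset[0,\infty)$, $E(t)=\inf\{r\ge 0: D(r)>t\}$, and $$X(t)=\lim_{s\downarrow t}A^-(E(s)),\quad Y(t)=A(E(t)),\quad G(t)=\lim_{s\downarrow t}D^-(E(s)),\quad 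H(t)=D(E(t)).$$
   Context: Lévy Walk: $S^{m-1}$ is the Euclidean unit sphere of $\mathbb R^m$ and $\lambda$ is a probability measure on $S^{m-1}$ whose support spans $\mathbb R^m$. $\Lambda_1,\Lambda_2,\dots$ are i.i.d. with distribution $\lambda$; $J_1,J_2,\dots$ are i.i.d. $\mathbb R_+$-valued random variables; the sequences $(\Lambda_i)$ and $(J_i)$ are independent. $T(0)=0$, $S(0)=0$, $T(n)=\sum_{i=1}^nJ_i$, $S(n)=\sum_{j=1}^nJ_j\Lambda_j$, $N_t=\max\{n\ge0:T(n)\le t\}$, and $$W(t)=\sum_{j=1}^{N_t}J_j\Lambda_j+\bigl(t-T(N_t)\bigr)\Lambda_{N_t+1},\qquad t\ge 0.$$ For a separable metric space $E$, $\mathbb D(E)$ is the set of maps $[0,\infty)\to E$ that are right-continuous with left-hand limits. $J_1$ and $M_1$ are the Skorokhod topologies on these path spaces over $[0,\infty)$ ($M_1$ in the strong sense, i.e. based on completed graphs with straight line segments $[x(t-),x(t)]\subset\mathbb R^m$). For a path $x\in \mathbb D(E)$, $x^-$ is its left-continuous version: $x^-(t)=x(t-)$ for $t>0$ and $x^-(0)=x(0)$. *)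

theory Defs
  imports "HOL-Probability.Probability"
begin

section \<open>Path spaces\<close>

text \<open>
  A path on $[0,\infty)$ is a function on \<^typ>\<open>real\<close>; elements of the path space are
  extensional, so that they are determined by their values on $[0,\infty)$.
\<close>

definition cadlag_paths :: "(real \<Rightarrow> 'e::metric_space) set" where
  "cadlag_paths =
    {x \<in> extensional {0..}.
       (\<forall>t\<ge>0. (x \<longlongrightarrow> x t) (at_right t)) \<and>
       (\<forall>t>0. \<exists>l. (x \<longlongrightarrow> l) (at_left t))}"

definition left_version :: "(real \<Rightarrow> 'e::metric_space) \<Rightarrow> real \<Rightarrow> 'e" where
  "left_version x t = (if t > 0 then Lim (at_left t) x else x 0)"

text \<open>
  The Skorokhod topologies on $[0,\infty)$ are metrizable and are specified by their convergent
  sequences, so that the open sets are the sequentially open ones.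
\<close>

definition sequential_topology ::
    "'p set \<Rightarrow> ((nat \<Rightarrow> 'p) \<Rightarrow> 'p \<Rightarrow> bool) \<Rightarrow> 'p topology" where
  "sequential_topology P conv = topology (\<lambda>U. U \<subseteq> P \<and>
     (\<forall>x\<in>U. \<forall>xs. range xs \<subseteq> P \<and> conv xs x \<longrightarrow> (\<forall>\<^sub>F n in sequentially. xs n \<in> U)))"

lemma openin_sequential_topology:
  "openin (sequential_topology P conv) U \<longleftrightarrow> U \<subseteq> P \<and>
     (\<forall>x\<in>U. \<forall>xs. range xs \<subseteq> P \<and> conv xs x \<longrightarrow> (\<forall>\<^sub>F n in sequentially. xs n \<in> U))"
proof -
  have "istopology (\<lambda>U. U \<subseteq> P \<and>
     (\<forall>x\<in>U. \<forall>xs. range xs \<subseteq> P \<and> conv xs x \<longrightarrow> (\<forall>\<^sub>F n in sequentially. xs n \<in> U)))"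
    unfolding istopology_def
  proof (intro conjI allI impI)
    fix K
    assume K: "\<forall>U\<in>K. U \<subseteq> P \<and>
      (\<forall>x\<in>U. \<forall>xs. range xs \<subseteq> P \<and> conv xs x \<longrightarrow> (\<forall>\<^sub>F n in sequentially. xs n \<in> U))"
    then show "\<Union>K \<subseteq> P" by blast
    show "\<forall>x\<in>\<Union>K. \<forall>xs. range xs \<subseteq> P \<and> conv xs x \<longrightarrow> (\<forall>\<^sub>F n in sequentially. xs n \<in> \<Union>K)"
    proof (intro ballI allI impI)
      fix x xs assume "x \<in> \<Union>K" and xs: "range xs \<subseteq> P \<and> conv xs x"
      then obtain U where "U \<in> K" "x \<in> U" by blast
      with K xs have "\<forall>\<^sub>F n in sequentially. xs n \<in> U" by blast
      then show "\<forall>\<^sub>F n in sequentially. xs n \<in> \<Union>K"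
        using \<open>U \<in> K\<close> by (auto elim: eventually_mono)
    qed
  qed (auto intro: eventually_conj)
  then show ?thesis
    unfolding sequential_topology_def by (simp add: topology_inverse')
qed

lemma topspace_sequential_topology [simp]: "topspace (sequential_topology P conv) = P"
proof -
  have "openin (sequential_topology P conv) P"
    by (auto simp: openin_sequential_topology intro!: always_eventually)
  moreover have "topspace (sequential_topology P conv) \<subseteq> P"
    using openin_topspace[of "sequential_topology P conv"]
    unfolding openin_sequential_topology by blast
  ultimately show ?thesis
    using openin_subset by blast
qed

text \<open>
  \<open>J1_within T e x y\<close> bounds by \<open>e\<close> the uniform $J_1$ distance on $[0,T]$, which is the infimum of
  all such \<open>e\<close>. Convergence on $[0,\infty)$ is convergence of the restrictions to $[0,T]$, for
  every continuity point $T$ of the limit.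
\<close>

definition J1_within :: "real \<Rightarrow> real \<Rightarrow> (real \<Rightarrow> 'e::metric_space) \<Rightarrow> (real \<Rightarrow> 'e) \<Rightarrow> bool" where
  "J1_within T e x y \<longleftrightarrow>
    (\<exists>h. strict_mono_on {0..T} h \<and> continuous_on {0..T} h \<and> h ` {0..T} = {0..T} \<and>
         (\<forall>s\<in>{0..T}. \<bar>h s - s\<bar> \<le> e \<and> dist (x (h s)) (y s) \<le> e))"

definition J1_converges :: "(nat \<Rightarrow> real \<Rightarrow> 'e::metric_space) \<Rightarrow> (real \<Rightarrow> 'e) \<Rightarrow> bool" where
  "J1_converges xs x \<longleftrightarrow>
    (\<forall>T>0. isCont x T \<longrightarrow> (\<forall>e>0. \<forall>\<^sub>F n in sequentially. J1_within T e (xs n) x))"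

definition J1_topology :: "(real \<Rightarrow> 'e::metric_space) topology" where
  "J1_topology = sequential_topology cadlag_paths J1_converges"

text \<open>
  The strong $M_1$ topology: the completed graph over $[0,T]$ contains the straight line segment
  from $x(t-)$ to $x(t)$ for every $t$, and is ordered by time and then by the distance from
  $x(t-)$. Parametric representations \<open>(u, r)\<close> have the spatial component \<open>u\<close> and the temporal
  component \<open>r\<close>. As for $J_1$, the $M_1$ distance on $[0,T]$ is the infimum of the \<open>e\<close> with
  \<open>M1_within T e x y\<close>.
\<close>

definition completed_graph ::
    "real \<Rightarrow> (real \<Rightarrow> 'e::real_normed_vector) \<Rightarrow> ('e \<times> real) set" where
  "completed_graph T x = {(z, t). t \<in> {0..T} \<and> z \<in> closed_segment (left_version x t) (x t)}"

definition graph_le ::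
    "(real \<Rightarrow> 'e::real_normed_vector) \<Rightarrow> 'e \<times> real \<Rightarrow> 'e \<times> real \<Rightarrow> bool" where
  "graph_le x p q \<longleftrightarrow>
    snd p < snd q \<or>
    snd p = snd q \<and> dist (left_version x (snd p)) (fst p) \<le> dist (left_version x (snd p)) (fst q)"

definition parametric_rep ::
    "real \<Rightarrow> (real \<Rightarrow> 'e::real_normed_vector) \<Rightarrow> (real \<Rightarrow> 'e) \<Rightarrow> (real \<Rightarrow> real) \<Rightarrow> bool" where
  "parametric_rep T x u r \<longleftrightarrow>
    continuous_on {0..1} u \<and> continuous_on {0..1} r \<and>
    (\<lambda>s. (u s, r s)) ` {0..1} = completed_graph T x \<and>
    (\<forall>s\<in>{0..1}. \<forall>s'\<in>{0..1}. s \<le> s' \<longrightarrow> graph_le x (u s, r s) (u s', r s'))"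

definition M1_within ::
    "real \<Rightarrow> real \<Rightarrow> (real \<Rightarrow> 'e::real_normed_vector) \<Rightarrow> (real \<Rightarrow> 'e) \<Rightarrow> bool" where
  "M1_within T e x y \<longleftrightarrow>
    (\<exists>u r v q. parametric_rep T x u r \<and> parametric_rep T y v q \<and>
       (\<forall>s\<in>{0..1}. dist (u s) (v s) \<le> e \<and> \<bar>r s - q s\<bar> \<le> e))"

definition M1_converges ::
    "(nat \<Rightarrow> real \<Rightarrow> 'e::real_normed_vector) \<Rightarrow> (real \<Rightarrow> 'e) \<Rightarrow> bool" where
  "M1_converges xs x \<longleftrightarrow>
    (\<forall>T>0. isCont x T \<longrightarrow> (\<forall>e>0. \<forall>\<^sub>F n in sequentially. M1_within T e (xs n) x))"

definition M1_topology :: "(real \<Rightarrow> 'e::real_normed_vector) topology" where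
  "M1_topology = sequential_topology cadlag_paths M1_converges"


section \<open>Weak convergence of processes\<close>

definition borel_sets_of :: "'p topology \<Rightarrow> 'p measure" where
  "borel_sets_of X = sigma (topspace X) {U. openin X U}"

definition weakly_converges :: "'p topology \<Rightarrow> (nat \<Rightarrow> 'p measure) \<Rightarrow> 'p measure \<Rightarrow> bool" where
  "weakly_converges X \<mu> \<nu> \<longleftrightarrow>
    (\<forall>f. continuous_map X euclideanreal f \<and> bounded (f ` topspace X) \<longrightarrow>
       (\<lambda>n. \<integral>x. f x \<partial>\<mu> n) \<longlonglongrightarrow> (\<integral>x. f x \<partial>\<nu>))"

text \<open>
  A process need have its paths in the path space only almost surely: off a null set it agrees
  on $[0,\infty)$ with a genuine random element of the path space, whose law does not depend on the
  choice made on the null set.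
\<close>

definition path_version ::
    "(real \<Rightarrow> 'e) topology \<Rightarrow> 'w measure \<Rightarrow> ('w \<Rightarrow> real \<Rightarrow> 'e) \<Rightarrow> ('w \<Rightarrow> real \<Rightarrow> 'e) \<Rightarrow> bool" where
  "path_version X M Y Z \<longleftrightarrow>
    Z \<in> measurable M (borel_sets_of X) \<and> (AE \<omega> in M. \<forall>t\<ge>0. Z \<omega> t = Y \<omega> t)"

definition process_converges ::
    "(real \<Rightarrow> 'e) topology \<Rightarrow> 'w measure \<Rightarrow> (nat \<Rightarrow> 'w \<Rightarrow> real \<Rightarrow> 'e) \<Rightarrow>
     'v measure \<Rightarrow> ('v \<Rightarrow> real \<Rightarrow> 'e) \<Rightarrow> bool" where
  "process_converges X M Y M' Y' \<longleftrightarrow>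
    (\<exists>Z Z'. (\<forall>n. path_version X M (Y n) (Z n)) \<and> path_version X M' Y' Z' \<and>
       weakly_converges X (\<lambda>n. distr M (borel_sets_of X) (Z n)) (distr M' (borel_sets_of X) Z'))"


section \<open>The Levy walk\<close>

abbreviation sphere_borel :: "'e::euclidean_space measure" where
  "sphere_borel \<equiv> restrict_space borel (sphere 0 1)"

definition sphere_support :: "'e::euclidean_space measure \<Rightarrow> 'e set" where
  "sphere_support \<mu> =
    {x \<in> sphere 0 1. \<forall>U. open U \<and> x \<in> U \<longrightarrow> emeasure \<mu> (U \<inter> sphere 0 1) > 0}"

text \<open>The sequences are indexed by $1, 2, \dots$; the values at index \<open>0\<close> are irrelevant.
  Independence of the two sequences is that of the $\sigma$-algebras they generate;
  \<^const>\<open>prob_space.indep_var\<close> would require both to have the same type.\<close>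

locale levy_walk = prob_space M + direction: prob_space lam
  for M :: "'w measure" and lam :: "(real ^ 'm) measure" +
  fixes J :: "nat \<Rightarrow> 'w \<Rightarrow> real" and \<Lambda> :: "nat \<Rightarrow> 'w \<Rightarrow> real ^ 'm"
  assumes sets_direction: "sets lam = sets sphere_borel"
    and span_support: "span (sphere_support lam) = UNIV"
    and J_nonneg: "\<And>i \<omega>. i \<ge> 1 \<Longrightarrow> \<omega> \<in> space M \<Longrightarrow> J i \<omega> \<ge> 0"
    and J_indep: "indep_vars (\<lambda>_. borel) J {1..}"
    and J_ident: "\<And>i. i \<ge> 1 \<Longrightarrow> distr M borel (J i) = distr M borel (J 1)"
    and Lambda_indep: "indep_vars (\<lambda>_. sphere_borel) \<Lambda> {1..}"
    and Lambda_distr: "\<And>i. i \<ge> 1 \<Longrightarrow> distr M sphere_borel (\<Lambda> i) = lam"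
    and J_Lambda_indep:
      "indep_set
         {(\<lambda>\<omega>. \<lambda>i\<in>{1..}. J i \<omega>) -` S \<inter> space M | S. S \<in> sets (Pi\<^sub>M {1..} (\<lambda>_. borel))}
         {(\<lambda>\<omega>. \<lambda>i\<in>{1..}. \<Lambda> i \<omega>) -` S \<inter> space M | S. S \<in> sets (Pi\<^sub>M {1..} (\<lambda>_. sphere_borel))}"

definition walk_time :: "(nat \<Rightarrow> 'w \<Rightarrow> real) \<Rightarrow> nat \<Rightarrow> 'w \<Rightarrow> real" where
  "walk_time J n \<omega> = (\<Sum>i=1..n. J i \<omega>)"

definition walk_sum ::
    "(nat \<Rightarrow> 'w \<Rightarrow> real) \<Rightarrow> (nat \<Rightarrow> 'w \<Rightarrow> real ^ 'm) \<Rightarrow> nat \<Rightarrow> 'w \<Rightarrow> real ^ 'm" where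
  "walk_sum J \<Lambda> n \<omega> = (\<Sum>j=1..n. J j \<omega> *\<^sub>R \<Lambda> j \<omega>)"

definition walk_count :: "(nat \<Rightarrow> 'w \<Rightarrow> real) \<Rightarrow> real \<Rightarrow> 'w \<Rightarrow> nat" where
  "walk_count J t \<omega> = Max {n. walk_time J n \<omega> \<le> t}"

definition walk ::
    "(nat \<Rightarrow> 'w \<Rightarrow> real) \<Rightarrow> (nat \<Rightarrow> 'w \<Rightarrow> real ^ 'm) \<Rightarrow> real \<Rightarrow> 'w \<Rightarrow> real ^ 'm" where
  "walk J \<Lambda> t \<omega> =
    (\<Sum>j=1..walk_count J t \<omega>. J j \<omega> *\<^sub>R \<Lambda> j \<omega>) +
    (t - walk_time J (walk_count J t \<omega>) \<omega>) *\<^sub>R \<Lambda> (walk_count J t \<omega> + 1) \<omega>"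


section \<open>The limit process\<close>

text \<open>All functionals below are applied to individual sample paths \<open>a\<close> of $A$ and \<open>d\<close> of $D$.\<close>

definition inverse_time :: "(real \<Rightarrow> real) \<Rightarrow> real \<Rightarrow> real" where
  "inverse_time d t = Inf {r. 0 \<le> r \<and> d r > t}"

definition limit_X :: "(real \<Rightarrow> 'e::real_normed_vector) \<Rightarrow> (real \<Rightarrow> real) \<Rightarrow> real \<Rightarrow> 'e" where
  "limit_X a d t = Lim (at_right t) (\<lambda>s. left_version a (inverse_time d s))"

definition limit_Y :: "(real \<Rightarrow> 'e::real_normed_vector) \<Rightarrow> (real \<Rightarrow> real) \<Rightarrow> real \<Rightarrow> 'e" where
  "limit_Y a d t = a (inverse_time d t)"

definition limit_G :: "(real \<Rightarrow> real) \<Rightarrow> real \<Rightarrow> real" where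
  "limit_G d t = Lim (at_right t) (\<lambda>s. left_version d (inverse_time d s))"

definition limit_H :: "(real \<Rightarrow> real) \<Rightarrow> real \<Rightarrow> real" where
  "limit_H d t = d (inverse_time d t)"

definition limit_L :: "(real \<Rightarrow> 'e::real_normed_vector) \<Rightarrow> (real \<Rightarrow> real) \<Rightarrow> real \<Rightarrow> 'e" where
  "limit_L a d t =
    (if t \<in> d ` {0..} then limit_X a d t
     else limit_X a d t +
       ((t - limit_G d t) / (limit_H d t - limit_G d t)) *\<^sub>R (limit_Y a d t - limit_X a d t))"

end

theory Submission
  imports Defs
begin

text \<open>
  The rescaled walk \<open>W\<^sub>n\<close> is a deterministic functional of the space-time path \<open>(A\<^sub>n, D\<^sub>n)\<close>: the formula
  that defines \<open>L\<close> from \<open>(A, D)\<close>, applied to the step path \<open>(A\<^sub>n, D\<^sub>n)\<close>, interpolates linearly over each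
  move and returns \<open>W\<^sub>n\<close> (\<open>spatial_path_walk\<close>). So the theorem is a continuous mapping theorem, once
  the functional is known to be continuous from \<open>J\<^sub>1\<close> to \<open>M\<^sub>1\<close> on a set of paths that carries all the
  laws involved, prelimit and limit.

  This set consists of the ``coupled'' paths: the time component starts at 0, is nondecreasing and
  unbounded, and space stands still whenever time does. For such a path \<open>(a, d)\<close> the projection of its
  completed graph to space and time, with operational time forgotten, is exactly the completed
  graph of \<open>L\<close>: a jump of \<open>(a, d)\<close> that takes time is a segment traversed at constant speed, and a jump
  of \<open>a\<close> alone is a jump of \<open>L\<close> with its straight segment. Hence a continuous traversal of the jumps
  of \<open>(a, d)\<close> is a parametric representation of \<open>L\<close> (\<open>graph_curve_traversal\<close>). Two paths that are
  \<open>J\<^sub>1\<close>-close become uniformly close after a time change, which leaves \<open>L\<close> unaffected, and can then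
  be traversed at a common pace; the two parametric representations are uniformly close, so the two
  functions \<open>L\<close> are \<open>M\<^sub>1\<close>-close (\<open>spatial_path_continuous\<close>).

  The set of coupled paths is neither open nor closed, so its topology has to be compared with that of
  the whole space. For this a metric is used in which \<open>J\<^sub>1\<close> convergent sequences converge and for which the
  functional is still continuous on coupled paths. Unions of balls then extend open
  subsets of the set of coupled paths to the whole space, which gives measurability, and infimal
  convolutions with the metric approximate a bounded continuous function on it from below by functions
  that are continuous everywhere, which gives convergence of integrals (\<open>mapping_theorem\<close>).

  Probability enters only in showing that the laws are carried by coupled paths, that is, that the walk
  takes infinite time and that \<open>D\<close> is unbounded. The Laplace transform of \<open>D\<^sub>n\<close> at an integer time \<open>k\<close> is
  the \<open>k\<close>-th power of that at time 1, because the steps are independent and identically distributed;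
  since \<open>D\<close> is strictly increasing, the limit at time 1 is smaller than 1, and so the limit at time \<open>k\<close>
  decays geometrically (\<open>D_unbounded\<close>). As evaluation at a fixed time is not \<open>J\<^sub>1\<close> continuous, averages
  over unit windows of time take the place of the transforms themselves.
\<close>

section \<open>Right-continuous paths with left limits\<close>

definition cadlag :: "(real \<Rightarrow> 'e::metric_space) \<Rightarrow> bool" where
  "cadlag x \<longleftrightarrow>
    (\<forall>t\<ge>0. (x \<longlongrightarrow> x t) (at_right t)) \<and> (\<forall>t>0. \<exists>l. (x \<longlongrightarrow> l) (at_left t))"

lemma cadlag_paths_iff: "x \<in> cadlag_paths \<longleftrightarrow> x \<in> extensional {0..} \<and> cadlag x"
  by (auto simp: cadlag_paths_def cadlag_def)

lemma cadlag_right: "cadlag x \<Longrightarrow> 0 \<le> t \<Longrightarrow> (x \<longlongrightarrow> x t) (at_right t)"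
  by (simp add: cadlag_def)

lemma left_version_0 [simp]: "left_version x 0 = x 0"
  by (simp add: left_version_def)

lemma left_version_eqI: "(x \<longlongrightarrow> l) (at_left t) \<Longrightarrow> 0 < t \<Longrightarrow> left_version x t = l"
  by (simp add: left_version_def tendsto_Lim)

lemma cadlag_left: "cadlag x \<Longrightarrow> 0 < t \<Longrightarrow> (x \<longlongrightarrow> left_version x t) (at_left t)"
  using left_version_eqI by (fastforce simp: cadlag_def)

lemma left_version_close:
  assumes x: "cadlag x" and ab: "0 \<le> a" "a < t" and near: "\<And>s. a < s \<Longrightarrow> s < t \<Longrightarrow> dist (x s) c \<le> e"
  shows "dist (left_version x t) c \<le> e"
proof -
  have "((\<lambda>s. dist (x s) c) \<longlongrightarrow> dist (left_version x t) c) (at_left t)"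
    using cadlag_left[OF x] ab by (auto intro!: tendsto_intros)
  moreover have "\<forall>\<^sub>F s in at_left t. dist (x s) c \<le> e"
    using ab near by (intro eventually_at_leftI[of a]) auto
  ultimately show ?thesis by (intro tendsto_upperbound) auto
qed

lemma left_version_close2:
  assumes x: "cadlag x" and y: "cadlag y" and t: "0 \<le> t"
    and near: "\<And>s. 0 \<le> s \<Longrightarrow> s \<le> t \<Longrightarrow> dist (x s) (y s) \<le> e"
  shows "dist (left_version x t) (left_version y t) \<le> e"
proof (cases "t = 0")
  case False
  then have "((\<lambda>s. dist (x s) (y s)) \<longlongrightarrow> dist (left_version x t) (left_version y t)) (at_left t)"
    using cadlag_left[OF x] cadlag_left[OF y] t by (auto intro!: tendsto_intros)
  moreover have "\<forall>\<^sub>F s in at_left t. dist (x s) (y s) \<le> e"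
    using t False near by (intro eventually_at_leftI[of 0]) auto
  ultimately show ?thesis by (intro tendsto_upperbound) auto
qed (use near[of 0] t in auto)

lemma cadlag_near_right:
  assumes x: "cadlag x" and t: "0 \<le> t" and e: "0 < e"
  obtains b where "t < b" "\<And>s. t < s \<Longrightarrow> s < b \<Longrightarrow> dist (x s) (x t) \<le> e"
    "\<And>s. t < s \<Longrightarrow> s < b \<Longrightarrow> dist (left_version x s) (x t) \<le> e"
proof -
  have "\<forall>\<^sub>F s in at_right t. dist (x s) (x t) < e"
    using cadlag_right[OF x t] e by (rule tendstoD)
  then obtain b where b: "t < b" "\<And>s. t < s \<Longrightarrow> s < b \<Longrightarrow> dist (x s) (x t) < e"
    by (auto simp: eventually_at_right_field)
  show thesis
  proof (rule that[OF b(1)])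
    fix s assume s: "t < s" "s < b"
    show "dist (left_version x s) (x t) \<le> e"
      by (rule left_version_close[OF x t s(1)]) (use b s in \<open>auto intro!: less_imp_le b(2)\<close>)
  qed (use b in \<open>auto intro: less_imp_le\<close>)
qed

lemma cadlag_near_left:
  assumes x: "cadlag x" and t: "0 < t" and e: "0 < e"
  obtains a where "0 \<le> a" "a < t" "\<And>s. a < s \<Longrightarrow> s < t \<Longrightarrow> dist (x s) (left_version x t) \<le> e"
    "\<And>s. a < s \<Longrightarrow> s < t \<Longrightarrow> dist (left_version x s) (left_version x t) \<le> e"
proof -
  have "\<forall>\<^sub>F s in at_left t. dist (x s) (left_version x t) < e"
    using cadlag_left[OF x t] e by (rule tendstoD)
  then obtain a where a: "a < t" "\<And>s. a < s \<Longrightarrow> s < t \<Longrightarrow> dist (x s) (left_version x t) < e"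
    by (auto simp: eventually_at_left_field)
  show thesis
  proof (rule that[of "max a 0"])
    fix s assume s: "max a 0 < s" "s < t"
    show "dist (left_version x s) (left_version x t) \<le> e"
      by (rule left_version_close[of x "max a 0"]) (use a x s in \<open>auto intro!: less_imp_le a(2)\<close>)
  qed (use a t in \<open>auto intro: less_imp_le\<close>)
qed

lemma left_version_tendsto_right:
  assumes x: "cadlag x" and t: "0 \<le> t"
  shows "(left_version x \<longlongrightarrow> x t) (at_right t)"
proof (rule tendstoI)
  fix e :: real assume e: "e > 0"
  obtain b where b: "t < b" "\<And>s. t < s \<Longrightarrow> s < b \<Longrightarrow> dist (left_version x s) (x t) \<le> e/2"
    by (rule cadlag_near_right[OF x t, of "e/2"]) (use e in auto)
  show "\<forall>\<^sub>F s in at_right t. dist (left_version x s) (x t) < e"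
    using b e by (intro eventually_at_rightI[of t b]) (force dest!: b(2))+
qed

lemma isCont_cadlag_iff:
  assumes x: "cadlag x" and t: "0 < t"
  shows "isCont x t \<longleftrightarrow> left_version x t = x t"
proof
  assume "isCont x t"
  then have "(x \<longlongrightarrow> x t) (at_left t)"
    by (auto simp: isCont_def filterlim_at_split)
  then show "left_version x t = x t" using t by (rule left_version_eqI)
next
  assume "left_version x t = x t"
  then show "isCont x t"
    using cadlag_left[OF x t] cadlag_right[OF x, of t] t
    by (auto simp: isCont_def filterlim_at_split)
qed

definition jump_times :: "(real \<Rightarrow> 'e::metric_space) \<Rightarrow> real set" where
  "jump_times x = {t. 0 \<le> t \<and> left_version x t \<noteq> x t}"

lemma jump_times_pos: "t \<in> jump_times x \<Longrightarrow> 0 < t"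
  unfolding jump_times_def using left_version_0[of x] by (cases "t = 0") auto

text \<open>
  To the right of any time there is an interval without jumps larger than a given size, so the
  times of such jumps can be separated by rational numbers.
\<close>

lemma countable_jump_times:
  assumes x: "cadlag x"
  shows "countable (jump_times x)"
proof -
  define C where "C k = {t. 0 \<le> t \<and> dist (left_version x t) (x t) > 1 / Suc k}" for k :: nat
  have "jump_times x = (\<Union>k. C k)"
  proof safe
    fix t assume t: "t \<in> jump_times x"
    then have "0 < dist (left_version x t) (x t)" by (auto simp: jump_times_def)
    then obtain k :: nat where "inverse (Suc k) < dist (left_version x t) (x t)"
      using reals_Archimedean by blast
    then show "t \<in> (\<Union>k. C k)" using t by (auto simp: C_def jump_times_def inverse_eq_divide)
  qed (auto simp: C_def jump_times_def)
  moreover have "countable (C k)" for k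
  proof -
    have "\<exists>b>t. \<forall>s. t < s \<and> s < b \<longrightarrow> s \<notin> C k" if t: "t \<in> C k" for t
    proof -
      have t0: "0 \<le> t" using t by (simp add: C_def)
      obtain b where b: "t < b" "\<And>s. t < s \<Longrightarrow> s < b \<Longrightarrow> dist (x s) (x t) \<le> 1 / (2 * Suc k)"
        "\<And>s. t < s \<Longrightarrow> s < b \<Longrightarrow> dist (left_version x s) (x t) \<le> 1 / (2 * Suc k)"
        by (rule cadlag_near_right[OF x t0, of "1 / (2 * Suc k)"]) auto
      have "s \<notin> C k" if s: "t < s" "s < b" for s
      proof -
        have "dist (left_version x s) (x s) \<le> dist (left_version x s) (x t) + dist (x s) (x t)"
          by (rule dist_triangle2)
        also have "\<dots> \<le> 1 / (2 * Suc k) + 1 / (2 * Suc k)" using b(2,3)[OF s] by linarith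
        also have "\<dots> = 1 / Suc k" by (simp add: field_simps)
        finally show ?thesis by (simp add: C_def)
      qed
      then show ?thesis using b(1) by blast
    qed
    then obtain b where b: "\<And>t. t \<in> C k \<Longrightarrow> b t > t"
      "\<And>t s. t \<in> C k \<Longrightarrow> t < s \<Longrightarrow> s < b t \<Longrightarrow> s \<notin> C k" by metis
    have "\<exists>r. t < of_rat r \<and> of_rat r < b t" if "t \<in> C k" for t
      using of_rat_dense[OF b(1)[OF that]] by auto
    then obtain r where r: "\<And>t. t \<in> C k \<Longrightarrow> t < of_rat (r t)"
      "\<And>t. t \<in> C k \<Longrightarrow> of_rat (r t) < b t" by metis
    have lt: "r t < r s" if "t \<in> C k" "s \<in> C k" "t < s" for t s
    proof -
      have "b t \<le> s" using b(2)[OF that(1,3)] that(2) by force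
      then have "(of_rat (r t) :: real) < of_rat (r s)" using r(1)[OF that(2)] r(2)[OF that(1)] by linarith
      then show ?thesis by (simp add: of_rat_less)
    qed
    have "inj_on r (C k)"
    proof (rule inj_onI)
      fix s t assume "s \<in> C k" "t \<in> C k" "r s = r t"
      then show "s = t" using lt[of s t] lt[of t s] by force
    qed
    then show ?thesis by (rule countableI')
  qed
  ultimately show ?thesis by auto
qed

lemma exists_continuity_point:
  assumes x: "cadlag x"
  obtains T where "T > c" "T > 0" "isCont x T"
proof -
  have "uncountable ({max c 0<..<max c 0 + 1} - jump_times x)"
    by (intro uncountable_minus_countable countable_jump_times x) (simp add: uncountable_open_interval)
  then obtain T where T: "T \<in> {max c 0<..<max c 0 + 1}" "T \<notin> jump_times x"
    by (metis DiffE countable_empty ex_in_conv)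
  then have "0 < T" by auto
  moreover have "isCont x T"
    using T \<open>0 < T\<close> by (subst isCont_cadlag_iff[OF x]) (auto simp: jump_times_def)
  ultimately show thesis using that T by auto
qed

lemma cadlag_compose:
  assumes x: "cadlag x" and f: "continuous_on UNIV f"
  shows "cadlag (\<lambda>t. f (x t))"
    and "0 \<le> t \<Longrightarrow> left_version (\<lambda>t. f (x t)) t = f (left_version x t)"
proof -
  have lim: "((\<lambda>t. f (x t)) \<longlongrightarrow> f l) F" if "(x \<longlongrightarrow> l) F" for l F
    using f that by (auto intro: continuous_on_tendsto_compose)
  show "cadlag (\<lambda>t. f (x t))"
    unfolding cadlag_def
    by (auto intro!: lim cadlag_right[OF x] exI[of _ "f (left_version x _)"] cadlag_left[OF x])
  show "left_version (\<lambda>t. f (x t)) t = f (left_version x t)" if "0 \<le> t"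
  proof (cases "t = 0")
    case False
    then show ?thesis using that by (intro left_version_eqI lim cadlag_left[OF x]) auto
  qed simp
qed

subsection \<open>Time changes\<close>

definition time_change :: "(real \<Rightarrow> real) \<Rightarrow> bool" where
  "time_change h \<longleftrightarrow> strict_mono_on {0..} h \<and> h ` {0..} = {0..}"

lemma time_change_id: "time_change (\<lambda>s. s)"
  by (simp add: time_change_def strict_mono_on_def)

lemma time_change_nonneg: "time_change h \<Longrightarrow> 0 \<le> s \<Longrightarrow> 0 \<le> h s"
  by (auto simp: time_change_def)

lemma time_change_less: "time_change h \<Longrightarrow> 0 \<le> s \<Longrightarrow> 0 \<le> t \<Longrightarrow> h s < h t \<longleftrightarrow> s < t"
  by (auto simp: time_change_def strict_mono_on_less)

lemma time_change_le: "time_change h \<Longrightarrow> 0 \<le> s \<Longrightarrow> 0 \<le> t \<Longrightarrow> h s \<le> h t \<longleftrightarrow> s \<le> t"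
  by (meson linorder_not_le time_change_less)

lemma time_change_surj:
  assumes "time_change h" "0 \<le> t" obtains s where "0 \<le> s" "h s = t"
  using assms unfolding time_change_def by (metis atLeast_iff imageE)

lemma time_change_0: "time_change h \<Longrightarrow> h 0 = 0"
  by (metis order.refl order_antisym time_change_le time_change_nonneg time_change_surj)

lemma time_change_comp:
  assumes g: "time_change g" and h: "time_change h"
  shows "time_change (g \<circ> h)"
proof -
  have "(g \<circ> h) ` {0..} = g ` h ` {0..}" by (rule image_comp[symmetric])
  moreover have "strict_mono_on {0..} (g \<circ> h)"
    using time_change_less[OF g] time_change_less[OF h] time_change_nonneg[OF h]
    by (auto intro!: strict_mono_onI)
  ultimately show ?thesis using g h by (simp add: time_change_def)
qed

lemma time_change_inverse:
  assumes h: "time_change h"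
  obtains g where "time_change g" "\<And>s. 0 \<le> s \<Longrightarrow> h (g s) = s" "\<And>s. 0 \<le> s \<Longrightarrow> g (h s) = s"
proof -
  define g where "g = inv_into {0..} h"
  have inj: "inj_on h {0..}" using h by (auto simp: time_change_def intro: strict_mono_on_imp_inj_on)
  have hg: "h (g s) = s" if "0 \<le> s" for s
    unfolding g_def using h that by (intro f_inv_into_f) (auto simp: time_change_def)
  have g0: "0 \<le> g s" if "0 \<le> s" for s
    unfolding g_def using inv_into_into[of s h "{0..}"] h that by (auto simp: time_change_def)
  have gh: "g (h s) = s" if "0 \<le> s" for s
    unfolding g_def using inj that by (intro inv_into_f_f) auto
  have "time_change g"
    unfolding time_change_def
  proof (intro conjI strict_mono_onI)
    fix r s :: real assume "r \<in> {0..}" "s \<in> {0..}" "r < s"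
    then show "g r < g s" using time_change_less[OF h, of "g r" "g s"] hg g0 by auto
  next
    show "g ` {0..} = {0..}"
      using gh g0 time_change_nonneg[OF h] by (auto simp: image_iff) (metis atLeast_iff)
  qed
  then show thesis using that hg gh by blast
qed

text \<open>
  An increasing bijection maps one-sided neighbourhoods onto one-sided neighbourhoods.
\<close>

lemma
  assumes h: "time_change h"
  shows time_change_at_right: "0 \<le> t \<Longrightarrow> filterlim h (at_right (h t)) (at_right t)"
    and time_change_at_left: "0 < t \<Longrightarrow> filterlim h (at_left (h t)) (at_left t)"
proof -
  show "filterlim h (at_right (h t)) (at_right t)" if t: "0 \<le> t"
    unfolding filterlim_iff
  proof (intro allI impI)
    fix P assume "eventually P (at_right (h t))"
    then obtain b where b: "h t < b" "\<And>y. h t < y \<Longrightarrow> y < b \<Longrightarrow> P y"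
      by (auto simp: eventually_at_right_field)
    obtain c where c: "0 \<le> c" "h c = b"
      using time_change_surj[OF h, of b] b time_change_nonneg[OF h t] by auto
    then have "t < c" using b t time_change_less[OF h] by auto
    then show "\<forall>\<^sub>F s in at_right t. P (h s)"
      using t c by (intro eventually_at_rightI[of t c] b(2)) (auto simp: time_change_less[OF h])
  qed
  show "filterlim h (at_left (h t)) (at_left t)" if t: "0 < t"
    unfolding filterlim_iff
  proof (intro allI impI)
    fix P assume "eventually P (at_left (h t))"
    then obtain b where b: "b < h t" "\<And>y. b < y \<Longrightarrow> y < h t \<Longrightarrow> P y"
      by (auto simp: eventually_at_left_field)
    have "0 < h t" using time_change_less[OF h, of 0 t] t time_change_0[OF h] by auto
    then obtain c where c: "0 \<le> c" "h c = max b 0"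
      using time_change_surj[OF h, of "max b 0"] by auto
    then have "c < t" using b t time_change_less[OF h, of c t] \<open>0 < h t\<close> by auto
    then show "\<forall>\<^sub>F s in at_left t. P (h s)"
    proof (rule eventually_at_leftI[rotated])
      fix s assume s: "s \<in> {c<..<t}"
      then have "max b 0 < h s" "h s < h t"
        using c t time_change_less[OF h, of c s] time_change_less[OF h, of s t] by auto
      then show "P (h s)" by (intro b(2)) auto
    qed
  qed
qed

lemma
  assumes x: "cadlag x" and h: "time_change h"
  shows cadlag_time_change: "cadlag (x \<circ> h)"
    and left_version_time_change: "0 \<le> t \<Longrightarrow> left_version (x \<circ> h) t = left_version x (h t)"
proof -
  have left: "((x \<circ> h) \<longlongrightarrow> left_version x (h t)) (at_left t)" if "0 < t" for t
    unfolding comp_def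
    using that time_change_less[OF h, of 0 t] time_change_0[OF h]
    by (intro filterlim_compose[OF cadlag_left[OF x] time_change_at_left[OF h]]) auto
  have right: "((x \<circ> h) \<longlongrightarrow> (x \<circ> h) t) (at_right t)" if "0 \<le> t" for t
    unfolding comp_def
    using that time_change_nonneg[OF h]
    by (intro filterlim_compose[OF cadlag_right[OF x] time_change_at_right[OF h]]) auto
  show "cadlag (x \<circ> h)" unfolding cadlag_def using left right by blast
  show "left_version (x \<circ> h) t = left_version x (h t)" if "0 \<le> t"
    using that left_version_eqI[OF left] time_change_0[OF h] by (cases "t = 0") auto
qed

section \<open>Clocks and their inverses\<close>

text \<open>
  A clock starts at 0 so that every time \<open>t \<ge> 0\<close> lies at or after the left limit at its inverse, and is
  unbounded so that the infimum in \<open>inverse_time\<close> is taken over a nonempty set.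
\<close>

definition clock :: "(real \<Rightarrow> real) \<Rightarrow> bool" where
  "clock d \<longleftrightarrow> cadlag d \<and> mono_on {0..} d \<and> d 0 = 0 \<and> (\<forall>c. \<exists>t\<ge>0. c < d t)"

lemma clock_mono: "clock d \<Longrightarrow> 0 \<le> s \<Longrightarrow> s \<le> t \<Longrightarrow> d s \<le> d t"
  by (auto simp: clock_def mono_on_def)

lemma clock_cadlag: "clock d \<Longrightarrow> cadlag d"
  by (simp add: clock_def)

lemma clock_nonneg: "clock d \<Longrightarrow> 0 \<le> s \<Longrightarrow> 0 \<le> d s"
  using clock_mono[of d 0 s] by (simp add: clock_def)

lemma inverse_time_eqI:
  assumes "0 \<le> r" "\<And>r'. 0 \<le> r' \<Longrightarrow> r' < r \<Longrightarrow> d r' \<le> t" "\<And>r'. r < r' \<Longrightarrow> t < d r'"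
  shows "inverse_time d t = r"
  unfolding inverse_time_def
proof (rule cInf_eq_non_empty)
  show "{r. 0 \<le> r \<and> t < d r} \<noteq> {}"
    using assms(1) assms(3)[of "r + 1"] by (auto intro!: exI[of _ "r + 1"])
  show "r \<le> r'" if "r' \<in> {r. 0 \<le> r \<and> t < d r}" for r'
    using that assms(2)[of r'] by force
  show "y \<le> r" if y: "\<And>x. x \<in> {r. 0 \<le> r \<and> t < d r} \<Longrightarrow> y \<le> x" for y
    by (rule dense_ge) (use assms(1,3) in \<open>auto intro!: y\<close>)
qed

context
  fixes d :: "real \<Rightarrow> real" and t :: real
  assumes d: "clock d" and t: "0 \<le> t"
begin

lemma inverse_time_nonneg: "0 \<le> inverse_time d t"
  unfolding inverse_time_def using d by (intro cInf_greatest) (auto simp: clock_def)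

lemma inverse_time_le: "0 \<le> r \<Longrightarrow> t < d r \<Longrightarrow> inverse_time d t \<le> r"
  unfolding inverse_time_def by (intro cInf_lower) (auto intro!: bdd_belowI[of _ 0])

lemma before_inverse_time: "0 \<le> r \<Longrightarrow> r < inverse_time d t \<Longrightarrow> d r \<le> t"
  using inverse_time_le[of r] by force

lemma after_inverse_time:
  assumes "inverse_time d t < r" shows "t < d r"
proof -
  have "\<exists>x\<in>{r. 0 \<le> r \<and> t < d r}. x < r"
    using assms d unfolding inverse_time_def
    by (intro cInf_lessD) (auto simp: clock_def)
  then obtain x where "0 \<le> x" "t < d x" "x < r" by auto
  then show ?thesis using clock_mono[OF d, of x r] by simp
qed

lemma clock_at_inverse_time: "t \<le> d (inverse_time d t)"
proof (rule tendsto_lowerbound)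
  show "(d \<longlongrightarrow> d (inverse_time d t)) (at_right (inverse_time d t))"
    using cadlag_right[OF clock_cadlag[OF d] inverse_time_nonneg] .
  show "\<forall>\<^sub>F r in at_right (inverse_time d t). t \<le> d r"
    using after_inverse_time
    by (intro eventually_at_rightI[of _ "inverse_time d t + 1"]) (auto intro: less_imp_le)
qed simp

lemma left_version_at_inverse_time: "left_version d (inverse_time d t) \<le> t"
proof (cases "inverse_time d t = 0")
  case True
  then show ?thesis using d t by (simp add: clock_def)
next
  case False
  then have pos: "0 < inverse_time d t" using inverse_time_nonneg by simp
  show ?thesis
  proof (rule tendsto_upperbound)
    show "(d \<longlongrightarrow> left_version d (inverse_time d t)) (at_left (inverse_time d t))"
      using cadlag_left[OF clock_cadlag[OF d] pos] .
    show "\<forall>\<^sub>F r in at_left (inverse_time d t). d r \<le> t"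
      using before_inverse_time pos by (intro eventually_at_leftI[of 0]) auto
  qed simp
qed

end

lemma left_version_clock_ge:
  assumes d: "clock d" and r: "0 \<le> r" "r < r'"
  shows "d r \<le> left_version d r'"
proof (rule tendsto_lowerbound)
  show "(d \<longlongrightarrow> left_version d r') (at_left r')"
    using r by (intro cadlag_left clock_cadlag d) auto
  show "\<forall>\<^sub>F s in at_left r'. d r \<le> d s"
    using r clock_mono[OF d] by (intro eventually_at_leftI[of r]) auto
qed simp

lemma left_version_clock_le:
  assumes d: "clock d" and r: "0 \<le> r"
  shows "left_version d r \<le> d r"
proof (cases "r = 0")
  case False
  show ?thesis
  proof (rule tendsto_upperbound)
    show "(d \<longlongrightarrow> left_version d r) (at_left r)"
      using r False by (intro cadlag_left clock_cadlag d) auto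
    show "\<forall>\<^sub>F s in at_left r. d s \<le> d r"
      using r False clock_mono[OF d] by (intro eventually_at_leftI[of 0]) auto
  qed simp
qed simp

lemma inverse_time_in_jump:
  assumes d: "clock d" and r: "0 \<le> r" "left_version d r \<le> t" "t < d r"
  shows "inverse_time d t = r"
proof (rule inverse_time_eqI[OF r(1)])
  show "d r' \<le> t" if "0 \<le> r'" "r' < r" for r'
    using left_version_clock_ge[OF d that] r by simp
  show "t < d r'" if "r < r'" for r'
    using clock_mono[OF d r(1), of r'] that r by simp
qed

text \<open>
  The inverse of the clock stays at \<open>r\<close> while the time is inside a jump of the clock at \<open>r\<close>, and
  enters \<open>(r, \<infinity>)\<close> immediately when the time reaches \<open>d r\<close>. This evaluates all the right limits in
  the limit process.
\<close>

lemma limit_L_formula: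
  fixes a :: "real \<Rightarrow> 'e::real_normed_vector"
  assumes a: "cadlag a" and d: "clock d" and t: "0 \<le> t"
    and flat: "\<And>s s'. 0 \<le> s \<Longrightarrow> 0 \<le> s' \<Longrightarrow> d s = d s' \<Longrightarrow> a s = a s'"
  defines "r \<equiv> inverse_time d t"
  shows "limit_L a d t =
    (if t < d r
     then left_version a r + ((t - left_version d r) / (d r - left_version d r)) *\<^sub>R (a r - left_version a r)
     else a r)"
proof -
  have r0: "0 \<le> r" unfolding r_def by (rule inverse_time_nonneg[OF d t])
  have le: "left_version d r \<le> t" and ge: "t \<le> d r"
    unfolding r_def by (rule left_version_at_inverse_time[OF d t] clock_at_inverse_time[OF d t])+
  show ?thesis
  proof (cases "t < d r")
    case True
    have ev: "\<forall>\<^sub>F s in at_right t. inverse_time d s = r"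
      using True le by (intro eventually_at_rightI[of t "d r"] inverse_time_in_jump[OF d r0]) auto
    have X: "limit_X a d t = left_version a r"
      unfolding limit_X_def by (intro tendsto_Lim tendsto_eventually) (auto intro: eventually_mono[OF ev])
    have G: "limit_G d t = left_version d r"
      unfolding limit_G_def by (intro tendsto_Lim tendsto_eventually) (auto intro: eventually_mono[OF ev])
    show ?thesis
    proof (cases "t \<in> d ` {0..}")
      case range: True
      then obtain r' where r': "0 \<le> r'" "d r' = t" by auto
      have "r' < r" using True clock_mono[OF d r0, of r'] r'(2) by force
      then have "t \<le> left_version d r" using left_version_clock_ge[OF d r'(1)] r'(2) by auto
      then show ?thesis using True le X range by (simp add: limit_L_def)
    next
      case False
      then show ?thesis
        using True X G by (simp add: limit_L_def limit_H_def limit_Y_def r_def)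
    qed
  next
    case False
    then have t_eq: "t = d r" using ge by simp
    have after: "r < inverse_time d s" if "t < s" for s
    proof -
      have s: "0 \<le> s" using that t by simp
      have "r \<le> inverse_time d s"
      proof (rule ccontr)
        assume "\<not> r \<le> inverse_time d s"
        then have "s < d r" by (intro after_inverse_time[OF d s]) simp
        then show False using t_eq that by simp
      qed
      moreover have "r \<noteq> inverse_time d s" using clock_at_inverse_time[OF d s] t_eq that by auto
      ultimately show ?thesis by simp
    qed
    have lim: "filterlim (inverse_time d) (at_right r) (at_right t)"
      unfolding filterlim_iff
    proof (intro allI impI)
      fix P assume "eventually P (at_right r)"
      then obtain b where b: "r < b" "\<And>y. r < y \<Longrightarrow> y < b \<Longrightarrow> P y"
        by (auto simp: eventually_at_right_field)
      define m where "m = (r + b) / 2"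
      have m: "r < m" "m < b" using b(1) by (auto simp: m_def)
      have "t < d m" using after_inverse_time[OF d t] m(1) by (auto simp: r_def)
      then show "\<forall>\<^sub>F s in at_right t. P (inverse_time d s)"
      proof (rule eventually_at_rightI[rotated])
        fix s assume s: "s \<in> {t<..<d m}"
        then have "inverse_time d s \<le> m"
          using m r0 t by (intro inverse_time_le[OF d]) auto
        then show "P (inverse_time d s)" using after[of s] s m by (intro b(2)) auto
      qed
    qed
    have "limit_X a d t = a r"
      unfolding limit_X_def
      by (rule tendsto_Lim[OF _ filterlim_compose[OF left_version_tendsto_right[OF a r0] lim]]) simp
    moreover have "t \<in> d ` {0..}" using t_eq r0 by auto
    ultimately show ?thesis using False by (simp add: limit_L_def)
  qed
qed

lemma inverse_time_cong: "(\<And>s. 0 \<le> s \<Longrightarrow> d s = d' s) \<Longrightarrow> inverse_time d = inverse_time d'"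
  unfolding inverse_time_def by (auto intro!: ext arg_cong[where f = Inf])

section \<open>Continuous parametrization of a path with jumps\<close>

definition strict_clock :: "(real \<Rightarrow> real) \<Rightarrow> bool" where
  "strict_clock \<psi> \<longleftrightarrow> clock \<psi> \<and> strict_mono_on {0..} \<psi>"

lemma strict_clock_clock: "strict_clock \<psi> \<Longrightarrow> clock \<psi>"
  by (simp add: strict_clock_def)

lemma strict_clock_less: "strict_clock \<psi> \<Longrightarrow> 0 \<le> r \<Longrightarrow> r < r' \<Longrightarrow> \<psi> r < \<psi> r'"
  by (auto simp: strict_clock_def strict_mono_on_def)

text \<open>
  The atoms of a probability measure carried by the countable set are the jumps of its distribution
  function; adding the identity makes it strictly increasing and unbounded.
\<close>

lemma strict_clock_exists:
  assumes C: "countable C" "\<And>t. t \<in> C \<Longrightarrow> 0 < t"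
  obtains \<psi> where "strict_clock \<psi>" "C \<subseteq> jump_times \<psi>"
proof -
  \<comment> \<open>A probability measure needs a nonempty carrier; a pause of the clock at a time where nothing
    else jumps is harmless.\<close>
  define C' where "C' = insert 1 C"
  have C': "countable C'" "C' \<noteq> {}" "\<And>t. t \<in> C' \<Longrightarrow> 0 < t" using C by (auto simp: C'_def)
  define p where "p = map_pmf (from_nat_into C') (geometric_pmf (1/2))"
  have set_p: "set_pmf p = C'"
    using C' by (simp add: p_def set_pmf_geometric range_from_nat_into)
  define N where "N = distr (measure_pmf p) borel (\<lambda>x::real. x)"
  interpret N: real_distribution N
    unfolding N_def by (intro prob_space.real_distribution_distr measure_pmf.prob_space_axioms) simp
  have meas: "measure N A = measure p A" if "A \<in> sets borel" for A
    using that by (simp add: N_def measure_distr)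
  define \<psi> where "\<psi> t = t + cdf N t" for t
  have right: "(\<psi> \<longlongrightarrow> \<psi> t) (at_right t)" for t
    unfolding \<psi>_def using N.cdf_is_right_cont[of t]
    by (auto intro!: tendsto_intros simp: continuous_within)
  have left: "(\<psi> \<longlongrightarrow> t + measure N {..<t}) (at_left t)" for t
    unfolding \<psi>_def using N.cdf_at_left[of t] by (auto intro!: tendsto_intros)
  have cad: "cadlag \<psi>" unfolding cadlag_def using left right by blast
  have zero: "\<psi> 0 = 0"
  proof -
    have "{..0} \<inter> set_pmf p = {}" using C'(3) by (force simp: set_p)
    then have "measure p {..0} = 0" by (simp add: measure_pmf_zero_iff Int_commute)
    then show ?thesis by (simp add: \<psi>_def cdf_def meas)
  qed
  have less: "\<psi> s < \<psi> t" if "s < t" for s t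
    using that N.cdf_nondecreasing[of s t] by (simp add: \<psi>_def)
  have unbounded: "\<exists>t\<ge>0. c < \<psi> t" for c
    using N.cdf_nonneg[of "max c 0 + 1"]
    by (intro exI[of _ "max c 0 + 1"]) (auto simp: \<psi>_def)
  have "strict_clock \<psi>"
    unfolding strict_clock_def clock_def
    using cad zero less unbounded
    by (auto simp: mono_on_def strict_mono_on_def le_less)
  moreover have "C \<subseteq> jump_times \<psi>"
  proof
    fix t assume t: "t \<in> C"
    then have t0: "0 < t" by (rule C(2))
    have "measure N {..t} = measure N {..<t} + measure N {t}"
      by (subst N.finite_measure_Union[symmetric]) (auto intro!: arg_cong[where f = "measure N"])
    moreover have "measure N {t} > 0"
      using t set_p by (simp add: meas measure_pmf_single pmf_positive C'_def)
    ultimately show "t \<in> jump_times \<psi>"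
      using t0 left_version_eqI[OF left t0] by (simp add: jump_times_def \<psi>_def cdf_def)
  qed
  ultimately show thesis by (rule that)
qed

text \<open>
  Where \<open>\<psi>\<close> is continuous this is \<open>0 / 0 = 0\<close>.
\<close>

definition jump_fraction :: "(real \<Rightarrow> real) \<Rightarrow> real \<Rightarrow> real" where
  "jump_fraction \<psi> s = (s - left_version \<psi> (inverse_time \<psi> s)) /
     (\<psi> (inverse_time \<psi> s) - left_version \<psi> (inverse_time \<psi> s))"

text \<open>
  The path \<open>x\<close> run at the pace prescribed by \<open>\<psi>\<close>: each jump of \<open>\<psi>\<close> is a time interval during which
  the jump of \<open>x\<close>, if any, is traversed along the straight segment.
\<close>

definition traversal :: "(real \<Rightarrow> 'e::real_normed_vector) \<Rightarrow> (real \<Rightarrow> real) \<Rightarrow> real \<Rightarrow> 'e" where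
  "traversal x \<psi> s =
    (let r = inverse_time \<psi> s in left_version x r + jump_fraction \<psi> s *\<^sub>R (x r - left_version x r))"

context
  fixes \<psi> :: "real \<Rightarrow> real"
  assumes \<psi>: "strict_clock \<psi>"
begin

lemma clock_\<psi>: "clock \<psi>" using \<psi> by (rule strict_clock_clock)

lemma inverse_time_strict:
  assumes r: "0 \<le> r" "left_version \<psi> r \<le> s" "s \<le> \<psi> r"
  shows "inverse_time \<psi> s = r"
proof (rule inverse_time_eqI[OF r(1)])
  show "\<psi> r' \<le> s" if "0 \<le> r'" "r' < r" for r'
    using left_version_clock_ge[OF clock_\<psi> that] r by simp
  show "s < \<psi> r'" if "r < r'" for r'
    using strict_clock_less[OF \<psi> r(1) that] r by simp
qed

lemma jump_fraction_bounds:
  assumes "0 \<le> s" shows "0 \<le> jump_fraction \<psi> s" "jump_fraction \<psi> s \<le> 1"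
  using left_version_at_inverse_time[OF clock_\<psi> assms] clock_at_inverse_time[OF clock_\<psi> assms]
  by (auto simp: jump_fraction_def divide_le_eq_1)

lemma traversal_in_segment:
  assumes "0 \<le> s"
  shows "traversal x \<psi> s \<in> closed_segment (left_version x (inverse_time \<psi> s)) (x (inverse_time \<psi> s))"
  using jump_fraction_bounds[OF assms]
  by (auto simp: traversal_def Let_def in_segment algebra_simps intro!: exI[of _ "jump_fraction \<psi> s"])

lemma traversal_close:
  assumes "0 \<le> s" "dist (left_version x (inverse_time \<psi> s)) c \<le> e" "dist (x (inverse_time \<psi> s)) c \<le> e"
  shows "dist (traversal x \<psi> s) c \<le> e"
proof -
  have "closed_segment (left_version x (inverse_time \<psi> s)) (x (inverse_time \<psi> s)) \<subseteq> cball c e"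
    using assms by (intro closed_segment_subset convex_cball) (auto simp: dist_commute)
  then show ?thesis using traversal_in_segment[OF assms(1), of x] by (auto simp: dist_commute)
qed

lemma inverse_time_mono:
  assumes "0 \<le> s" "s \<le> s'" shows "inverse_time \<psi> s \<le> inverse_time \<psi> s'"
proof (rule ccontr)
  assume "\<not> inverse_time \<psi> s \<le> inverse_time \<psi> s'"
  then obtain r where r: "inverse_time \<psi> s' < r" "r < inverse_time \<psi> s"
    using dense[of "inverse_time \<psi> s'" "inverse_time \<psi> s"] by auto
  then show False
    using after_inverse_time[OF clock_\<psi> _ r(1)] before_inverse_time[OF clock_\<psi> _ _ r(2)]
      inverse_time_nonneg[OF clock_\<psi>, of s'] assms by force
qed

lemma jump_fraction_less:
  assumes "0 \<le> s" "s < s'" "inverse_time \<psi> s = inverse_time \<psi> s'"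
  shows "jump_fraction \<psi> s < jump_fraction \<psi> s'"
proof -
  let ?r = "inverse_time \<psi> s"
  have "left_version \<psi> ?r \<le> s" "s' \<le> \<psi> ?r"
    using left_version_at_inverse_time[OF clock_\<psi>, of s] clock_at_inverse_time[OF clock_\<psi>, of s'] assms
    by auto
  then show ?thesis using assms(2) by (simp add: jump_fraction_def assms(3)[symmetric] divide_strict_right_mono)
qed

lemma traversal_at_clock:
  assumes "jump_times x \<subseteq> jump_times \<psi>" "0 \<le> r"
  shows "inverse_time \<psi> (\<psi> r) = r" "traversal x \<psi> (\<psi> r) = x r"
proof -
  show inv: "inverse_time \<psi> (\<psi> r) = r"
    using left_version_clock_le[OF clock_\<psi>] assms by (intro inverse_time_strict) auto
  show "traversal x \<psi> (\<psi> r) = x r"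
    using assms by (cases "r \<in> jump_times \<psi>") (auto simp: traversal_def jump_fraction_def inv jump_times_def)
qed

lemma traversal_at_left_clock:
  assumes "0 \<le> r"
  shows "inverse_time \<psi> (left_version \<psi> r) = r" "traversal x \<psi> (left_version \<psi> r) = left_version x r"
proof -
  show inv: "inverse_time \<psi> (left_version \<psi> r) = r"
    using left_version_clock_le[OF clock_\<psi>] assms by (intro inverse_time_strict) auto
  show "traversal x \<psi> (left_version \<psi> r) = left_version x r"
    by (simp add: traversal_def jump_fraction_def inv)
qed

lemma traversal_in_jump:
  assumes "0 \<le> r" "r \<in> jump_times \<psi>" "0 \<le> \<theta>" "\<theta> \<le> 1"
  defines "s \<equiv> left_version \<psi> r + \<theta> * (\<psi> r - left_version \<psi> r)"
  shows "inverse_time \<psi> s = r" "jump_fraction \<psi> s = \<theta>" "0 \<le> s"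
proof -
  have lt: "left_version \<psi> r < \<psi> r"
    using assms left_version_clock_le[OF clock_\<psi>, of r] by (force simp: jump_times_def)
  have "\<theta> * (\<psi> r - left_version \<psi> r) \<le> 1 * (\<psi> r - left_version \<psi> r)"
    using assms lt by (intro mult_right_mono) auto
  then have "s \<le> \<psi> r" by (simp add: s_def)
  then show inv: "inverse_time \<psi> s = r"
    using assms(1,3) lt by (intro inverse_time_strict) (auto simp: s_def)
  show "jump_fraction \<psi> s = \<theta>"
    using lt unfolding jump_fraction_def inv by (simp add: s_def)
  have "0 < r" using assms(2) by (rule jump_times_pos)
  then have "0 \<le> left_version \<psi> r"
    using left_version_clock_ge[OF clock_\<psi>, of 0 r] clock_\<psi> by (simp add: clock_def)
  then show "0 \<le> s" using lt assms by (simp add: s_def)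
qed

text \<open>
  Inside a jump of \<open>\<psi>\<close> the traversal is affine. At the end of the jump the traversal is at \<open>x r\<close>,
  and shortly afterwards it lies on segments between values of \<open>x\<close> shortly after \<open>r\<close>; similarly at
  the beginning of the jump.
\<close>

lemma traversal_continuous:
  assumes x: "cadlag x" and jumps: "jump_times x \<subseteq> jump_times \<psi>"
  shows "continuous_on {0..} (traversal x \<psi>)"
proof -
  note d = clock_\<psi>
  have aff: "(traversal x \<psi> \<longlongrightarrow> traversal x \<psi> s) F"
    if "\<forall>\<^sub>F z in F. inverse_time \<psi> z = inverse_time \<psi> s" "((\<lambda>z. z) \<longlongrightarrow> s) F" for s F
  proof -
    let ?r = "inverse_time \<psi> s"
    have "((\<lambda>z. left_version x ?r + ((z - left_version \<psi> ?r) / (\<psi> ?r - left_version \<psi> ?r)) *\<^sub>R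
        (x ?r - left_version x ?r)) \<longlongrightarrow> traversal x \<psi> s) F"
      unfolding traversal_def Let_def jump_fraction_def divide_inverse
      by (intro tendsto_intros that(2))
    then show ?thesis
      by (rule Lim_transform_eventually)
        (use that(1) in eventually_elim, simp add: traversal_def jump_fraction_def Let_def)
  qed
  have right: "(traversal x \<psi> \<longlongrightarrow> traversal x \<psi> s) (at_right s)" if s: "0 \<le> s" for s
  proof -
    let ?r = "inverse_time \<psi> s"
    have r0: "0 \<le> ?r" by (rule inverse_time_nonneg[OF d s])
    show ?thesis
    proof (cases "s < \<psi> ?r")
      case True
      show ?thesis
      proof (rule aff)
        show "\<forall>\<^sub>F z in at_right s. inverse_time \<psi> z = ?r"
          using True left_version_at_inverse_time[OF d s]
          by (intro eventually_at_rightI[of s "\<psi> ?r"] inverse_time_strict r0) auto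
      qed (rule tendsto_ident_at)
    next
      case False
      then have s_eq: "s = \<psi> ?r" using clock_at_inverse_time[OF d s] by simp
      have val: "traversal x \<psi> s = x ?r"
        using traversal_at_clock(2)[OF jumps r0] s_eq by simp
      show ?thesis
        unfolding val
      proof (rule tendstoI)
        fix e :: real assume e: "0 < e"
        obtain b where b: "?r < b" "\<And>z. ?r < z \<Longrightarrow> z < b \<Longrightarrow> dist (x z) (x ?r) \<le> e/2"
          "\<And>z. ?r < z \<Longrightarrow> z < b \<Longrightarrow> dist (left_version x z) (x ?r) \<le> e/2"
          by (rule cadlag_near_right[OF x r0, of "e/2"]) (use e in auto)
        define m where "m = (?r + b) / 2"
        have m: "?r < m" "m < b" using b(1) by (auto simp: m_def)
        have sm: "s < \<psi> m" using strict_clock_less[OF \<psi> r0 m(1)] s_eq by simp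
        show "\<forall>\<^sub>F z in at_right s. dist (traversal x \<psi> z) (x ?r) < e"
        proof (rule eventually_at_rightI[OF _ sm])
          fix z assume z: "z \<in> {s<..<\<psi> m}"
          then have z0: "0 \<le> z" using s by simp
          have "inverse_time \<psi> z \<le> m" using m r0 z z0 by (intro inverse_time_le[OF d]) auto
          moreover have "inverse_time \<psi> z \<noteq> ?r"
            using clock_at_inverse_time[OF d z0] s_eq z by auto
          then have "?r < inverse_time \<psi> z" using inverse_time_mono[of s z] s z by auto
          ultimately have "dist (traversal x \<psi> z) (x ?r) \<le> e/2"
            using m by (intro traversal_close z0 b) auto
          then show "dist (traversal x \<psi> z) (x ?r) < e" using e by simp
        qed
      qed
    qed
  qed
  have left: "(traversal x \<psi> \<longlongrightarrow> traversal x \<psi> s) (at_left s)" if s: "0 < s" for s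
  proof -
    let ?r = "inverse_time \<psi> s"
    have s': "0 \<le> s" using s by simp
    have r0: "0 \<le> ?r" by (rule inverse_time_nonneg[OF d s'])
    show ?thesis
    proof (cases "left_version \<psi> ?r < s")
      case True
      show ?thesis
      proof (rule aff)
        show "\<forall>\<^sub>F z in at_left s. inverse_time \<psi> z = ?r"
          using True clock_at_inverse_time[OF d s']
          by (intro eventually_at_leftI[of "left_version \<psi> ?r" s] inverse_time_strict r0) auto
      qed (rule tendsto_ident_at)
    next
      case False
      then have s_eq: "s = left_version \<psi> ?r" using left_version_at_inverse_time[OF d s'] by simp
      have val: "traversal x \<psi> s = left_version x ?r"
        using traversal_at_left_clock(2)[OF r0, of x] s_eq by simp
      have r1: "0 < ?r" using r0 s s_eq d by (cases "?r = 0") (auto simp: clock_def)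
      show ?thesis
        unfolding val
      proof (rule tendstoI)
        fix e :: real assume e: "0 < e"
        obtain a where a: "0 \<le> a" "a < ?r" "\<And>z. a < z \<Longrightarrow> z < ?r \<Longrightarrow> dist (x z) (left_version x ?r) \<le> e/2"
          "\<And>z. a < z \<Longrightarrow> z < ?r \<Longrightarrow> dist (left_version x z) (left_version x ?r) \<le> e/2"
          by (rule cadlag_near_left[OF x r1, of "e/2"]) (use e in auto)
        define m where "m = (?r + a) / 2"
        have m: "a < m" "m < ?r" using a(2) by (auto simp: m_def)
        have m0: "0 \<le> m" using m a by simp
        define n where "n = (m + ?r) / 2"
        have n: "m < n" "n < ?r" using m(2) by (auto simp: n_def)
        have "\<psi> m < \<psi> n" "\<psi> n \<le> s"
          using strict_clock_less[OF \<psi> m0 n(1)] left_version_clock_ge[OF d _ n(2)] m0 n s_eq by auto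
        then have sm: "\<psi> m < s" by simp
        show "\<forall>\<^sub>F z in at_left s. dist (traversal x \<psi> z) (left_version x ?r) < e"
        proof (rule eventually_at_leftI[OF _ sm])
          fix z assume z: "z \<in> {\<psi> m<..<s}"
          then have z0: "0 \<le> z" using clock_nonneg[OF d m0] by simp
          have "m \<le> inverse_time \<psi> z"
            using inverse_time_mono[of "\<psi> m" z] clock_nonneg[OF d m0] z
              traversal_at_clock(1)[OF jumps m0] by simp
          moreover have "inverse_time \<psi> z \<noteq> ?r"
            using left_version_at_inverse_time[OF d z0] s_eq z by auto
          then have "inverse_time \<psi> z < ?r" using inverse_time_mono[of z s] z0 z by auto
          ultimately have "dist (traversal x \<psi> z) (left_version x ?r) \<le> e/2"
            using m by (intro traversal_close z0 a) auto
          then show "dist (traversal x \<psi> z) (left_version x ?r) < e" using e by simp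
        qed
      qed
    qed
  qed
  show ?thesis
    unfolding continuous_on
  proof
    fix s :: real assume "s \<in> {0..}"
    then consider "s = 0" | "0 < s" by force
    then show "(traversal x \<psi> \<longlongrightarrow> traversal x \<psi> s) (at s within {0..})"
    proof cases
      case 1
      then have "at s within {0..} = at_right s" by (simp add: at_within_Ici_at_right)
      then show ?thesis using right 1 by simp
    next
      case 2
      then have "(traversal x \<psi> \<longlongrightarrow> traversal x \<psi> s) (at s)"
        using left right by (auto simp: filterlim_at_split)
      then show ?thesis by (rule tendsto_mono[OF at_le, rotated]) simp
    qed
  qed
qed

end

section \<open>Curves that trace the completed graph of a path\<close>

text \<open>
  Monotonicity along the completed graph is expressed by betweenness on the stretches where the time
  component \<open>q\<close> stands still: there the space component moves in one direction along a straight
  segment. The path \<open>L\<close> takes the last value of each such stretch, and its left limit is the first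
  value. At time 0 the completed graph has no segment, whence the assumption \<open>start\<close>.
\<close>

locale graph_curve =
  fixes u :: "real \<Rightarrow> 'e::real_normed_vector" and q :: "real \<Rightarrow> real" and L :: "real \<Rightarrow> 'e"
  assumes cont_u: "continuous_on {0..} u" and cont_q: "continuous_on {0..} q"
    and q_mono: "\<And>s s'. 0 \<le> s \<Longrightarrow> s \<le> s' \<Longrightarrow> q s \<le> q s'" and q_0: "q 0 = 0"
    and between: "\<And>s1 s2 s3. 0 \<le> s1 \<Longrightarrow> s1 \<le> s2 \<Longrightarrow> s2 \<le> s3 \<Longrightarrow> q s1 = q s3 \<Longrightarrow>
      u s2 \<in> closed_segment (u s1) (u s3)"
    and start: "\<And>s. 0 \<le> s \<Longrightarrow> q s = 0 \<Longrightarrow> u s = u 0"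
    and last: "\<And>t. 0 \<le> t \<Longrightarrow> \<exists>s\<ge>0. q s = t \<and> L t = u s \<and> (\<forall>s'>s. t < q s')"
begin

definition last_time :: "real \<Rightarrow> real" where
  "last_time t = (SOME s. 0 \<le> s \<and> q s = t \<and> L t = u s \<and> (\<forall>s'>s. t < q s'))"

lemma last_time:
  assumes "0 \<le> t"
  shows "0 \<le> last_time t" "q (last_time t) = t" "u (last_time t) = L t"
    "\<And>s. last_time t < s \<Longrightarrow> t < q s"
  using someI_ex[OF last[OF assms, unfolded Bex_def]] unfolding last_time_def[symmetric] by auto

lemma le_last_time: "0 \<le> t \<Longrightarrow> q s \<le> t \<Longrightarrow> s \<le> last_time t"
  using last_time(4)[of t s] by force

lemma last_time_le: "0 \<le> t \<Longrightarrow> 0 \<le> s \<Longrightarrow> t < q s \<Longrightarrow> last_time t \<le> s"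
  using q_mono[of s "last_time t"] last_time(2)[of t] by force

definition first_time :: "real \<Rightarrow> real" where
  "first_time t = Inf {s. 0 \<le> s \<and> t \<le> q s}"

lemma first_time:
  assumes t: "0 \<le> t"
  shows "0 \<le> first_time t" "q (first_time t) = t" "first_time t \<le> last_time t"
    "\<And>s. 0 \<le> s \<Longrightarrow> s < first_time t \<Longrightarrow> q s < t"
proof -
  define S where "S = {s. 0 \<le> s \<and> t \<le> q s}"
  have "S = {s \<in> {0..}. q s \<in> {t..}}" by (auto simp: S_def)
  moreover have "closed {s \<in> {0..}. q s \<in> {t..}}"
    using continuous_closed_preimage[OF cont_q, of "{t..}"] by (simp add: vimage_def Int_def conj_commute)
  ultimately have cl: "closed S" by simp
  have ne: "last_time t \<in> S" using last_time(1,2)[OF t] by (simp add: S_def)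
  have bdd: "bdd_below S" by (auto simp: S_def intro!: bdd_belowI[of _ 0])
  have "first_time t \<in> S"
    unfolding first_time_def S_def[symmetric] using closed_contains_Inf[OF _ bdd cl] ne by auto
  then show "0 \<le> first_time t" by (simp add: S_def)
  show le: "first_time t \<le> last_time t"
    unfolding first_time_def S_def[symmetric] using ne bdd by (rule cInf_lower)
  show "q (first_time t) = t"
    using \<open>first_time t \<in> S\<close> q_mono[OF _ le] last_time(2)[OF t] by (auto simp: S_def)
  show "q s < t" if "0 \<le> s" "s < first_time t" for s
  proof (rule ccontr)
    assume "\<not> q s < t"
    then have "first_time t \<le> s"
      unfolding first_time_def S_def[symmetric] using that bdd by (intro cInf_lower) (auto simp: S_def)
    then show False using that by simp
  qed
qed

lemma L_right:
  assumes t: "0 \<le> t"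
  shows "(L \<longlongrightarrow> L t) (at_right t)"
proof (rule tendstoI)
  fix e :: real assume e: "0 < e"
  let ?s = "last_time t"
  have s0: "0 \<le> ?s" by (rule last_time(1)[OF t])
  obtain \<eta> where \<eta>: "0 < \<eta>" "\<And>s. 0 \<le> s \<Longrightarrow> dist s ?s < \<eta> \<Longrightarrow> dist (u s) (u ?s) < e"
    using cont_u s0 e unfolding continuous_on_iff by (metis atLeast_iff)
  have "t < q (?s + \<eta> / 2)" using last_time(4)[OF t] \<eta>(1) by simp
  then show "\<forall>\<^sub>F t' in at_right t. dist (L t') (L t) < e"
  proof (rule eventually_at_rightI[rotated])
    fix t' assume t': "t' \<in> {t<..<q (?s + \<eta> / 2)}"
    then have t'0: "0 \<le> t'" using t by simp
    have "?s \<le> last_time t'" using t' last_time(2)[OF t] by (intro le_last_time t'0) auto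
    moreover have "last_time t' \<le> ?s + \<eta> / 2" using t' s0 \<eta>(1) by (intro last_time_le t'0) auto
    ultimately have "dist (last_time t') ?s < \<eta>" using \<eta>(1) by (simp add: dist_real_def)
    then show "dist (L t') (L t) < e"
      using \<eta>(2)[OF last_time(1)[OF t'0]] last_time(3)[OF t] last_time(3)[OF t'0] by simp
  qed
qed

lemma L_left:
  assumes t: "0 < t"
  shows "(L \<longlongrightarrow> u (first_time t)) (at_left t)"
proof (rule tendstoI)
  fix e :: real assume e: "0 < e"
  let ?s = "first_time t"
  have t0: "0 \<le> t" using t by simp
  have s0: "0 \<le> ?s" by (rule first_time(1)[OF t0])
  have s1: "0 < ?s" using s0 first_time(2)[OF t0] q_0 t by (cases "?s = 0") auto
  obtain \<eta> where \<eta>: "0 < \<eta>" "\<And>s. 0 \<le> s \<Longrightarrow> dist s ?s < \<eta> \<Longrightarrow> dist (u s) (u ?s) < e"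
    using cont_u s0 e unfolding continuous_on_iff by (metis atLeast_iff)
  define a where "a = max 0 (?s - \<eta> / 2)"
  have a: "0 \<le> a" "a < ?s" "?s - \<eta> / 2 \<le> a" using s1 \<eta>(1) by (auto simp: a_def)
  have "q a < t" by (rule first_time(4)[OF t0 a(1,2)])
  then show "\<forall>\<^sub>F t' in at_left t. dist (L t') (u ?s) < e"
  proof (rule eventually_at_leftI[rotated])
    fix t' assume t': "t' \<in> {q a<..<t}"
    then have t'0: "0 \<le> t'" using q_mono[of 0 a] q_0 a by simp
    have "a \<le> last_time t'" using t' by (intro le_last_time t'0) auto
    moreover have "last_time t' \<le> ?s" using t' s0 first_time(2)[OF t0] by (intro last_time_le t'0) auto
    ultimately have "dist (last_time t') ?s < \<eta>" using \<eta>(1) a by (simp add: dist_real_def)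
    then show "dist (L t') (u ?s) < e"
      using \<eta>(2)[OF last_time(1)[OF t'0]] last_time(3)[OF t'0] by simp
  qed
qed

lemma cadlag_L: "cadlag L"
  unfolding cadlag_def using L_right L_left by blast

lemma left_version_L: 
  assumes "0 \<le> t" shows "left_version L t = u (first_time t)"
proof (cases "t = 0")
  case True
  then show ?thesis
    using last_time(1,2,3)[of 0] first_time(1,2)[of 0] start[of "first_time 0"] start[of "last_time 0"] by simp
next
  case False
  then show ?thesis using left_version_eqI[OF L_left] assms by simp
qed

lemma between_first_last:
  assumes "0 \<le> s" "q s = t" shows "first_time t \<le> s" "s \<le> last_time t" "0 \<le> t"
proof -
  show t: "0 \<le> t" using q_mono[of 0 s] q_0 assms by simp
  show "first_time t \<le> s" using first_time(4)[OF t, of s] assms by force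
  show "s \<le> last_time t" using le_last_time[OF t] assms by simp
qed

lemma curve_in_segment:
  assumes "0 \<le> s"
  shows "u s \<in> closed_segment (left_version L (q s)) (L (q s))"
proof -
  note b = between_first_last[OF assms refl]
  show ?thesis
    using between[OF first_time(1)[OF b(3)] b(1,2)] first_time(2)[OF b(3)] last_time(2,3)[OF b(3)]
    by (simp add: left_version_L[OF b(3)])
qed

text \<open>
  While the time stands still, the distance from the start of the segment takes all intermediate
  values, and a point of the segment is determined by this distance.
\<close>

lemma segment_in_curve:
  assumes t: "0 \<le> t" and z: "z \<in> closed_segment (left_version L t) (L t)"
  obtains s where "0 \<le> s" "q s = t" "u s = z" "s \<le> last_time t"
proof -
  define p where "p = u (first_time t)"
  define v where "v = L t - p"
  have seg: "closed_segment (left_version L t) (L t) = {p + \<kappa> *\<^sub>R v | \<kappa>. 0 \<le> \<kappa> \<and> \<kappa> \<le> 1}"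
    by (auto simp: left_version_L[OF t] p_def v_def closed_segment_def algebra_simps)
  obtain \<kappa> where \<kappa>: "0 \<le> \<kappa>" "\<kappa> \<le> 1" "z = p + \<kappa> *\<^sub>R v" using z seg by auto
  let ?I = "{first_time t..last_time t}"
  have sub: "?I \<subseteq> {0..}" using first_time(1)[OF t] by auto
  have q_I: "q s = t" if "s \<in> ?I" for s
    using that q_mono[of "first_time t" s] q_mono[of s "last_time t"] first_time(1,2)[OF t] last_time(2)[OF t]
    by auto
  have "continuous_on ?I (\<lambda>s. dist p (u s))"
    by (intro continuous_intros continuous_on_subset[OF cont_u sub])
  moreover have "dist p (u (first_time t)) \<le> \<kappa> * norm v" using \<kappa> by (simp add: p_def)
  moreover have "\<kappa> * norm v \<le> dist p (u (last_time t))"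
    using \<kappa>(1,2) last_time(3)[OF t] by (simp add: v_def dist_norm norm_minus_commute mult_left_le_one_le)
  ultimately obtain s where s: "s \<in> ?I" "dist p (u s) = \<kappa> * norm v"
    using IVT'[of "\<lambda>s. dist p (u s)" "first_time t" "\<kappa> * norm v" "last_time t"] first_time(3)[OF t] by auto
  have s0: "0 \<le> s" using s(1) sub by auto
  have "u s \<in> closed_segment (left_version L t) (L t)"
    using curve_in_segment[OF s0] q_I[OF s(1)] by simp
  then obtain \<mu> where \<mu>: "0 \<le> \<mu>" "u s = p + \<mu> *\<^sub>R v" using seg by auto
  then have "\<mu> * norm v = \<kappa> * norm v" using s(2) by (simp add: dist_norm)
  then have "\<mu> *\<^sub>R v = \<kappa> *\<^sub>R v" by (cases "v = 0") auto
  then have "u s = z" using \<mu>(2) \<kappa>(3) by simp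
  then show thesis using that s0 q_I s(1) by auto
qed

lemma curve_graph_le:
  assumes s: "0 \<le> s" "s \<le> s'" shows "graph_le L (u s, q s) (u s', q s')"
proof (cases "q s = q s'")
  case True
  note b = between_first_last[OF s(1) refl]
  have "u s \<in> closed_segment (u (first_time (q s))) (u s')"
    using first_time[OF b(3)] b s True by (intro between) auto
  then obtain \<kappa> where \<kappa>: "0 \<le> \<kappa>" "\<kappa> \<le> 1"
    "u s = u (first_time (q s)) + \<kappa> *\<^sub>R (u s' - u (first_time (q s)))"
    by (auto simp: in_segment algebra_simps)
  then have "dist (u (first_time (q s))) (u s) \<le> dist (u (first_time (q s))) (u s')"
    by (simp add: dist_norm norm_minus_commute[of _ "u s'"] mult_left_le_one_le)
  then show ?thesis using True left_version_L[OF b(3)] by (simp add: graph_le_def)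
next
  case False
  then show ?thesis using q_mono[OF s] by (simp add: graph_le_def)
qed

text \<open>
  The curve is stopped when it leaves the time interval \<open>[0, T]\<close>. The parameter interval \<open>[0, K]\<close> is
  longer than needed, so that curves that leave at different parameters can share it.
\<close>

lemma parametric_rep_stopped:
  assumes T: "0 < T" and K: "0 \<le> K" "T < q K"
  shows "parametric_rep T L (\<lambda>z. u (min (K * z) (last_time T))) (\<lambda>z. q (min (K * z) (last_time T)))"
proof -
  define m where "m z = min (K * z) (last_time T)" for z
  have T0: "0 \<le> T" using T by simp
  have lK: "last_time T \<le> K" using K by (intro last_time_le) (auto simp: T0)
  have m_ge: "0 \<le> m z" if "0 \<le> z" for z
    using K that last_time(1)[OF T0] by (simp add: m_def)
  have m_cont: "continuous_on {0..1} m"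
    unfolding m_def by (intro continuous_on_min continuous_on_mult continuous_on_const continuous_on_id)
  have m_img: "m ` {0..1} \<subseteq> {0..}"
    by (rule image_subsetI) (simp add: m_ge)
  have cu: "continuous_on {0..1} (\<lambda>z. u (m z))"
    by (rule continuous_on_compose2[OF cont_u m_cont m_img])
  have cq: "continuous_on {0..1} (\<lambda>z. q (m z))"
    by (rule continuous_on_compose2[OF cont_q m_cont m_img])
  have range: "(\<lambda>z. (u (m z), q (m z))) ` {0..1} = completed_graph T L"
  proof safe
    fix z :: real assume z: "z \<in> {0..1}"
    have "0 \<le> q (m z)" using q_mono[OF _ m_ge[of z]] q_0 z by simp
    moreover have "q (m z) \<le> q (last_time T)" using m_ge[of z] z by (intro q_mono) (auto simp: m_def)
    ultimately show "(u (m z), q (m z)) \<in> completed_graph T L"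
      using curve_in_segment[OF m_ge] z last_time(2)[OF T0] by (simp add: completed_graph_def)
  next
    fix z t assume "(z, t) \<in> completed_graph T L"
    then have t: "0 \<le> t" "t \<le> T" and z: "z \<in> closed_segment (left_version L t) (L t)"
      by (auto simp: completed_graph_def)
    obtain s where s: "0 \<le> s" "q s = t" "u s = z" "s \<le> last_time t"
      using segment_in_curve[OF t(1) z] .
    have "last_time t \<le> last_time T" using t last_time(2)[OF t(1)] by (intro le_last_time) auto
    then have sT: "s \<le> last_time T" using s(4) by simp
    have K0: "0 < K" using K T q_0 by (cases "K = 0") auto
    have "m (s / K) = s" using K0 sT by (simp add: m_def)
    moreover have "s / K \<in> {0..1}" using s(1) sT lK K0 by auto
    ultimately show "(z, t) \<in> (\<lambda>z. (u (m z), q (m z))) ` {0..1}"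
      using s by (intro image_eqI[of _ _ "s / K"]) auto
  qed
  have "graph_le L (u (m z), q (m z)) (u (m z'), q (m z'))" if "z \<in> {0..1}" "z' \<in> {0..1}" "z \<le> z'" for z z'
  proof -
    have "K * z \<le> K * z'" using K(1) that(3) by (simp add: mult_left_mono)
    then show ?thesis using that m_ge by (intro curve_graph_le) (auto simp: m_def)
  qed
  then show ?thesis
    unfolding parametric_rep_def m_def[symmetric] using cu cq range by blast
qed

end

text \<open>
  Two curves that are uniformly close are stopped at different parameters. Between these two
  parameters the time is close to \<open>T\<close>, so that near a continuity point \<open>T\<close> nothing moves much.
\<close>

lemma M1_within_if_curves_close:
  fixes u u' :: "real \<Rightarrow> 'e::real_normed_vector"
  assumes c: "graph_curve u q L" and c': "graph_curve u' q' L'"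
    and T: "0 < T" and K: "0 \<le> K" "T < q K" "T < q' K"
    and close: "\<And>s. 0 \<le> s \<Longrightarrow> s \<le> K \<Longrightarrow> dist (u s) (u' s) \<le> e"
      "\<And>s. 0 \<le> s \<Longrightarrow> s \<le> K \<Longrightarrow> \<bar>q s - q' s\<bar> \<le> e"
    and near: "\<And>z t. 0 \<le> t \<Longrightarrow> \<bar>t - T\<bar> \<le> e \<Longrightarrow> z \<in> closed_segment (left_version L t) (L t) \<Longrightarrow> dist z (L T) \<le> \<eta>"
  shows "M1_within T (2 * \<eta> + e) L' L"
proof -
  interpret c: graph_curve u q L by (rule c)
  interpret c': graph_curve u' q' L' by (rule c')
  have T0: "0 \<le> T" using T by simp
  define \<sigma> where "\<sigma> = c.last_time T"
  define \<sigma>' where "\<sigma>' = c'.last_time T"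
  note \<sigma> = c.last_time[OF T0, folded \<sigma>_def] and \<sigma>' = c'.last_time[OF T0, folded \<sigma>'_def]
  have \<sigma>K: "\<sigma> \<le> K" "\<sigma>' \<le> K"
    unfolding \<sigma>_def \<sigma>'_def using K by (auto intro: c.last_time_le c'.last_time_le simp: T0)
  have e0: "0 \<le> e" using close(2)[of 0] K by (simp add: c.q_0 c'.q_0)
  have near_u: "dist (u s) (L T) \<le> \<eta>" if "0 \<le> s" "\<bar>q s - T\<bar> \<le> e" for s
    using that c.curve_in_segment[OF that(1)] c.between_first_last(3)[OF that(1) refl]
    by (intro near[of "q s"]) auto
  have \<eta>0: "0 \<le> \<eta>" using near_u[OF \<sigma>(1)] \<sigma>(2,3) e0 by simp
  have bound: "dist (u' (min s \<sigma>')) (u (min s \<sigma>)) \<le> 2 * \<eta> + e \<and> \<bar>q' (min s \<sigma>') - q (min s \<sigma>)\<bar> \<le> 2 * \<eta> + e"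
    if s: "0 \<le> s" "s \<le> K" for s
  proof
    have q_min: "q (min s \<sigma>) = min (q s) T"
      using c.q_mono[OF s(1), of \<sigma>] \<sigma>(2) \<sigma>(4)[of s] by (auto simp: min_def)
    have q'_min: "q' (min s \<sigma>') = min (q' s) T"
      using c'.q_mono[OF s(1), of \<sigma>'] \<sigma>'(2) \<sigma>'(4)[of s] by (auto simp: min_def)
    show "\<bar>q' (min s \<sigma>') - q (min s \<sigma>)\<bar> \<le> 2 * \<eta> + e"
      unfolding q_min q'_min using close(2)[OF s] \<eta>0 by (auto simp: min_def abs_le_iff)
    show "dist (u' (min s \<sigma>')) (u (min s \<sigma>)) \<le> 2 * \<eta> + e"
    proof -
      consider (same) "min s \<sigma> = min s \<sigma>'" | (less) "min s \<sigma> = \<sigma>" "\<sigma> < min s \<sigma>'" | (greater) "min s \<sigma>' = \<sigma>'" "\<sigma>' < min s \<sigma>"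
        by linarith
      then show ?thesis
      proof cases
        case same
        have "dist (u (min s \<sigma>')) (u' (min s \<sigma>')) \<le> e" using s \<sigma>'(1) by (intro close) auto
        then show ?thesis using same \<eta>0 by (simp add: dist_commute)
      next
        case less
        let ?s = "min s \<sigma>'"
        have s': "0 \<le> ?s" "?s \<le> K" using s \<sigma>'(1) by auto
        have "q' ?s \<le> T" using c'.q_mono[OF s'(1), of \<sigma>'] \<sigma>'(2) by simp
        moreover have "T < q ?s" using \<sigma>(4)[OF less(2)] .
        ultimately have "dist (u ?s) (L T) \<le> \<eta>" using close(2)[OF s'] by (intro near_u s') auto
        moreover have "dist (u' ?s) (L T) \<le> dist (u ?s) (u' ?s) + dist (u ?s) (L T)"
          by (rule dist_triangle3)
        ultimately show ?thesis
          using close(1)[OF s'] less(1) \<sigma>(3) \<eta>0 by simp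
      next
        case greater
        let ?s = "min s \<sigma>"
        have s': "0 \<le> ?s" "?s \<le> K" using s \<sigma>(1) by auto
        have le: "q \<sigma>' \<le> q ?s" "q ?s \<le> T"
          using c.q_mono[OF \<sigma>'(1), of ?s] greater(2) c.q_mono[OF s'(1), of \<sigma>] \<sigma>(2) by auto
        have cl: "\<bar>q \<sigma>' - T\<bar> \<le> e" using close(2)[OF \<sigma>'(1) \<sigma>K(2)] \<sigma>'(2) by simp
        have 1: "dist (u ?s) (L T) \<le> \<eta>" using le cl by (intro near_u s') auto
        have 2: "dist (u \<sigma>') (L T) \<le> \<eta>" using cl by (intro near_u \<sigma>') auto
        have "dist (u' \<sigma>') (u ?s) \<le> dist (u \<sigma>') (u' \<sigma>') + dist (u \<sigma>') (u ?s)"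
          by (rule dist_triangle3)
        also have "dist (u \<sigma>') (u ?s) \<le> dist (u \<sigma>') (L T) + dist (u ?s) (L T)"
          by (rule dist_triangle2)
        finally show ?thesis
          using 1 2 close(1)[OF \<sigma>'(1) \<sigma>K(2)] greater(1) by simp
      qed
    qed
  qed
  show ?thesis
    unfolding M1_within_def
  proof (intro exI conjI ballI)
    show "parametric_rep T L' (\<lambda>z. u' (min (K * z) \<sigma>')) (\<lambda>z. q' (min (K * z) \<sigma>'))"
      unfolding \<sigma>'_def by (rule c'.parametric_rep_stopped[OF T K(1,3)])
    show "parametric_rep T L (\<lambda>z. u (min (K * z) \<sigma>)) (\<lambda>z. q (min (K * z) \<sigma>))"
      unfolding \<sigma>_def by (rule c.parametric_rep_stopped[OF T K(1,2)])
    fix z :: real assume "z \<in> {0..1}"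
    then have "0 \<le> K * z" "K * z \<le> K" using K(1) by (auto simp: mult_left_le)
    from bound[OF this]
    show "dist (u' (min (K * z) \<sigma>')) (u (min (K * z) \<sigma>)) \<le> 2 * \<eta> + e"
      "\<bar>q' (min (K * z) \<sigma>') - q (min (K * z) \<sigma>)\<bar> \<le> 2 * \<eta> + e" by auto
  qed
qed

text \<open>
  The bound \<open>e\<close> depends on the path only and not on a curve that traces its graph; this matters
  because the curve will depend on the path with which \<open>L\<close> is compared.
\<close>

lemma graph_near_continuity_point:
  fixes L :: "real \<Rightarrow> 'e::real_normed_vector"
  assumes L: "cadlag L" and T: "0 < T" and cont: "isCont L T" and \<eta>: "0 < \<eta>"
  obtains e where "0 < e" "\<And>z t. 0 \<le> t \<Longrightarrow> \<bar>t - T\<bar> \<le> e \<Longrightarrow> z \<in> closed_segment (left_version L t) (L t) \<Longrightarrow> dist z (L T) \<le> \<eta>"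
proof -
  obtain d where d: "0 < d" "\<And>t. dist t T < d \<Longrightarrow> dist (L t) (L T) < \<eta>"
    using cont \<eta> unfolding continuous_at_eps_delta by metis
  define e where "e = min (T / 2) (d / 2)"
  have e: "0 < e" using T d(1) by (simp add: e_def)
  show thesis
  proof (rule that[OF e])
    fix z t assume t: "0 \<le> t" "\<bar>t - T\<bar> \<le> e" and z: "z \<in> closed_segment (left_version L t) (L t)"
    define a where "a = max 0 (t - d / 2)"
    have "e \<le> T / 2" "e \<le> d / 2" by (auto simp: e_def)
    then have a: "0 \<le> a" "a < t" "t - d / 2 \<le> a" "t \<le> T + d/2" "T - d/2 \<le> t"
      using t T d(1) by (auto simp: a_def abs_le_iff)
    have "dist (L s) (L T) \<le> \<eta>" if "a < s" "s < t" for s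
    proof -
      have "dist s T < d" using that a by (auto simp: dist_real_def)
      then show ?thesis using d(2) less_imp_le by blast
    qed
    then have "dist (left_version L t) (L T) \<le> \<eta>" by (rule left_version_close[OF L a(1,2)])
    moreover have "dist t T < d" using a d(1) by (auto simp: dist_real_def)
    then have "dist (L t) (L T) < \<eta>" by (rule d(2))
    ultimately have "closed_segment (left_version L t) (L t) \<subseteq> cball (L T) \<eta>"
      by (intro closed_segment_subset convex_cball) (auto simp: dist_commute)
    then show "dist z (L T) \<le> \<eta>" using z by (auto simp: dist_commute)
  qed
qed

section \<open>From space-time paths to spatial paths\<close>

text \<open>
  A jump of the space component may occur while the time component is continuous, but not on a stretch
  where the time component is constant. This is satisfied by the step paths of the walk, because a move
  that takes no time covers no distance, and trivially if the time component is strictly increasing.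
\<close>

definition coupled :: "(real \<Rightarrow> 'e::real_normed_vector \<times> real) \<Rightarrow> bool" where
  "coupled x \<longleftrightarrow> cadlag x \<and> clock (\<lambda>t. snd (x t)) \<and>
    (\<forall>s\<ge>0. \<forall>t\<ge>0. snd (x s) = snd (x t) \<longrightarrow> x s = x t)"

definition spatial_path :: "(real \<Rightarrow> 'e::real_normed_vector \<times> real) \<Rightarrow> real \<Rightarrow> 'e" where
  "spatial_path x = (\<lambda>t\<in>{0..}. limit_L (\<lambda>s. fst (x s)) (\<lambda>s. snd (x s)) t)"

lemmas cadlag_fst = cadlag_compose(1)[OF _ continuous_on_fst[OF continuous_on_id]]
  and cadlag_snd = cadlag_compose(1)[OF _ continuous_on_snd[OF continuous_on_id]]
  and left_version_fst = cadlag_compose(2)[OF _ continuous_on_fst[OF continuous_on_id]]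
  and left_version_snd = cadlag_compose(2)[OF _ continuous_on_snd[OF continuous_on_id]]

lemma spatial_path_formula:
  assumes x: "coupled x" and t: "0 \<le> t"
  defines "r \<equiv> inverse_time (\<lambda>s. snd (x s)) t"
  shows "spatial_path x t =
    (if t < snd (x r)
     then fst (left_version x r) + ((t - snd (left_version x r)) / (snd (x r) - snd (left_version x r))) *\<^sub>R
       (fst (x r) - fst (left_version x r))
     else fst (x r))"
proof -
  have c: "cadlag x" and d: "clock (\<lambda>s. snd (x s))" using x by (auto simp: coupled_def)
  have r: "0 \<le> r" unfolding r_def by (rule inverse_time_nonneg[OF d t])
  have "limit_L (\<lambda>s. fst (x s)) (\<lambda>s. snd (x s)) t = spatial_path x t"
    using t by (simp add: spatial_path_def)
  note L = this
  have flat: "fst (x s) = fst (x s')" if "0 \<le> s" "0 \<le> s'" "snd (x s) = snd (x s')" for s s'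
    using x that by (metis coupled_def)
  show ?thesis
    using limit_L_formula[OF cadlag_fst[OF c] d t flat, folded r_def]
    unfolding L left_version_fst[OF c r] left_version_snd[OF c r] .
qed

lemma affine_between:
  fixes p w :: "'e::real_normed_vector"
  assumes "a \<le> b" "b \<le> c"
  shows "p + b *\<^sub>R w \<in> closed_segment (p + a *\<^sub>R w) (p + c *\<^sub>R w)"
proof -
  have "b \<in> closed_segment a c" using assms by (simp add: closed_segment_eq_real_ivl)
  then obtain k where k: "0 \<le> k" "k \<le> 1" "b = (1 - k) * a + k * c" by (auto simp: in_segment)
  have "p + b *\<^sub>R w = (1 - k) *\<^sub>R (p + a *\<^sub>R w) + k *\<^sub>R (p + c *\<^sub>R w)"
    unfolding k(3) by (simp add: algebra_simps)
  then show ?thesis using k(1,2) by (auto simp: in_segment)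
qed

lemma fst_in_segment:
  assumes "z \<in> closed_segment a b" shows "fst z \<in> closed_segment (fst a) (fst b)"
  using assms by (auto simp: in_segment)

text \<open>
  If the traversal spends a stretch at a constant time, it first completes the jump of \<open>x\<close> that it is
  in, then stays at the constant value of \<open>x\<close>; so it moves along a single segment.
\<close>

lemma graph_curve_traversal:
  fixes x :: "real \<Rightarrow> 'e::real_normed_vector \<times> real"
  assumes x: "coupled x" and \<psi>: "strict_clock \<psi>" and jumps: "jump_times x \<subseteq> jump_times \<psi>"
  shows "graph_curve (\<lambda>s. fst (traversal x \<psi> s)) (\<lambda>s. snd (traversal x \<psi> s)) (spatial_path x)"
proof -
  define U where "U = traversal x \<psi>"
  define d where "d s = snd (x s)" for s
  define \<rho> where "\<rho> = inverse_time \<psi>"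
  define \<theta> where "\<theta> = jump_fraction \<psi>"
  define p where "p = left_version x"
  have c: "cadlag x" and d: "clock d" and flat: "\<And>s t. 0 \<le> s \<Longrightarrow> 0 \<le> t \<Longrightarrow> d s = d t \<Longrightarrow> x s = x t"
    using x unfolding coupled_def d_def by blast+
  have \<psi>c: "clock \<psi>" by (rule strict_clock_clock[OF \<psi>])
  have U_eq: "U s = p (\<rho> s) + \<theta> s *\<^sub>R (x (\<rho> s) - p (\<rho> s))" for s
    by (simp add: U_def p_def \<rho>_def \<theta>_def traversal_def Let_def)
  have \<rho>0: "0 \<le> \<rho> s" if "0 \<le> s" for s unfolding \<rho>_def by (rule inverse_time_nonneg[OF \<psi>c that])
  have \<rho>_mono: "\<rho> s \<le> \<rho> s'" if "0 \<le> s" "s \<le> s'" for s s'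
    unfolding \<rho>_def by (rule inverse_time_mono[OF \<psi> that])
  have \<theta>01: "0 \<le> \<theta> s" "\<theta> s \<le> 1" if "0 \<le> s" for s
    unfolding \<theta>_def by (rule jump_fraction_bounds[OF \<psi> that])+
  have \<theta>_less: "\<theta> s < \<theta> s'" if "0 \<le> s" "s < s'" "\<rho> s = \<rho> s'" for s s'
    using jump_fraction_less[OF \<psi>] that unfolding \<theta>_def \<rho>_def by blast
  have \<theta>_le: "\<theta> s \<le> \<theta> s'" if "0 \<le> s" "s \<le> s'" "\<rho> s = \<rho> s'" for s s'
    using \<theta>_less[of s s'] that by (cases "s = s'") auto
  have p_snd: "snd (p r) = left_version d r" if "0 \<le> r" for r
    unfolding p_def d_def by (rule left_version_snd[OF c that, symmetric])
  have p_le: "snd (p r) \<le> d r" if "0 \<le> r" for r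
    using p_snd that left_version_clock_le[OF d] by simp
  have p_ge: "d r \<le> snd (p r')" if "0 \<le> r" "r < r'" for r r'
    using p_snd[of r'] that left_version_clock_ge[OF d that] by simp
  have q_eq: "snd (U s) = snd (p (\<rho> s)) + \<theta> s * (d (\<rho> s) - snd (p (\<rho> s)))" for s
    by (simp add: U_eq d_def)
  have q_bounds: "snd (p (\<rho> s)) \<le> snd (U s)" "snd (U s) \<le> d (\<rho> s)" if s: "0 \<le> s" for s
  proof -
    have le: "0 \<le> d (\<rho> s) - snd (p (\<rho> s))" using p_le[OF \<rho>0[OF s]] by simp
    show "snd (p (\<rho> s)) \<le> snd (U s)" unfolding q_eq using le \<theta>01[OF s] by simp
    show "snd (U s) \<le> d (\<rho> s)" unfolding q_eq using mult_right_mono[OF \<theta>01(2)[OF s] le] by simp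
  qed
  have q_mono: "snd (U s) \<le> snd (U s')" if s: "0 \<le> s" "s \<le> s'" for s s'
  proof (cases "\<rho> s = \<rho> s'")
    case True
    then show ?thesis
      unfolding q_eq using \<theta>_le[OF s True] p_le[OF \<rho>0[of s']] s by (simp add: mult_right_mono)
  next
    case False
    then have "\<rho> s < \<rho> s'" using \<rho>_mono[OF s] by simp
    then show ?thesis using p_ge[OF \<rho>0[OF s(1)], of "\<rho> s'"] q_bounds[of s] q_bounds[of s'] s by simp
  qed
  have stay: "U s' = x (\<rho> s)" if s: "0 \<le> s" "s \<le> s'" "\<rho> s < \<rho> s'" "snd (U s) = snd (U s')" for s s'
  proof -
    have \<rho>s: "0 \<le> \<rho> s" and s': "0 \<le> s'" and \<rho>s': "0 \<le> \<rho> s'" using s \<rho>0 by auto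
    have t: "d (\<rho> s) = snd (U s')" "snd (p (\<rho> s')) = snd (U s')"
      using p_ge[OF \<rho>s s(3)] q_bounds[OF s(1)] q_bounds[OF s'] s(4) by auto
    have "x z = x (\<rho> s)" if z: "\<rho> s < z" "z < \<rho> s'" for z
    proof (rule flat)
      show "d z = d (\<rho> s)"
        using clock_mono[OF d \<rho>s, of z] p_ge[OF _ z(2)] z \<rho>s t by auto
    qed (use z \<rho>s in auto)
    then have "\<forall>\<^sub>F z in at_left (\<rho> s'). x (\<rho> s) = x z"
      using s(3) by (intro eventually_at_leftI[of "\<rho> s"]) auto
    then have "(x \<longlongrightarrow> x (\<rho> s)) (at_left (\<rho> s'))"
      by (intro tendsto_eventually) (simp add: eq_commute)
    then have p: "p (\<rho> s') = x (\<rho> s)"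
      unfolding p_def using s(3) \<rho>s by (intro left_version_eqI) auto
    show ?thesis
    proof (cases "d (\<rho> s') = d (\<rho> s)")
      case True
      then have "x (\<rho> s') = x (\<rho> s)" by (intro flat \<rho>s \<rho>s')
      then show ?thesis by (simp add: U_eq p)
    next
      case False
      moreover have "d (\<rho> s) = d (\<rho> s) + \<theta> s' * (d (\<rho> s') - d (\<rho> s))"
        using q_eq[of s', unfolded t(2), folded t(1)] .
      ultimately have "\<theta> s' = 0" by simp
      then show ?thesis by (simp add: U_eq p)
    qed
  qed
  have U_between: "U s2 \<in> closed_segment (U s1) (U s3)"
    if s: "0 \<le> s1" "s1 \<le> s2" "s2 \<le> s3" "snd (U s1) = snd (U s3)" for s1 s2 s3
  proof -
    have s20: "0 \<le> s2" using s by simp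
    consider "\<rho> s1 = \<rho> s3" | "\<rho> s1 < \<rho> s3" "\<rho> s1 = \<rho> s2" | "\<rho> s1 < \<rho> s2"
      using \<rho>_mono[OF s(1,2)] \<rho>_mono[OF s20 s(3)] by linarith
    then show ?thesis
    proof cases
      case 1
      then have eq: "\<rho> s2 = \<rho> s1" "\<rho> s3 = \<rho> s1" using \<rho>_mono[OF s(1,2)] \<rho>_mono[OF s20 s(3)] by auto
      show ?thesis
        unfolding U_eq eq using eq s s20 by (intro affine_between \<theta>_le) auto
    next
      case 2
      have "U s3 = x (\<rho> s1)" using s 2 by (intro stay[of s1 s3]) auto
      then have U3: "U s3 = p (\<rho> s1) + 1 *\<^sub>R (x (\<rho> s1) - p (\<rho> s1))" by simp
      show ?thesis
        unfolding U3 unfolding U_eq 2(2)[symmetric] using 2 s s20 by (intro affine_between \<theta>_le \<theta>01) auto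
    next
      case 3
      have "snd (U s1) = snd (U s2)" using q_mono[OF s(1,2)] q_mono[OF s20 s(3)] s(4) by simp
      then have "U s2 = x (\<rho> s1)" by (rule stay[OF s(1,2) 3])
      moreover have "\<rho> s1 < \<rho> s3" using 3 \<rho>_mono[OF s20 s(3)] by simp
      then have "U s3 = x (\<rho> s1)" using s by (intro stay) auto
      ultimately show ?thesis by simp
    qed
  qed
  have \<rho>_0: "\<rho> 0 = 0" and U_0: "U 0 = x 0"
    using traversal_at_left_clock(1)[OF \<psi>, of 0] traversal_at_left_clock(2)[OF \<psi>, of 0 x] \<psi>c
    by (auto simp: \<rho>_def U_def clock_def)
  show ?thesis
    unfolding U_def[symmetric]
  proof (unfold_locales)
    have U_cont: "continuous_on {0..} U"
      unfolding U_def by (rule traversal_continuous[OF \<psi> c jumps])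
    show "continuous_on {0..} (\<lambda>s. fst (U s))" "continuous_on {0..} (\<lambda>s. snd (U s))"
      by (intro continuous_intros U_cont)+
    show "snd (U s) \<le> snd (U s')" if "0 \<le> s" "s \<le> s'" for s s' using that by (rule q_mono)
    show q0: "snd (U 0) = 0" using d by (simp add: U_0 clock_def d_def)
    show "fst (U s2) \<in> closed_segment (fst (U s1)) (fst (U s3))"
      if "0 \<le> s1" "s1 \<le> s2" "s2 \<le> s3" "snd (U s1) = snd (U s3)" for s1 s2 s3
      by (rule fst_in_segment[OF U_between[OF that]])
    show "fst (U s) = fst (U 0)" if s: "0 \<le> s" "snd (U s) = 0" for s
    proof (cases "\<rho> s = 0")
      case True
      then have "U s = x 0" by (simp add: U_eq[of s] p_def)
      then show ?thesis by (simp add: U_0)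
    next
      case False
      then have "\<rho> 0 < \<rho> s" using \<rho>0[OF s(1)] \<rho>_0 by simp
      then show ?thesis using stay[of 0 s] s q0 \<rho>_0 U_0 by simp
    qed
    fix t :: real assume t: "0 \<le> t"
    define r where "r = inverse_time d t"
    have r0: "0 \<le> r" unfolding r_def by (rule inverse_time_nonneg[OF d t])
    have le: "snd (p r) \<le> t"
      unfolding p_snd[OF r0] unfolding r_def by (rule left_version_at_inverse_time[OF d t])
    have ge: "t \<le> d r" unfolding r_def by (rule clock_at_inverse_time[OF d t])
    have L: "spatial_path x t = (if t < d r then fst (p r) + ((t - snd (p r)) / (d r - snd (p r))) *\<^sub>R
       (fst (x r) - fst (p r)) else fst (x r))"
      using spatial_path_formula[OF x t] by (simp add: r_def d_def[abs_def] p_def)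
    show "\<exists>s\<ge>0. snd (U s) = t \<and> spatial_path x t = fst (U s) \<and> (\<forall>s'>s. t < snd (U s'))"
    proof (cases "t < d r")
      case True
      define \<kappa> where "\<kappa> = (t - snd (p r)) / (d r - snd (p r))"
      have \<kappa>: "0 \<le> \<kappa>" "\<kappa> \<le> 1" using True le by (auto simp: \<kappa>_def divide_le_eq_1)
      have "p r \<noteq> x r" using True le by (auto simp: d_def)
      then have "r \<in> jump_times \<psi>" using jumps r0 by (auto simp: jump_times_def p_def)
      from traversal_in_jump[OF \<psi> r0 this \<kappa>] obtain s where
        s: "\<rho> s = r" "\<theta> s = \<kappa>" "0 \<le> s" unfolding \<rho>_def \<theta>_def by blast
      have Us: "snd (U s) = t" using True le by (simp add: q_eq s \<kappa>_def)
      have "t < snd (U s')" if s': "s < s'" for s'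
      proof (cases "\<rho> s' = r")
        case eq: True
        then have "\<theta> s < \<theta> s'" using \<theta>_less[of s s'] s s' by simp
        then have "\<theta> s * (d r - snd (p r)) < \<theta> s' * (d r - snd (p r))"
          using True le by (intro mult_strict_right_mono) auto
        then show ?thesis using Us unfolding q_eq eq s by simp
      next
        case False
        then have "r < \<rho> s'" using \<rho>_mono[of s s'] s s' by simp
        then show ?thesis using p_ge[OF r0, of "\<rho> s'"] q_bounds[of s'] s s' True by simp
      qed
      moreover have "spatial_path x t = fst (U s)"
        using True by (simp add: L U_eq s \<kappa>_def)
      ultimately show ?thesis using s Us by blast
    next
      case False
      then have t_eq: "d r = t" using ge by simp
      have s: "0 \<le> \<psi> r" "\<rho> (\<psi> r) = r" "U (\<psi> r) = x r"
        unfolding \<rho>_def U_def using traversal_at_clock[OF \<psi> jumps r0] clock_nonneg[OF \<psi>c r0] by auto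
      have "t < snd (U s')" if s': "\<psi> r < s'" for s'
      proof -
        have s'0: "0 \<le> s'" using s s' by simp
        have "\<rho> s' \<noteq> r" using clock_at_inverse_time[OF \<psi>c s'0] s' by (auto simp: \<rho>_def)
        then have lt: "r < \<rho> s'" using \<rho>_mono[of "\<psi> r" s'] s s' by simp
        define m where "m = (r + \<rho> s') / 2"
        have m: "r < m" "m < \<rho> s'" using lt by (auto simp: m_def)
        have "t < d m" using m(1) unfolding r_def by (rule after_inverse_time[OF d t])
        then show ?thesis using p_ge[OF _ m(2)] q_bounds[OF s'0] r0 m(1) by simp
      qed
      then show ?thesis
        using s t_eq False by (intro exI[of _ "\<psi> r"]) (simp add: L d_def)
    qed
  qed
qed

lemma cadlag_spatial_path:
  assumes x: "coupled x"
  shows "cadlag (spatial_path x)"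
proof -
  have c: "cadlag x" using x by (simp add: coupled_def)
  obtain \<psi> where "strict_clock \<psi>" "jump_times x \<subseteq> jump_times \<psi>"
    using strict_clock_exists[OF countable_jump_times[OF c] jump_times_pos] .
  then interpret graph_curve "\<lambda>s. fst (traversal x \<psi> s)" "\<lambda>s. snd (traversal x \<psi> s)" "spatial_path x"
    by (rule graph_curve_traversal[OF x])
  show ?thesis by (rule cadlag_L)
qed

lemma spatial_path_in_cadlag_paths: "coupled x \<Longrightarrow> spatial_path x \<in> cadlag_paths"
  using cadlag_spatial_path by (auto simp: cadlag_paths_iff spatial_path_def)

text \<open>The spatial path depends on the space-time curve only up to reparametrization.\<close>

lemma
  assumes x: "coupled x" and h: "time_change h"
  shows coupled_time_change: "coupled (x \<circ> h)"
    and spatial_path_time_change: "spatial_path (x \<circ> h) = spatial_path x"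
proof -
  have c: "cadlag x" and d: "clock (\<lambda>s. snd (x s))"
    and flat: "\<And>s t. 0 \<le> s \<Longrightarrow> 0 \<le> t \<Longrightarrow> snd (x s) = snd (x t) \<Longrightarrow> x s = x t"
    using x unfolding coupled_def by blast+
  have c': "cadlag (x \<circ> h)" by (rule cadlag_time_change[OF c h])
  have "\<exists>t\<ge>0. b < snd (x (h t))" for b
  proof -
    obtain s where "0 \<le> s" "b < snd (x s)" using d by (auto simp: clock_def)
    then show ?thesis using time_change_surj[OF h] by metis
  qed
  then have "clock (\<lambda>s. snd ((x \<circ> h) s))"
    using cadlag_snd[OF c'] d time_change_0[OF h] time_change_le[OF h] time_change_nonneg[OF h]
    by (auto simp: clock_def mono_on_def)
  then show xh: "coupled (x \<circ> h)"
    using c' flat time_change_nonneg[OF h] by (auto simp: coupled_def)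
  obtain g where g: "time_change g" "\<And>s. 0 \<le> s \<Longrightarrow> h (g s) = s" "\<And>s. 0 \<le> s \<Longrightarrow> g (h s) = s"
    by (rule time_change_inverse[OF h]) blast
  show "spatial_path (x \<circ> h) = spatial_path x"
  proof
    fix t
    show "spatial_path (x \<circ> h) t = spatial_path x t"
    proof (cases "0 \<le> t")
      case t: True
      define r where "r = inverse_time (\<lambda>s. snd (x s)) t"
      have r0: "0 \<le> r" unfolding r_def by (rule inverse_time_nonneg[OF d t])
      have g0: "0 \<le> g r" by (rule time_change_nonneg[OF g(1) r0])
      have inv: "inverse_time (\<lambda>s. snd ((x \<circ> h) s)) t = g r"
      proof (rule inverse_time_eqI[OF g0])
        fix r' :: real
        show "snd ((x \<circ> h) r') \<le> t" if "0 \<le> r'" "r' < g r"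
          using that time_change_less[OF h that(1) g0] g(2)[OF r0] time_change_nonneg[OF h that(1)]
            before_inverse_time[OF d t, of "h r'"] by (simp add: r_def)
        show "t < snd ((x \<circ> h) r')" if "g r < r'"
          using that time_change_less[OF h g0, of r'] g(2)[OF r0] g0
            after_inverse_time[OF d t, of "h r'"] by (simp add: r_def)
      qed
      show ?thesis
        unfolding spatial_path_formula[OF xh t] spatial_path_formula[OF x t] inv
          left_version_time_change[OF c h g0]
        by (simp add: g(2)[OF r0] r_def[symmetric])
    qed (simp add: spatial_path_def)
  qed
qed

section \<open>Closeness up to a time change and continuity of the spatial path\<close>

text \<open>
  Closeness up to the horizon \<open>1 / e\<close>. Requiring the bound when \<open>s\<close> or \<open>h s\<close> is within the horizon makes
  the notion symmetric, the inverse of \<open>h\<close> being used for the opposite direction.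
\<close>

definition J1_near :: "real \<Rightarrow> (real \<Rightarrow> 'e::metric_space) \<Rightarrow> (real \<Rightarrow> 'e) \<Rightarrow> bool" where
  "J1_near e x y \<longleftrightarrow> (\<exists>h. time_change h \<and>
    (\<forall>s\<ge>0. s \<le> 1 / e \<or> h s \<le> 1 / e \<longrightarrow> \<bar>h s - s\<bar> \<le> e \<and> dist (x (h s)) (y s) \<le> e))"

lemma M1_within_mono: "M1_within T e x y \<Longrightarrow> e \<le> e' \<Longrightarrow> M1_within T e' x y"
  unfolding M1_within_def by (meson order_trans)

lemma dist_interpolation_le:
  fixes a b a' b' :: "'e::real_normed_vector"
  assumes "0 \<le> \<kappa>" "\<kappa> \<le> 1" "dist a a' \<le> e" "dist b b' \<le> e"
  shows "dist (a + \<kappa> *\<^sub>R (b - a)) (a' + \<kappa> *\<^sub>R (b' - a')) \<le> e"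
proof -
  have "(a + \<kappa> *\<^sub>R (b - a)) - (a' + \<kappa> *\<^sub>R (b' - a')) = (1 - \<kappa>) *\<^sub>R (a - a') + \<kappa> *\<^sub>R (b - b')"
    by (simp add: algebra_simps)
  then have "dist (a + \<kappa> *\<^sub>R (b - a)) (a' + \<kappa> *\<^sub>R (b' - a')) \<le> (1 - \<kappa>) * dist a a' + \<kappa> * dist b b'"
    using norm_triangle_ineq[of "(1 - \<kappa>) *\<^sub>R (a - a')" "\<kappa> *\<^sub>R (b - b')"] assms(1,2)
    by (simp add: dist_norm)
  also have "\<dots> \<le> (1 - \<kappa>) * e + \<kappa> * e"
    using assms by (intro add_mono mult_left_mono) auto
  finally show ?thesis by (simp add: algebra_simps)
qed

text \<open>
  After a time change the two space-time paths are uniformly close, including their left limits, so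
  they can be traversed at the same pace. The clock for this has to pause at the jumps of both paths.
  It depends on \<open>y\<close>, while \<open>e0\<close> does not.
\<close>

lemma spatial_path_continuous:
  fixes x :: "real \<Rightarrow> 'e::real_normed_vector \<times> real"
  assumes x: "coupled x" and T: "0 < T" "isCont (spatial_path x) T" and \<epsilon>: "0 < \<epsilon>"
  obtains e0 where "0 < e0"
    "\<And>y e. coupled y \<Longrightarrow> 0 < e \<Longrightarrow> e \<le> e0 \<Longrightarrow> J1_near e y x \<Longrightarrow> M1_within T \<epsilon> (spatial_path y) (spatial_path x)"
proof -
  have cx: "cadlag x" using x by (simp add: coupled_def)
  have "clock (\<lambda>t. snd (x t))" using x by (simp add: coupled_def)
  then obtain R where R: "0 \<le> R" "T + 1 < snd (x R)" unfolding clock_def by blast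
  obtain e1 where e1: "0 < e1" "\<And>z t. 0 \<le> t \<Longrightarrow> \<bar>t - T\<bar> \<le> e1 \<Longrightarrow>
      z \<in> closed_segment (left_version (spatial_path x) t) (spatial_path x t) \<Longrightarrow> dist z (spatial_path x T) \<le> \<epsilon> / 4"
    by (rule graph_near_continuity_point[OF cadlag_spatial_path[OF x] T, of "\<epsilon> / 4"]) (use \<epsilon> in auto)
  \<comment> \<open>The horizon \<open>1 / e\<close> has to reach the time \<open>R\<close> by which both curves have left \<open>[0, T]\<close>.\<close>
  define e0 where "e0 = Min {e1, \<epsilon> / 4, 1 / 2, 1 / (R + 1)}"
  show thesis
  proof (rule that)
    show "0 < e0" using e1 \<epsilon> R by (simp add: e0_def)
    fix y e assume y: "coupled y" and e: "0 < e" "e \<le> e0" and near: "J1_near e y x"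
    have e_le: "e \<le> e1" "e \<le> \<epsilon> / 4" "e \<le> 1 / 2" "e \<le> 1 / (R + 1)" using e(2) by (auto simp: e0_def)
    have Re: "R \<le> 1 / e"
    proof -
      have "e * (R + 1) \<le> 1" using e_le(4) R(1) by (simp add: pos_le_divide_eq)
      then show ?thesis using e(1) by (simp add: pos_le_divide_eq algebra_simps)
    qed
    obtain h where h: "time_change h"
      "\<And>s. 0 \<le> s \<Longrightarrow> s \<le> 1 / e \<or> h s \<le> 1 / e \<Longrightarrow> \<bar>h s - s\<bar> \<le> e \<and> dist (y (h s)) (x s) \<le> e"
      using near unfolding J1_near_def by blast
    define y' where "y' = y \<circ> h"
    have y': "coupled y'" and L_eq: "spatial_path y' = spatial_path y"
      unfolding y'_def by (rule coupled_time_change[OF y h(1)] spatial_path_time_change[OF y h(1)])+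
    have cy: "cadlag y'" using y' by (simp add: coupled_def)
    obtain \<psi> where \<psi>: "strict_clock \<psi>" and jumps: "jump_times x \<union> jump_times y' \<subseteq> jump_times \<psi>"
      using strict_clock_exists[of "jump_times x \<union> jump_times y'"] countable_jump_times[OF cx]
        countable_jump_times[OF cy] by (metis UnE countable_Un jump_times_pos)
    have \<psi>c: "clock \<psi>" by (rule strict_clock_clock[OF \<psi>])
    have jx: "jump_times x \<subseteq> jump_times \<psi>" and jy: "jump_times y' \<subseteq> jump_times \<psi>" using jumps by auto
    have near_R: "dist (y' s) (x s) \<le> e" if "0 \<le> s" "s \<le> R" for s
      using h(2)[OF that(1)] that Re by (simp add: y'_def)
    have near_R_left: "dist (left_version y' s) (left_version x s) \<le> e" if "0 \<le> s" "s \<le> R" for s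
      by (rule left_version_close2[OF cy cx that(1)]) (use that near_R in auto)
    define K where "K = \<psi> R"
    have K0: "0 \<le> K" unfolding K_def by (rule clock_nonneg[OF \<psi>c R(1)])
    have close: "dist (traversal x \<psi> s) (traversal y' \<psi> s) \<le> e" if s: "0 \<le> s" "s \<le> K" for s
    proof -
      have "inverse_time \<psi> s \<le> R"
        using inverse_time_mono[OF \<psi> s] traversal_at_clock(1)[OF \<psi> jx R(1)] by (simp add: K_def)
      moreover have "0 \<le> inverse_time \<psi> s" by (rule inverse_time_nonneg[OF \<psi>c s(1)])
      ultimately have "dist (traversal y' \<psi> s) (traversal x \<psi> s) \<le> e"
        unfolding traversal_def Let_def
        by (intro dist_interpolation_le jump_fraction_bounds[OF \<psi> s(1)] near_R near_R_left) auto
      then show ?thesis by (simp add: dist_commute)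
    qed
    have close': "\<bar>snd (traversal x \<psi> s) - snd (traversal y' \<psi> s)\<bar> \<le> e" if s: "0 \<le> s" "s \<le> K" for s
      using dist_snd_le[of "traversal x \<psi> s" "traversal y' \<psi> s"] close[OF s] by (simp add: dist_real_def)
    have K1: "T + 1 < snd (traversal x \<psi> K)"
      using R(2) traversal_at_clock(2)[OF \<psi> jx R(1)] by (simp add: K_def)
    then have K2: "T < snd (traversal y' \<psi> K)" using close'[OF K0 order.refl] e_le(3) by (simp add: abs_le_iff)
    have "M1_within T (2 * (\<epsilon> / 4) + e) (spatial_path y') (spatial_path x)"
    proof (rule M1_within_if_curves_close[OF graph_curve_traversal[OF x \<psi> jx] graph_curve_traversal[OF y' \<psi> jy] T(1) K0])
      show "dist (fst (traversal x \<psi> s)) (fst (traversal y' \<psi> s)) \<le> e" if "0 \<le> s" "s \<le> K" for s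
        using dist_fst_le[of "traversal x \<psi> s" "traversal y' \<psi> s"] close[OF that] by simp
      show "dist z (spatial_path x T) \<le> \<epsilon> / 4"
        if "0 \<le> t" "\<bar>t - T\<bar> \<le> e" "z \<in> closed_segment (left_version (spatial_path x) t) (spatial_path x t)" for z t
        using that e_le by (intro e1(2)[of t]) auto
    qed (use K1 K2 close' in auto)
    then show "M1_within T \<epsilon> (spatial_path y) (spatial_path x)"
      unfolding L_eq by (rule M1_within_mono) (use e_le \<epsilon> in simp)
  qed
qed

lemma J1_near_sym:
  assumes "J1_near e x y" shows "J1_near e y x"
proof -
  obtain h where h: "time_change h"
    "\<And>s. 0 \<le> s \<Longrightarrow> s \<le> 1 / e \<or> h s \<le> 1 / e \<Longrightarrow> \<bar>h s - s\<bar> \<le> e \<and> dist (x (h s)) (y s) \<le> e"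
    using assms unfolding J1_near_def by blast
  obtain g where g: "time_change g" "\<And>s. 0 \<le> s \<Longrightarrow> h (g s) = s"
    by (rule time_change_inverse[OF h(1)]) blast
  have "\<bar>g s - s\<bar> \<le> e \<and> dist (y (g s)) (x s) \<le> e" if "0 \<le> s" "s \<le> 1 / e \<or> g s \<le> 1 / e" for s
    using h(2)[OF time_change_nonneg[OF g(1) that(1)]] that(2) g(2)[OF that(1)]
    by (auto simp: dist_commute abs_minus_commute)
  then show ?thesis using g(1) unfolding J1_near_def by blast
qed

text \<open>
  The horizons \<open>1 / e\<close> shrink fast enough for this: a time before \<open>1 / (e + e')\<close> is moved by at most \<open>e'\<close>
  and then lies before \<open>1 / e\<close>.
\<close>

lemma J1_near_trans:
  assumes xy: "J1_near e x y" and yz: "J1_near e' y z" and e: "0 < e" "0 < e'" "e + e' \<le> 1"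
  shows "J1_near (e + e') x z"
proof -
  obtain h where h: "time_change h"
    "\<And>s. 0 \<le> s \<Longrightarrow> s \<le> 1 / e \<or> h s \<le> 1 / e \<Longrightarrow> \<bar>h s - s\<bar> \<le> e \<and> dist (x (h s)) (y s) \<le> e"
    using xy unfolding J1_near_def by blast
  obtain k where k: "time_change k"
    "\<And>s. 0 \<le> s \<Longrightarrow> s \<le> 1 / e' \<or> k s \<le> 1 / e' \<Longrightarrow> \<bar>k s - s\<bar> \<le> e' \<and> dist (y (k s)) (z s) \<le> e'"
    using yz unfolding J1_near_def by blast
  define c where "c = 1 / (e + e')"
  have horizon: "1 / (a + b) + b \<le> 1 / a" if "0 < a" "0 < b" "a + b \<le> 1" for a b :: real
  proof -
    have "a * (a + b) \<le> 1 * 1" using that by (intro mult_mono) auto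
    then have "b * (a * (a + b)) \<le> b" using that by (simp add: mult_left_le)
    then show ?thesis using that by (simp add: field_simps)
  qed
  have c: "c + e' \<le> 1 / e" "c + e \<le> 1 / e'"
    using horizon[of e e'] horizon[of e' e] e by (auto simp: c_def add.commute)
  have "\<bar>h (k s) - s\<bar> \<le> e + e' \<and> dist (x (h (k s))) (z s) \<le> e + e'" if s: "0 \<le> s" "s \<le> c \<or> h (k s) \<le> c" for s
  proof -
    have ks: "0 \<le> k s" by (rule time_change_nonneg[OF k(1) s(1)])
    have "(\<bar>k s - s\<bar> \<le> e' \<and> dist (y (k s)) (z s) \<le> e') \<and> (\<bar>h (k s) - k s\<bar> \<le> e \<and> dist (x (h (k s))) (y (k s)) \<le> e)"
    proof (cases "s \<le> c")
      case True
      then have 1: "\<bar>k s - s\<bar> \<le> e' \<and> dist (y (k s)) (z s) \<le> e'" using c e by (intro k(2) s) auto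
      then have "k s \<le> 1 / e" using True c by (auto simp: abs_le_iff)
      then show ?thesis using 1 h(2)[OF ks] by simp
    next
      case False
      then have 1: "\<bar>h (k s) - k s\<bar> \<le> e \<and> dist (x (h (k s))) (y (k s)) \<le> e"
        using c e s(2) by (intro h(2) ks) auto
      then have "k s \<le> 1 / e'" using False s(2) c by (auto simp: abs_le_iff)
      then show ?thesis using 1 k(2)[OF s(1)] by simp
    qed
    then show ?thesis
      using dist_triangle[of "x (h (k s))" "z s" "y (k s)"] by (auto simp: abs_le_iff)
  qed
  then show ?thesis
    using time_change_comp[OF h(1) k(1)] unfolding J1_near_def c_def by (intro exI[of _ "h \<circ> k"]) auto
qed

text \<open>The triangle inequality for nearness is limited to \<open>e + e' \<le> 1\<close>; capping the distance at 1 removes this limit.\<close>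

definition J1_dist :: "(real \<Rightarrow> 'e::metric_space) \<Rightarrow> (real \<Rightarrow> 'e) \<Rightarrow> real" where
  "J1_dist x y = Inf {e. 1 \<le> e \<or> 0 < e \<and> J1_near e x y}"

lemma J1_dist_bdd: "bdd_below {e. 1 \<le> e \<or> 0 < e \<and> J1_near e x y}"
  by (rule bdd_belowI[of _ 0]) auto

lemma J1_dist_nonneg: "0 \<le> J1_dist x y"
  unfolding J1_dist_def by (rule cInf_greatest) (auto intro: exI[of _ 1])

lemma J1_dist_le_1: "J1_dist x y \<le> 1"
  unfolding J1_dist_def by (rule cInf_lower[OF _ J1_dist_bdd]) simp

lemma J1_dist_le: "0 < e \<Longrightarrow> J1_near e x y \<Longrightarrow> J1_dist x y \<le> e"
  unfolding J1_dist_def by (rule cInf_lower[OF _ J1_dist_bdd]) simp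

lemma J1_dist_less:
  assumes "J1_dist x y < e" "e \<le> 1"
  obtains e' where "0 < e'" "e' < e" "J1_near e' x y"
proof -
  have "\<exists>e'\<in>{e. 1 \<le> e \<or> 0 < e \<and> J1_near e x y}. e' < e"
    using assms(1) unfolding J1_dist_def by (intro cInf_lessD) (auto intro: exI[of _ 1])
  then show thesis using that assms(2) by auto
qed

lemma J1_dist_sym: "J1_dist x y = J1_dist y x"
proof -
  have "J1_near e x y \<longleftrightarrow> J1_near e y x" for e by (blast intro: J1_near_sym)
  then show ?thesis by (simp add: J1_dist_def)
qed

lemma J1_dist_self: "J1_dist x x = 0"
proof (rule antisym[OF _ J1_dist_nonneg])
  show "J1_dist x x \<le> 0"
  proof (rule field_le_epsilon)
    fix e :: real assume "0 < e"
    then show "J1_dist x x \<le> 0 + e"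
      using time_change_id by (intro J1_dist_le) (auto simp: J1_near_def)
  qed
qed

lemma J1_dist_triangle: "J1_dist x z \<le> J1_dist x y + J1_dist y z"
proof (rule field_le_epsilon)
  fix \<epsilon> :: real assume \<epsilon>: "0 < \<epsilon>"
  show "J1_dist x z \<le> J1_dist x y + J1_dist y z + \<epsilon>"
  proof (cases "J1_dist x y + J1_dist y z + \<epsilon> < 1")
    case True
    have "J1_dist x y + \<epsilon> / 2 \<le> 1" "J1_dist y z + \<epsilon> / 2 \<le> 1"
      using True \<epsilon> J1_dist_nonneg[of x y] J1_dist_nonneg[of y z] by auto
    moreover have "J1_dist x y < J1_dist x y + \<epsilon> / 2" "J1_dist y z < J1_dist y z + \<epsilon> / 2"
      using \<epsilon> by auto
    ultimately obtain e e' where e: "0 < e" "e < J1_dist x y + \<epsilon> / 2" "J1_near e x y"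
      and e': "0 < e'" "e' < J1_dist y z + \<epsilon> / 2" "J1_near e' y z"
      by (metis J1_dist_less)
    have "J1_near (e + e') x z" using e e' True by (intro J1_near_trans) auto
    then have "J1_dist x z \<le> e + e'" using e(1) e'(1) by (intro J1_dist_le) auto
    then show ?thesis using e(2) e'(2) by simp
  next
    case False
    then show ?thesis using J1_dist_le_1[of x z] by simp
  qed
qed

text \<open>A time change of \<open>[0, T]\<close> extends by the identity; the horizon lies within \<open>[0, T]\<close>.\<close>

lemma J1_within_imp_near:
  assumes w: "J1_within T e x y" and T: "0 < e" "1 / e \<le> T"
  shows "J1_near e x y"
proof -
  obtain h where h: "strict_mono_on {0..T} h" "h ` {0..T} = {0..T}"
    "\<And>s. s \<in> {0..T} \<Longrightarrow> \<bar>h s - s\<bar> \<le> e \<and> dist (x (h s)) (y s) \<le> e"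
    using w unfolding J1_within_def by blast
  define k where "k s = (if s \<le> T then h s else s)" for s
  have k_T: "k s \<in> {0..T}" if "0 \<le> s" "s \<le> T" for s
    using h(2) that by (auto simp: k_def)
  have "{0..} = {0..T} \<union> {T<..}" using T by (auto intro: order_trans[of 0 "1 / e"])
  moreover have "k ` {0..T} = {0..T}" using h(2) by (simp add: k_def)
  moreover have "k ` {T<..} = {T<..}" by (auto simp: k_def image_iff)
  ultimately have "k ` {0..} = {0..}" by (metis image_Un)
  moreover have "strict_mono_on {0..} k"
  proof (rule strict_mono_onI)
    fix r s :: real assume rs: "r \<in> {0..}" "s \<in> {0..}" "r < s"
    show "k r < k s"
    proof (cases "s \<le> T")
      case True
      then show ?thesis using rs strict_mono_onD[OF h(1), of r s] by (simp add: k_def)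
    next
      case False
      then show ?thesis using rs k_T[of r] by (cases "r \<le> T") (auto simp: k_def)
    qed
  qed
  ultimately have tc: "time_change k" by (simp add: time_change_def)
  have "\<bar>k s - s\<bar> \<le> e \<and> dist (x (k s)) (y s) \<le> e" if s: "0 \<le> s" "s \<le> 1 / e \<or> k s \<le> 1 / e" for s
  proof -
    have "s \<le> T" using s(2) T(2) by (auto simp: k_def split: if_splits)
    then show ?thesis using h(3)[of s] s(1) by (simp add: k_def)
  qed
  then show ?thesis using tc unfolding J1_near_def by blast
qed

lemma J1_converges_imp_dist:
  assumes x: "cadlag x" and conv: "J1_converges xs x"
  shows "(\<lambda>n. J1_dist (xs n) x) \<longlonglongrightarrow> 0"
proof (rule tendstoI)
  fix \<epsilon> :: real assume \<epsilon>: "0 < \<epsilon>"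
  obtain T where T: "2 / \<epsilon> < T" "0 < T" "isCont x T" using exists_continuity_point[OF x] .
  have "\<forall>\<^sub>F n in sequentially. J1_within T (\<epsilon> / 2) (xs n) x"
    using conv T \<epsilon> by (simp add: J1_converges_def)
  then show "\<forall>\<^sub>F n in sequentially. dist (J1_dist (xs n) x) 0 < \<epsilon>"
  proof eventually_elim
    case (elim n)
    have "J1_near (\<epsilon> / 2) (xs n) x" using T \<epsilon> by (intro J1_within_imp_near[OF elim]) auto
    then have "J1_dist (xs n) x \<le> \<epsilon> / 2" using \<epsilon> by (intro J1_dist_le) auto
    then show ?case using \<epsilon> J1_dist_nonneg[of "xs n" x] by simp
  qed
qed

lemma spatial_path_M1_converges:
  fixes x :: "real \<Rightarrow> 'e::real_normed_vector \<times> real"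
  assumes x: "coupled x" and xs: "\<And>n. coupled (xs n)" and lim: "(\<lambda>n. J1_dist (xs n) x) \<longlonglongrightarrow> 0"
  shows "M1_converges (\<lambda>n. spatial_path (xs n)) (spatial_path x)"
  unfolding M1_converges_def
proof (intro allI impI)
  fix T \<epsilon> :: real assume "0 < T" "isCont (spatial_path x) T" "0 < \<epsilon>"
  then obtain e0 where e0: "0 < e0" "\<And>y e. coupled y \<Longrightarrow> 0 < e \<Longrightarrow> e \<le> e0 \<Longrightarrow> J1_near e y x \<Longrightarrow>
      M1_within T \<epsilon> (spatial_path y) (spatial_path x)"
    by (rule spatial_path_continuous[OF x]) blast
  have "\<forall>\<^sub>F n in sequentially. J1_dist (xs n) x < min e0 1"
    using e0(1) by (intro order_tendstoD[OF lim]) auto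
  then show "\<forall>\<^sub>F n in sequentially. M1_within T \<epsilon> (spatial_path (xs n)) (spatial_path x)"
  proof eventually_elim
    case (elim n)
    obtain e where "0 < e" "e < min e0 1" "J1_near e (xs n) x"
      by (rule J1_dist_less[OF elim]) auto
    then show ?case by (intro e0(2)[OF xs]) auto
  qed
qed

section \<open>Mapping theorem\<close>

lemma continuous_map_sequential_topology:
  "continuous_map (sequential_topology P conv) euclideanreal f \<longleftrightarrow>
    (\<forall>x\<in>P. \<forall>xs. range xs \<subseteq> P \<and> conv xs x \<longrightarrow> (\<lambda>n. f (xs n)) \<longlonglongrightarrow> f x)"
proof
  assume f: "continuous_map (sequential_topology P conv) euclideanreal f"
  show "\<forall>x\<in>P. \<forall>xs. range xs \<subseteq> P \<and> conv xs x \<longrightarrow> (\<lambda>n. f (xs n)) \<longlonglongrightarrow> f x"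
  proof (intro ballI allI impI topological_tendstoI)
    fix x xs V assume x: "x \<in> P" "range xs \<subseteq> P \<and> conv xs x" "open V" "f x \<in> V"
    have "openin (sequential_topology P conv) {x \<in> P. f x \<in> V}"
      using openin_continuous_map_preimage[OF f, of V] x(3) by simp
    then have "\<forall>\<^sub>F n in sequentially. xs n \<in> {x \<in> P. f x \<in> V}"
      using x by (auto simp: openin_sequential_topology)
    then show "\<forall>\<^sub>F n in sequentially. f (xs n) \<in> V" by eventually_elim simp
  qed
next
  assume f: "\<forall>x\<in>P. \<forall>xs. range xs \<subseteq> P \<and> conv xs x \<longrightarrow> (\<lambda>n. f (xs n)) \<longlonglongrightarrow> f x"
  show "continuous_map (sequential_topology P conv) euclideanreal f"
    unfolding continuous_map_def
  proof (intro conjI allI impI)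
    fix V :: "real set" assume V: "openin euclideanreal V"
    have "\<forall>\<^sub>F n in sequentially. xs n \<in> {x \<in> P. f x \<in> V}"
      if "x \<in> P" "f x \<in> V" "range xs \<subseteq> P" "conv xs x" for x xs
    proof -
      have "\<forall>\<^sub>F n in sequentially. f (xs n) \<in> V"
        using f that V by (intro topological_tendstoD[of _ "f x"]) auto
      then show ?thesis by eventually_elim (use that(3) in auto)
    qed
    then show "openin (sequential_topology P conv) {x \<in> topspace (sequential_topology P conv). f x \<in> V}"
      by (auto simp: openin_sequential_topology)
  qed simp
qed

lemma space_borel_sets_of [simp]: "space (borel_sets_of X) = topspace X"
  unfolding borel_sets_of_def by (intro space_measure_of) (auto dest: openin_subset)

lemma sets_borel_sets_of: "sets (borel_sets_of X) = sigma_sets (topspace X) {U. openin X U}"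
  unfolding borel_sets_of_def by (intro sets_measure_of) (auto dest: openin_subset)

lemma borel_measurable_continuous_map:
  assumes "continuous_map X euclideanreal f" shows "f \<in> borel_measurable (borel_sets_of X)"
proof (rule borel_measurableI)
  fix V :: "real set" assume "open V"
  then have "openin X {x \<in> topspace X. f x \<in> V}"
    using openin_continuous_map_preimage[OF assms] by simp
  moreover have "f -` V \<inter> space (borel_sets_of X) = {x \<in> topspace X. f x \<in> V}" by auto
  ultimately show "f -` V \<inter> space (borel_sets_of X) \<in> sets (borel_sets_of X)"
    by (simp add: sets_borel_sets_of sigma_sets.Basic)
qed

lemma measurable_borel_sets_ofI:
  assumes "\<And>\<omega>. \<omega> \<in> space M \<Longrightarrow> Z \<omega> \<in> topspace X"
    and "\<And>U. openin X U \<Longrightarrow> Z -` U \<inter> space M \<in> sets M"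
  shows "Z \<in> measurable M (borel_sets_of X)"
  unfolding borel_sets_of_def
  by (rule measurable_measure_of) (use assms in \<open>auto dest: openin_subset\<close>)

text \<open>
  Continuity is required only along sequences in \<open>S\<close>, a set that may be neither open nor closed, and
  refers to the metric \<open>J1_dist\<close>, for which the triangle inequality is available.
\<close>

locale J1_continuous =
  fixes S :: "(real \<Rightarrow> 'e::metric_space) set" and P :: "'p set" and conv :: "(nat \<Rightarrow> 'p) \<Rightarrow> 'p \<Rightarrow> bool"
    and \<Psi> :: "(real \<Rightarrow> 'e) \<Rightarrow> 'p"
  assumes S_paths: "S \<subseteq> cadlag_paths" and S_nonempty: "S \<noteq> {}" and \<Psi>_P: "\<And>x. x \<in> S \<Longrightarrow> \<Psi> x \<in> P"
    and \<Psi>_continuous: "\<And>x xs. x \<in> S \<Longrightarrow> range xs \<subseteq> S \<Longrightarrow> (\<lambda>n. J1_dist (xs n) x) \<longlonglongrightarrow> 0 \<Longrightarrow>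
      conv (\<lambda>n. \<Psi> (xs n)) (\<Psi> x)"
begin

abbreviation "X \<equiv> sequential_topology P conv"

lemma open_preimage:
  assumes U: "openin X U" and x: "x \<in> S" "\<Psi> x \<in> U"
  shows "\<exists>r>0. \<forall>y\<in>S. J1_dist y x < r \<longrightarrow> \<Psi> y \<in> U"
proof (rule ccontr)
  assume "\<not> ?thesis"
  then have "\<exists>y\<in>S. J1_dist y x < 1 / Suc n \<and> \<Psi> y \<notin> U" for n by simp
  then obtain ys where ys: "\<And>n. ys n \<in> S" "\<And>n. J1_dist (ys n) x < 1 / Suc n" "\<And>n. \<Psi> (ys n) \<notin> U"
    by metis
  have "(\<lambda>n. J1_dist (ys n) x) \<longlonglongrightarrow> 0"
  proof (rule tendsto_sandwich)
    show "\<forall>\<^sub>F n in sequentially. 0 \<le> J1_dist (ys n) x" by (simp add: J1_dist_nonneg)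
    show "\<forall>\<^sub>F n in sequentially. J1_dist (ys n) x \<le> 1 / real (Suc n)" by (intro always_eventually allI less_imp_le ys(2))
    show "(\<lambda>n. 1 / real (Suc n)) \<longlonglongrightarrow> 0" by (rule LIMSEQ_Suc[OF lim_1_over_n])
  qed simp
  then have "conv (\<lambda>n. \<Psi> (ys n)) (\<Psi> x)" using ys(1) x(1) by (intro \<Psi>_continuous) auto
  moreover have "range (\<lambda>n. \<Psi> (ys n)) \<subseteq> P" using ys(1) \<Psi>_P by auto
  ultimately have "\<forall>\<^sub>F n in sequentially. \<Psi> (ys n) \<in> U"
    using U x(2) by (auto simp: openin_sequential_topology)
  then show False using ys(3) by simp
qed

text \<open>
  By the triangle inequality, unions of balls are open in the \<open>J\<^sub>1\<close> topology; around each point of \<open>S\<close> that is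
  mapped to \<open>U\<close> there is a ball whose points in \<open>S\<close> are mapped to \<open>U\<close>.
\<close>

lemma open_extension:
  assumes U: "openin X U"
  obtains V where "openin J1_topology V" "\<And>x. x \<in> S \<Longrightarrow> x \<in> V \<longleftrightarrow> \<Psi> x \<in> U"
proof -
  obtain r where r: "\<And>x. x \<in> S \<Longrightarrow> \<Psi> x \<in> U \<Longrightarrow> 0 < r x"
    "\<And>x y. x \<in> S \<Longrightarrow> \<Psi> x \<in> U \<Longrightarrow> y \<in> S \<Longrightarrow> J1_dist y x < r x \<Longrightarrow> \<Psi> y \<in> U"
    using open_preimage[OF U] by metis
  define V where "V = {y \<in> cadlag_paths. \<exists>x\<in>S. \<Psi> x \<in> U \<and> J1_dist y x < r x}"
  have "\<forall>\<^sub>F n in sequentially. ys n \<in> V"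
    if y: "y \<in> V" and ys: "range ys \<subseteq> cadlag_paths" "J1_converges ys y" for y ys
  proof -
    obtain x where x: "x \<in> S" "\<Psi> x \<in> U" "J1_dist y x < r x" using y by (auto simp: V_def)
    have "cadlag y" using y by (simp add: V_def cadlag_paths_iff)
    then have lim: "(\<lambda>n. J1_dist (ys n) y) \<longlonglongrightarrow> 0" using ys(2) by (rule J1_converges_imp_dist)
    have "\<forall>\<^sub>F n in sequentially. J1_dist (ys n) y < r x - J1_dist y x"
      using x(3) by (intro order_tendstoD[OF lim]) simp
    then show ?thesis
    proof eventually_elim
      case (elim n)
      then have "J1_dist (ys n) x < r x" using J1_dist_triangle[of "ys n" x y] by simp
      then show ?case using x(1,2) ys(1) by (auto simp: V_def)
    qed
  qed
  then have "openin J1_topology V"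
    by (auto simp: J1_topology_def openin_sequential_topology V_def)
  moreover have "x \<in> V \<longleftrightarrow> \<Psi> x \<in> U" if x: "x \<in> S" for x
  proof
    assume "\<Psi> x \<in> U"
    then have "J1_dist x x < r x" using r(1)[OF x] by (simp add: J1_dist_self)
    then show "x \<in> V" using x S_paths \<open>\<Psi> x \<in> U\<close> unfolding V_def by blast
  next
    assume "x \<in> V"
    then obtain y where "y \<in> S" "\<Psi> y \<in> U" "J1_dist x y < r y" unfolding V_def by blast
    then show "\<Psi> x \<in> U" using r(2) x by blast
  qed
  ultimately show thesis by (rule that)
qed

text \<open>
  Nothing is known about \<open>\<Psi>\<close> outside \<open>S\<close>, and \<open>S\<close> need not be measurable; so the image is replaced by
  a constant on a measurable null set.
\<close>

lemma measurable_image: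
  assumes Z: "Z \<in> measurable M (borel_sets_of J1_topology)" and AE: "AE \<omega> in M. Z \<omega> \<in> S"
  obtains W where "W \<in> measurable M (borel_sets_of X)" "AE \<omega> in M. Z \<omega> \<in> S \<and> W \<omega> = \<Psi> (Z \<omega>)"
proof -
  obtain x0 where x0: "x0 \<in> S" using S_nonempty by blast
  obtain N where N: "{\<omega> \<in> space M. \<not> Z \<omega> \<in> S} \<subseteq> N" "emeasure M N = 0" "N \<in> sets M"
    using AE by (rule AE_E)
  define W where "W \<omega> = (if \<omega> \<in> N then \<Psi> x0 else \<Psi> (Z \<omega>))" for \<omega>
  have "W \<in> measurable M (borel_sets_of X)"
  proof (rule measurable_borel_sets_ofI)
    show "W \<omega> \<in> topspace X" if "\<omega> \<in> space M" for \<omega>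
      using that N(1) x0 \<Psi>_P by (auto simp: W_def)
    fix U assume "openin X U"
    then obtain V where V: "openin J1_topology V" "\<And>x. x \<in> S \<Longrightarrow> x \<in> V \<longleftrightarrow> \<Psi> x \<in> U"
      by (rule open_extension) blast
    have "V \<in> sets (borel_sets_of J1_topology)"
      using V(1) by (simp add: sets_borel_sets_of sigma_sets.Basic)
    then have "Z -` V \<inter> space M \<in> sets M" by (rule measurable_sets[OF Z])
    moreover have "W -` U \<inter> space M = (Z -` V \<inter> space M - N) \<union> (if \<Psi> x0 \<in> U then N else {})"
      using N(1) V(2) sets.sets_into_space[OF N(3)] by (auto simp: W_def split: if_splits)
    ultimately show "W -` U \<inter> space M \<in> sets M" using N(3) by auto
  qed
  moreover have "AE \<omega> in M. \<omega> \<notin> N" using N by (intro AE_not_in) auto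
  then have "AE \<omega> in M. Z \<omega> \<in> S \<and> W \<omega> = \<Psi> (Z \<omega>)"
    by (rule AE_mp) (use N(1) in \<open>auto simp: W_def\<close>)
  ultimately show thesis by (rule that)
qed

text \<open>
  The function \<open>f \<circ> \<Psi>\<close> on \<open>S\<close> is the increasing limit of the Lipschitz functions
  \<open>x \<mapsto> inf {f (\<Psi> y) + k * J1_dist y x | y \<in> S}\<close>, which are continuous on the whole path space.
\<close>

lemma lipschitz_minorants:
  assumes f: "continuous_map X euclideanreal f" and C: "\<And>x. x \<in> P \<Longrightarrow> \<bar>f x\<bar> \<le> C"
  obtains g :: "nat \<Rightarrow> (real \<Rightarrow> 'e) \<Rightarrow> real" where
    "\<And>k. continuous_map J1_topology euclideanreal (g k)" "\<And>k x. \<bar>g k x\<bar> \<le> C + k"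
    "\<And>k x. x \<in> S \<Longrightarrow> - C \<le> g k x \<and> g k x \<le> f (\<Psi> x)" "\<And>x. x \<in> S \<Longrightarrow> (\<lambda>k. g k x) \<longlonglongrightarrow> f (\<Psi> x)"
proof -
  define g where "g k x = Inf ((\<lambda>y. f (\<Psi> y) + real k * J1_dist y x) ` S)" for k :: nat and x
  have F: "\<bar>f (\<Psi> y)\<bar> \<le> C" if "y \<in> S" for y using C \<Psi>_P that by blast
  have lower: "- C \<le> f (\<Psi> y) + real k * J1_dist y x" if "y \<in> S" for k x y
  proof -
    have "0 \<le> real k * J1_dist y x" by (simp add: J1_dist_nonneg)
    then show ?thesis using F[OF that] by (simp add: abs_le_iff)
  qed
  have bdd: "bdd_below ((\<lambda>y. f (\<Psi> y) + real k * J1_dist y x) ` S)" for k x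
    by (rule bdd_belowI[of _ "- C"]) (use lower in auto)
  have g_le: "g k x \<le> f (\<Psi> y) + real k * J1_dist y x" if "y \<in> S" for k x y
    unfolding g_def using that by (intro cInf_lower bdd) auto
  have g_ge: "c \<le> g k x" if "\<And>y. y \<in> S \<Longrightarrow> c \<le> f (\<Psi> y) + real k * J1_dist y x" for c k x
    unfolding g_def using that S_nonempty by (intro cInf_greatest) auto
  have g_bound: "\<bar>g k x\<bar> \<le> C + k" for k x
  proof -
    obtain y where y: "y \<in> S" using S_nonempty by blast
    have "real k * J1_dist y x \<le> real k * 1" by (intro mult_left_mono J1_dist_le_1) simp
    then have "g k x \<le> C + k" using g_le[OF y, of k x] F[OF y] by (simp add: abs_le_iff)
    then show ?thesis using g_ge[of "- C" k x, OF lower] by (simp add: abs_le_iff)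
  qed
  have lip: "g k x \<le> g k x' + real k * J1_dist x x'" for k x x'
  proof -
    have "g k x - real k * J1_dist x x' \<le> g k x'"
    proof (rule g_ge)
      fix y assume y: "y \<in> S"
      have "real k * J1_dist y x \<le> real k * (J1_dist y x' + J1_dist x x')"
        using J1_dist_triangle[of y x x'] by (intro mult_left_mono) (auto simp: J1_dist_sym[of x])
      then show "g k x - real k * J1_dist x x' \<le> f (\<Psi> y) + real k * J1_dist y x'"
        using g_le[OF y, of k x] by (simp add: distrib_left)
    qed
    then show ?thesis by simp
  qed
  show thesis
  proof (rule that[of g])
    show "continuous_map J1_topology euclideanreal (g k)" for k
      unfolding J1_topology_def continuous_map_sequential_topology
    proof (intro ballI allI impI)
      fix x :: "real \<Rightarrow> 'e" and xs
      assume x: "x \<in> cadlag_paths" "range xs \<subseteq> cadlag_paths \<and> J1_converges xs x"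
      then have lim: "(\<lambda>n. J1_dist (xs n) x) \<longlonglongrightarrow> 0"
        by (intro J1_converges_imp_dist) (auto simp: cadlag_paths_iff)
      have "(\<lambda>n. g k (xs n) - g k x) \<longlonglongrightarrow> 0"
      proof (rule Lim_null_comparison)
        have "norm (g k (xs n) - g k x) \<le> real k * J1_dist (xs n) x" for n
          using lip[of k "xs n" x] lip[of k x "xs n"] by (auto simp: abs_le_iff J1_dist_sym[of x])
        then show "\<forall>\<^sub>F n in sequentially. norm (g k (xs n) - g k x) \<le> real k * J1_dist (xs n) x" by simp
        show "(\<lambda>n. real k * J1_dist (xs n) x) \<longlonglongrightarrow> 0" using tendsto_mult_left[OF lim, of "real k"] by simp
      qed
      then show "(\<lambda>n. g k (xs n)) \<longlonglongrightarrow> g k x" by (rule LIM_zero_cancel)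
    qed
    show "\<bar>g k x\<bar> \<le> C + k" for k x by (rule g_bound)
    show between: "- C \<le> g k x \<and> g k x \<le> f (\<Psi> x)" if "x \<in> S" for k x
      using g_ge[of "- C" k x, OF lower] g_le[OF that, of k x] by (simp add: J1_dist_self)
    show "(\<lambda>k. g k x) \<longlonglongrightarrow> f (\<Psi> x)" if x: "x \<in> S" for x
    proof (rule tendstoI)
      fix e :: real assume e: "0 < e"
      have "openin X {z \<in> topspace X. f z \<in> {f (\<Psi> x) - e / 2 <..}}"
        by (rule openin_continuous_map_preimage[OF f]) simp
      then have "openin X {z \<in> P. f (\<Psi> x) - e / 2 < f z}" by simp
      from open_preimage[OF this x] obtain r where r: "0 < r"
        "\<And>y. y \<in> S \<Longrightarrow> J1_dist y x < r \<Longrightarrow> f (\<Psi> x) - e / 2 < f (\<Psi> y)"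
        using \<Psi>_P[OF x] e by auto
      have "\<forall>\<^sub>F k in sequentially. 2 * C / r \<le> real k"
        using filterlim_real_sequentially by (simp add: filterlim_at_top)
      then show "\<forall>\<^sub>F k in sequentially. dist (g k x) (f (\<Psi> x)) < e"
      proof eventually_elim
        case (elim k)
        have "f (\<Psi> x) - e / 2 \<le> g k x"
        proof (rule g_ge)
          fix y assume y: "y \<in> S"
          show "f (\<Psi> x) - e / 2 \<le> f (\<Psi> y) + real k * J1_dist y x"
          proof (cases "J1_dist y x < r")
            case True
            moreover have "0 \<le> real k * J1_dist y x" by (simp add: J1_dist_nonneg)
            ultimately show ?thesis using r(2)[OF y] by fastforce
          next
            case False
            have "2 * C \<le> real k * r" using elim r(1) by (simp add: pos_divide_le_eq)
            also have "\<dots> \<le> real k * J1_dist y x" using False by (intro mult_left_mono) auto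
            finally show ?thesis using F[OF x] F[OF y] e by (simp add: abs_le_iff)
          qed
        qed
        then show ?case using between[OF x, of k] e by (simp add: dist_real_def)
      qed
    qed
  qed
qed

text \<open>
  Each minorant gives a lower bound for the lower limit of the integrals of \<open>f\<close>, and the minorants
  exhaust \<open>f\<close> under the limit law. The upper bound is the lower bound for \<open>- f\<close>.
\<close>

lemma mapping_theorem:
  assumes M: "prob_space M" and M': "prob_space M'"
    and Z: "\<And>n. Z n \<in> measurable M (borel_sets_of J1_topology)"
    and Z': "Z' \<in> measurable M' (borel_sets_of J1_topology)"
    and weak: "weakly_converges J1_topology (\<lambda>n. distr M (borel_sets_of J1_topology) (Z n))
      (distr M' (borel_sets_of J1_topology) Z')"
    and W: "\<And>n. W n \<in> measurable M (borel_sets_of X)" and W': "W' \<in> measurable M' (borel_sets_of X)"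
    and WZ: "\<forall>\<^sub>F n in sequentially. AE \<omega> in M. Z n \<omega> \<in> S \<and> W n \<omega> = \<Psi> (Z n \<omega>)"
    and W'Z': "AE \<omega> in M'. Z' \<omega> \<in> S \<and> W' \<omega> = \<Psi> (Z' \<omega>)"
  shows "weakly_converges X (\<lambda>n. distr M (borel_sets_of X) (W n)) (distr M' (borel_sets_of X) W')"
proof -
  interpret M: prob_space M by (rule M)
  interpret M': prob_space M' by (rule M')
  have lower: "\<forall>\<^sub>F n in sequentially. (\<integral>\<omega>. f (W' \<omega>) \<partial>M') - \<epsilon> < (\<integral>\<omega>. f (W n \<omega>) \<partial>M)"
    if f: "continuous_map X euclideanreal f" and C: "\<And>x. x \<in> P \<Longrightarrow> \<bar>f x\<bar> \<le> C" and \<epsilon>: "0 < \<epsilon>" for f C \<epsilon>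
  proof -
    obtain g where g: "\<And>k. continuous_map J1_topology euclideanreal (g k)" "\<And>k x. \<bar>g k x\<bar> \<le> C + real k"
      "\<And>k x. x \<in> S \<Longrightarrow> - C \<le> g k x \<and> g k x \<le> f (\<Psi> x)" "\<And>x. x \<in> S \<Longrightarrow> (\<lambda>k. g k x) \<longlonglongrightarrow> f (\<Psi> x)"
      by (rule lipschitz_minorants[OF f C]) blast+
    have fm: "f \<in> borel_measurable (borel_sets_of X)" by (rule borel_measurable_continuous_map[OF f])
    have gm: "g k \<in> borel_measurable (borel_sets_of J1_topology)" for k
      by (rule borel_measurable_continuous_map[OF g(1)])
    have fW: "(\<lambda>\<omega>. f (W n \<omega>)) \<in> borel_measurable M" for n by (rule measurable_compose[OF W fm])
    have fW': "(\<lambda>\<omega>. f (W' \<omega>)) \<in> borel_measurable M'" by (rule measurable_compose[OF W' fm])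
    have gZ: "(\<lambda>\<omega>. g k (Z n \<omega>)) \<in> borel_measurable M" for n k by (rule measurable_compose[OF Z gm])
    have gZ': "(\<lambda>\<omega>. g k (Z' \<omega>)) \<in> borel_measurable M'" for k by (rule measurable_compose[OF Z' gm])
    have WP: "W n \<omega> \<in> P" if "\<omega> \<in> space M" for n \<omega> using measurable_space[OF W that] by simp
    have "(\<lambda>k. \<integral>\<omega>. g k (Z' \<omega>) \<partial>M') \<longlonglongrightarrow> (\<integral>\<omega>. f (W' \<omega>) \<partial>M')"
    proof (rule integral_dominated_convergence[where w = "\<lambda>_. C"])
      show "AE \<omega> in M'. (\<lambda>k. g k (Z' \<omega>)) \<longlonglongrightarrow> f (W' \<omega>)"
        using W'Z' by eventually_elim (use g(4) in auto)
      show "AE \<omega> in M'. norm (g k (Z' \<omega>)) \<le> C" for k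
        using W'Z'
      proof eventually_elim
        case (elim \<omega>)
        then have "f (\<Psi> (Z' \<omega>)) \<le> C" using C[OF \<Psi>_P, of "Z' \<omega>"] by (auto simp: abs_le_iff)
        then show ?case using g(3)[of "Z' \<omega>" k] elim by (auto simp: abs_le_iff)
      qed
    qed (use gZ' fW' in auto)
    then have "\<forall>\<^sub>F k in sequentially. (\<integral>\<omega>. f (W' \<omega>) \<partial>M') - \<epsilon> < (\<integral>\<omega>. g k (Z' \<omega>) \<partial>M')"
      using \<epsilon> by (intro order_tendstoD(1)) auto
    then obtain k where k: "(\<integral>\<omega>. f (W' \<omega>) \<partial>M') - \<epsilon> < (\<integral>\<omega>. g k (Z' \<omega>) \<partial>M')"
      by (auto simp: eventually_sequentially)
    have "bounded (g k ` topspace J1_topology)"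
      using g(2)[of k] by (auto simp: bounded_iff intro!: exI[of _ "C + real k"])
    then have "(\<lambda>n. \<integral>x. g k x \<partial>distr M (borel_sets_of J1_topology) (Z n)) \<longlonglongrightarrow>
        (\<integral>x. g k x \<partial>distr M' (borel_sets_of J1_topology) Z')"
      using weak g(1)[of k] unfolding weakly_converges_def by blast
    then have "(\<lambda>n. \<integral>\<omega>. g k (Z n \<omega>) \<partial>M) \<longlonglongrightarrow> (\<integral>\<omega>. g k (Z' \<omega>) \<partial>M')"
      by (simp add: integral_distr[OF Z gm] integral_distr[OF Z' gm])
    then have "\<forall>\<^sub>F n in sequentially. (\<integral>\<omega>. f (W' \<omega>) \<partial>M') - \<epsilon> < (\<integral>\<omega>. g k (Z n \<omega>) \<partial>M)"
      using k by (rule order_tendstoD(1))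
    then show ?thesis
      using WZ
    proof eventually_elim
      case (elim n)
      have "(\<integral>\<omega>. g k (Z n \<omega>) \<partial>M) \<le> (\<integral>\<omega>. f (W n \<omega>) \<partial>M)"
      proof (rule integral_mono_AE)
        show "integrable M (\<lambda>\<omega>. g k (Z n \<omega>))"
          using g(2) by (intro M.integrable_const_bound[where B = "C + real k"] gZ) auto
        show "integrable M (\<lambda>\<omega>. f (W n \<omega>))"
          using C WP by (intro M.integrable_const_bound[where B = C] fW) auto
        show "AE \<omega> in M. g k (Z n \<omega>) \<le> f (W n \<omega>)"
          using elim(2) by eventually_elim (use g(3) in auto)
      qed
      then show ?case using elim(1) by simp
    qed
  qed
  show ?thesis
    unfolding weakly_converges_def
  proof (intro allI impI)
    fix f assume f: "continuous_map X euclideanreal f \<and> bounded (f ` topspace X)"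
    then obtain C where C: "\<And>x. x \<in> P \<Longrightarrow> \<bar>f x\<bar> \<le> C" by (auto simp: bounded_iff)
    have f': "continuous_map X euclideanreal (\<lambda>x. - f x)"
      using f by (intro continuous_map_minus) auto
    have fm: "f \<in> borel_measurable (borel_sets_of X)"
      using f by (intro borel_measurable_continuous_map) auto
    have "(\<lambda>n. \<integral>\<omega>. f (W n \<omega>) \<partial>M) \<longlonglongrightarrow> (\<integral>\<omega>. f (W' \<omega>) \<partial>M')"
    proof (rule tendstoI)
      fix \<epsilon> :: real assume \<epsilon>: "0 < \<epsilon>"
      have "\<forall>\<^sub>F n in sequentially. (\<integral>\<omega>. f (W' \<omega>) \<partial>M') - \<epsilon> < (\<integral>\<omega>. f (W n \<omega>) \<partial>M)"
        using f C \<epsilon> by (intro lower) auto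
      moreover have "\<forall>\<^sub>F n in sequentially. (\<integral>\<omega>. - f (W' \<omega>) \<partial>M') - \<epsilon> < (\<integral>\<omega>. - f (W n \<omega>) \<partial>M)"
        using C \<epsilon> by (intro lower[OF f']) auto
      ultimately show "\<forall>\<^sub>F n in sequentially. dist (\<integral>\<omega>. f (W n \<omega>) \<partial>M) (\<integral>\<omega>. f (W' \<omega>) \<partial>M') < \<epsilon>"
        by eventually_elim (auto simp: dist_real_def abs_less_iff)
    qed
    then show "(\<lambda>n. \<integral>x. f x \<partial>distr M (borel_sets_of X) (W n)) \<longlonglongrightarrow> (\<integral>x. f x \<partial>distr M' (borel_sets_of X) W')"
      by (simp add: integral_distr[OF W fm] integral_distr[OF W' fm])
  qed
qed

end

section \<open>Continuous functionals on the path space\<close>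

text \<open>An increasing bijection of \<open>[0, T]\<close> fixes both end points.\<close>

lemma J1_converges_end_points:
  assumes conv: "J1_converges xs x" and T: "0 < T" "isCont x T" and t: "t = 0 \<or> t = T"
  shows "(\<lambda>n. xs n t) \<longlonglongrightarrow> x t"
proof (rule tendstoI)
  fix e :: real assume e: "0 < e"
  have "\<forall>\<^sub>F n in sequentially. J1_within T (e / 2) (xs n) x"
    using conv T e by (simp add: J1_converges_def)
  then show "\<forall>\<^sub>F n in sequentially. dist (xs n t) (x t) < e"
  proof eventually_elim
    case (elim n)
    then obtain h where h: "strict_mono_on {0..T} h" "h ` {0..T} = {0..T}"
      "\<And>s. s \<in> {0..T} \<Longrightarrow> dist (xs n (h s)) (x s) \<le> e / 2"
      unfolding J1_within_def by blast
    have tT: "t \<in> {0..T}" using t T(1) by auto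
    have "t \<in> h ` {0..T}" "h t \<in> h ` {0..T}" unfolding h(2) using tT h(2) by auto
    then obtain s where s: "s \<in> {0..T}" "h s = t" by force
    moreover have "h t \<in> {0..T}" using \<open>h t \<in> h ` {0..T}\<close> unfolding h(2) .
    ultimately have "h t = t"
      using strict_mono_onD[OF h(1), of s t] strict_mono_onD[OF h(1), of t s] t tT by (cases s t rule: linorder_cases) auto
    then show ?case using h(3)[OF tT] e by simp
  qed
qed

lemma J1_converges_pointwise:
  assumes "J1_converges xs x" "0 < T" "isCont x T"
  shows "(\<lambda>n. xs n T) \<longlonglongrightarrow> x T"
  using J1_converges_end_points[OF assms] by simp

lemma J1_converges_at_0:
  assumes x: "cadlag x" and conv: "J1_converges xs x"
  shows "(\<lambda>n. xs n 0) \<longlonglongrightarrow> x 0"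
proof -
  obtain T where "0 < T" "isCont x T" using exists_continuity_point[OF x] .
  then show ?thesis using J1_converges_end_points[OF conv] by simp
qed

lemma cadlag_window_measurable:
  fixes \<phi> :: "'e::metric_space \<Rightarrow> real"
  assumes x: "cadlag x" and \<phi>: "continuous_on UNIV \<phi>" and a: "0 \<le> a"
  shows "(\<lambda>s. indicator {a..b} s * \<phi> (x s)) \<in> borel_measurable lborel"
proof -
  define y where "y s = \<phi> (x (max 0 s))" for s
  have "continuous_on (- insert 0 (jump_times x)) y"
    unfolding continuous_on_def
  proof
    fix s assume s: "s \<in> - insert 0 (jump_times x)"
    have "isCont (\<lambda>s. x (max 0 s)) s"
    proof (cases "0 < s")
      case True
      then have "isCont x s" using s by (subst isCont_cadlag_iff[OF x]) (auto simp: jump_times_def)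
      then have "isCont x (max 0 s)" using True by simp
      then show ?thesis by (intro isCont_o2[of s "max 0" x]) (auto intro!: continuous_intros)
    next
      case False
      then have "\<forall>\<^sub>F z in nhds s. z < 0" 
        using s eventually_nhds_in_open[of "{..<0}" s] by simp
      then have "\<forall>\<^sub>F z in nhds s. x (max 0 z) = x 0" by eventually_elim auto
      then show ?thesis by (subst isCont_cong) auto
    qed
    then have "isCont y s" unfolding y_def using \<phi>
      by (intro isCont_o2[of s "\<lambda>s. x (max 0 s)" \<phi>]) (auto simp: continuous_on_eq_continuous_at)
    then show "(y \<longlongrightarrow> y s) (at s within - insert 0 (jump_times x))"
      unfolding isCont_def by (rule tendsto_mono[OF at_le, rotated]) simp
  qed
  moreover have "countable (insert 0 (jump_times x))" using countable_jump_times[OF x] by simp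
  ultimately have [measurable]: "y \<in> borel_measurable borel"
    by (intro borel_measurable_continuous_countable_exceptions)
  have "(\<lambda>s. indicator {a..b} s * \<phi> (x s)) = (\<lambda>s. indicator {a..b} s * y s)"
    using a by (auto simp: y_def indicator_def)
  then show ?thesis by simp
qed

text \<open>
  \<open>J\<^sub>1\<close> convergence implies convergence at the continuity points of the limit, hence almost everywhere.
\<close>

lemma continuous_map_J1_window_integral:
  fixes \<phi> :: "'e::metric_space \<Rightarrow> real"
  assumes \<phi>: "continuous_on UNIV \<phi>" and C: "\<And>z. \<bar>\<phi> z\<bar> \<le> C" and a: "0 \<le> a"
  shows "continuous_map J1_topology euclideanreal (\<lambda>x. \<integral>s. indicator {a..b} s * \<phi> (x s) \<partial>lborel)"
  unfolding J1_topology_def continuous_map_sequential_topology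
proof (intro ballI allI impI)
  fix x :: "real \<Rightarrow> 'e" and xs
  assume "x \<in> cadlag_paths" and xs: "range xs \<subseteq> cadlag_paths \<and> J1_converges xs x"
  then have x: "cadlag x" by (simp add: cadlag_paths_iff)
  have xsn: "cadlag (xs n)" for n using xs by (auto simp: image_subset_iff cadlag_paths_iff)
  have "0 \<le> C" using C[of "x 0"] by simp
  show "(\<lambda>n. \<integral>s. indicator {a..b} s * \<phi> (xs n s) \<partial>lborel) \<longlonglongrightarrow> (\<integral>s. indicator {a..b} s * \<phi> (x s) \<partial>lborel)"
  proof (rule integral_dominated_convergence[where w = "\<lambda>s. indicator {a..b} s * C"])
    show "(\<lambda>s. indicator {a..b} s * \<phi> (x s)) \<in> borel_measurable lborel"
      "(\<lambda>s. indicator {a..b} s * \<phi> (xs n s)) \<in> borel_measurable lborel" for n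
      by (intro cadlag_window_measurable x xsn \<phi> a)+
    show "integrable lborel (\<lambda>s. indicator {a..b} s * C)"
      by (intro integrable_mult_left integrable_real_indicator) (auto simp: emeasure_lborel_Icc_eq)
    show "AE s in lborel. norm (indicator {a..b} s * \<phi> (xs n s)) \<le> indicator {a..b} s * C" for n
      using C \<open>0 \<le> C\<close> by (auto simp: indicator_def)
    have "AE s in lborel. s \<notin> insert 0 (jump_times x)"
      using countable_jump_times[OF x] by (intro AE_not_in countable_imp_null_set_lborel) simp
    then show "AE s in lborel. (\<lambda>n. indicator {a..b} s * \<phi> (xs n s)) \<longlonglongrightarrow> indicator {a..b} s * \<phi> (x s)"
    proof eventually_elim
      case (elim s)
      show ?case
      proof (cases "s \<in> {a..b}")
        case True
        then have "0 < s" using elim a by auto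
        then have "isCont x s" using elim by (subst isCont_cadlag_iff[OF x]) (auto simp: jump_times_def)
        then have "(\<lambda>n. xs n s) \<longlonglongrightarrow> x s" using xs \<open>0 < s\<close> by (intro J1_converges_pointwise) auto
        then have "(\<lambda>n. \<phi> (xs n s)) \<longlonglongrightarrow> \<phi> (x s)"
          using \<phi> by (auto intro: continuous_on_tendsto_compose)
        then show ?thesis by (intro tendsto_intros)
      qed simp
    qed
  qed
qed

text \<open>
  The Laplace functional of the time component at a fixed time is not continuous on the path space, its
  average over a window is. The truncation at 0 keeps it bounded on paths whose time component may be
  negative.
\<close>

definition laplace_window :: "nat \<Rightarrow> (real \<Rightarrow> 'e::metric_space \<times> real) \<Rightarrow> real" where
  "laplace_window k x = (\<integral>s. indicator {real k..real k + 1} s * exp (- max 0 (snd (x s))) \<partial>lborel)"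

lemma continuous_map_laplace_window:
  "continuous_map J1_topology euclideanreal (laplace_window k)"
  unfolding laplace_window_def[abs_def]
  by (rule continuous_map_J1_window_integral[where C = 1]) (auto intro!: continuous_intros)

lemma laplace_window_bounds:
  assumes x: "cadlag x" and l: "0 \<le> l" "\<And>s. real k \<le> s \<Longrightarrow> s \<le> real k + 1 \<Longrightarrow> l \<le> max 0 (snd (x s))"
    and u: "\<And>s. real k \<le> s \<Longrightarrow> s \<le> real k + 1 \<Longrightarrow> max 0 (snd (x s)) \<le> u"
  shows "exp (- u) \<le> laplace_window k x" "laplace_window k x \<le> exp (- l)"
proof -
  let ?I = "{real k..real k + 1}"
  have meas: "(\<lambda>s. indicator ?I s * exp (- max 0 (snd (x s)))) \<in> borel_measurable lborel"
    by (rule cadlag_window_measurable[OF x]) (auto intro!: continuous_intros)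
  have int_c: "integrable lborel (\<lambda>s. indicator ?I s * c)" for c :: real by simp
  have val_c: "(\<integral>s. indicator ?I s * c \<partial>lborel) = c" for c :: real by simp
  have int: "integrable lborel (\<lambda>s. indicator ?I s * exp (- max 0 (snd (x s))))"
    by (rule Bochner_Integration.integrable_bound[OF int_c[of 1] meas]) (auto simp: indicator_def)
  have u': "0 \<le> u \<and> snd (x s) \<le> u" if "s \<in> ?I" for s using u[of s] that by simp
  have "(\<integral>s. indicator ?I s * exp (- u) \<partial>lborel) \<le> laplace_window k x"
    unfolding laplace_window_def by (intro integral_mono int int_c) (use u' in \<open>auto simp: indicator_def\<close>)
  then show "exp (- u) \<le> laplace_window k x" unfolding val_c .
  have "laplace_window k x \<le> (\<integral>s. indicator ?I s * exp (- l) \<partial>lborel)"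
    unfolding laplace_window_def by (intro integral_mono int int_c) (auto simp: indicator_def l)
  then show "laplace_window k x \<le> exp (- l)" unfolding val_c .
qed

lemma laplace_window_range:
  assumes x: "cadlag x" shows "0 \<le> laplace_window k x" "laplace_window k x \<le> 1"
proof -
  show "0 \<le> laplace_window k x"
    unfolding laplace_window_def by (rule Bochner_Integration.integral_nonneg) simp
  have "integrable lborel (\<lambda>s. indicator {real k..real k + 1} s * (1::real))" by simp
  then have "laplace_window k x \<le> (\<integral>s. indicator {real k..real k + 1} s * 1 \<partial>lborel)"
    unfolding laplace_window_def
    by (intro integral_mono' ) (auto simp: indicator_def)
  then show "laplace_window k x \<le> 1" by simp
qed

section \<open>The clocks run forever\<close>

lemma AE_small_of_mean_small:
  fixes Y :: "nat \<Rightarrow> 'a \<Rightarrow> real"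
  assumes "\<And>n. integrable M (Y n)" "\<And>n. AE \<omega> in M. 0 \<le> Y n \<omega>" "(\<lambda>n. \<integral>\<omega>. Y n \<omega> \<partial>M) \<longlonglongrightarrow> 0"
  shows "AE \<omega> in M. \<forall>c>0. \<exists>n. Y n \<omega> < c"
proof -
  have "(\<integral>\<omega>. norm (Y n \<omega>) \<partial>M) = (\<integral>\<omega>. Y n \<omega> \<partial>M)" for n
  proof (rule integral_cong_AE)
    show "AE \<omega> in M. norm (Y n \<omega>) = Y n \<omega>" using assms(2)[of n] by eventually_elim simp
  qed (use assms(1) in auto)
  then obtain r where "AE \<omega> in M. (\<lambda>n. Y (r n) \<omega>) \<longlonglongrightarrow> 0"
    using tendsto_L1_AE_subseq[of M Y] assms by auto
  then show ?thesis
  proof eventually_elim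
    case (elim \<omega>)
    have "\<exists>n. Y n \<omega> < c" if "0 < c" for c
      using order_tendstoD(2)[OF elim that] by (auto simp: eventually_sequentially)
    then show ?case by blast
  qed
qed

context levy_walk
begin

lemma J_measurable: "i \<ge> 1 \<Longrightarrow> J i \<in> borel_measurable M"
  using J_indep by (auto simp: indep_vars_def)

lemma walk_time_measurable: "walk_time J k \<in> borel_measurable M"
  unfolding walk_time_def[abs_def] by (intro borel_measurable_sum J_measurable) auto

lemma walk_time_mono: "\<omega> \<in> space M \<Longrightarrow> m \<le> n \<Longrightarrow> walk_time J m \<omega> \<le> walk_time J n \<omega>"
  unfolding walk_time_def by (intro sum_mono2) (auto intro: J_nonneg)

lemma walk_time_nonneg: "\<omega> \<in> space M \<Longrightarrow> 0 \<le> walk_time J n \<omega>"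
  unfolding walk_time_def by (intro sum_nonneg) (auto intro: J_nonneg)

lemma laplace_walk_time:
  assumes c: "0 \<le> c"
  shows "expectation (\<lambda>\<omega>. exp (- (c * walk_time J k \<omega>))) = expectation (\<lambda>\<omega>. exp (- (c * J 1 \<omega>))) ^ k"
proof -
  have int: "integrable M (\<lambda>\<omega>. exp (- (c * J i \<omega>)))" if "i \<in> {1..k}" for i
  proof (rule integrable_const_bound[where B = 1])
    show "(\<lambda>\<omega>. exp (- (c * J i \<omega>))) \<in> borel_measurable M" using J_measurable[of i] that by simp
    show "AE \<omega> in M. norm (exp (- (c * J i \<omega>))) \<le> 1"
      using J_nonneg[of i] that c by (intro AE_I2) auto
  qed
  have "indep_vars (\<lambda>_. borel) J {1..k}" by (rule indep_vars_subset[OF J_indep]) auto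
  then have ind: "indep_vars (\<lambda>_. borel) (\<lambda>i \<omega>. exp (- (c * J i \<omega>))) {1..k}"
    by (rule indep_vars_compose2[where Y = "\<lambda>_ y. exp (- (c * y))"]) simp
  have same: "expectation (\<lambda>\<omega>. exp (- (c * J i \<omega>))) = expectation (\<lambda>\<omega>. exp (- (c * J 1 \<omega>)))" if "1 \<le> i" for i
  proof -
    have "expectation (\<lambda>\<omega>. exp (- (c * J i \<omega>))) = (\<integral>y. exp (- (c * y)) \<partial>distr M borel (J i))"
      using J_measurable[OF that] by (subst integral_distr) auto
    also have "\<dots> = expectation (\<lambda>\<omega>. exp (- (c * J 1 \<omega>)))"
      unfolding J_ident[OF that] using J_measurable[of 1] by (subst integral_distr) auto
    finally show ?thesis .
  qed
  have "exp (- (c * walk_time J k \<omega>)) = (\<Prod>i\<in>{1..k}. exp (- (c * J i \<omega>)))" for \<omega>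
    by (simp add: walk_time_def sum_distrib_left sum_negf[symmetric] exp_sum)
  then have "expectation (\<lambda>\<omega>. exp (- (c * walk_time J k \<omega>))) =
      (\<Prod>i\<in>{1..k}. expectation (\<lambda>\<omega>. exp (- (c * J i \<omega>))))"
    by (simp only: indep_vars_lebesgue_integral[OF finite_atLeastAtMost ind int])
  also have "\<dots> = (\<Prod>i\<in>{1..k}. expectation (\<lambda>\<omega>. exp (- (c * J 1 \<omega>))))"
    by (intro prod.cong same) auto
  finally show ?thesis by simp
qed

end

text \<open>
  \<open>Z n\<close> and \<open>Z'\<close> are random elements of the path space that represent the processes \<open>(A\<^sub>n, D\<^sub>n)\<close> and
  \<open>(A, D)\<close> up to null sets.
\<close>

locale walk_limit = levy_walk M lam J \<Lambda> + limit: prob_space M'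
  for M :: "'w measure" and lam :: "(real ^ 'm) measure" and J \<Lambda> and M' :: "'v measure" +
  fixes B b :: "nat \<Rightarrow> real" and A :: "'v \<Rightarrow> real \<Rightarrow> real ^ 'm" and D :: "'v \<Rightarrow> real \<Rightarrow> real"
    and Z :: "nat \<Rightarrow> 'w \<Rightarrow> real \<Rightarrow> (real ^ 'm) \<times> real" and Z' :: "'v \<Rightarrow> real \<Rightarrow> (real ^ 'm) \<times> real"
  assumes B_pos: "\<And>n. B n > 0" and b_pos: "\<And>n. b n > 0"
    and Z_measurable: "\<And>n. Z n \<in> measurable M (borel_sets_of J1_topology)"
    and Z_eq: "\<And>n. AE \<omega> in M. \<forall>t\<ge>0. Z n \<omega> t =
      (B n *\<^sub>R walk_sum J \<Lambda> (nat \<lfloor>real n * t\<rfloor>) \<omega>, b n * walk_time J (nat \<lfloor>real n * t\<rfloor>) \<omega>)"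
    and Z'_measurable: "Z' \<in> measurable M' (borel_sets_of J1_topology)"
    and Z'_eq: "AE \<omega> in M'. \<forall>t\<ge>0. Z' \<omega> t = (A \<omega> t, D \<omega> t)"
    and weak: "weakly_converges J1_topology (\<lambda>n. distr M (borel_sets_of J1_topology) (Z n))
      (distr M' (borel_sets_of J1_topology) Z')"
    and D_strict: "AE \<omega> in M'. strict_mono_on {0..} (D \<omega>)"
begin

lemma Z_cadlag: "\<omega> \<in> space M \<Longrightarrow> Z n \<omega> \<in> cadlag_paths" "\<omega> \<in> space M \<Longrightarrow> cadlag (Z n \<omega>)"
  using measurable_space[OF Z_measurable, of \<omega> n] by (auto simp: J1_topology_def cadlag_paths_iff)

lemma Z'_cadlag: "\<omega> \<in> space M' \<Longrightarrow> Z' \<omega> \<in> cadlag_paths" "\<omega> \<in> space M' \<Longrightarrow> cadlag (Z' \<omega>)"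
  using measurable_space[OF Z'_measurable, of \<omega>] by (auto simp: J1_topology_def cadlag_paths_iff)

lemma
  assumes f: "continuous_map J1_topology euclideanreal f" and C: "\<And>x. x \<in> cadlag_paths \<Longrightarrow> \<bar>f x\<bar> \<le> C"
  shows integral_tendsto: "(\<lambda>n. \<integral>\<omega>. f (Z n \<omega>) \<partial>M) \<longlonglongrightarrow> (\<integral>\<omega>. f (Z' \<omega>) \<partial>M')"
    and integrable_Z: "integrable M (\<lambda>\<omega>. f (Z n \<omega>))"
    and integrable_Z': "integrable M' (\<lambda>\<omega>. f (Z' \<omega>))"
proof -
  have fm: "f \<in> borel_measurable (borel_sets_of J1_topology)"
    by (rule borel_measurable_continuous_map[OF f])
  have "bounded (f ` topspace J1_topology)"
    using C by (auto simp: bounded_iff J1_topology_def)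
  then have "(\<lambda>n. \<integral>x. f x \<partial>distr M (borel_sets_of J1_topology) (Z n)) \<longlonglongrightarrow>
      (\<integral>x. f x \<partial>distr M' (borel_sets_of J1_topology) Z')"
    using weak f unfolding weakly_converges_def by blast
  then show "(\<lambda>n. \<integral>\<omega>. f (Z n \<omega>) \<partial>M) \<longlonglongrightarrow> (\<integral>\<omega>. f (Z' \<omega>) \<partial>M')"
    by (simp add: integral_distr[OF Z_measurable fm] integral_distr[OF Z'_measurable fm])
  show "integrable M (\<lambda>\<omega>. f (Z n \<omega>))"
    using C Z_cadlag by (intro integrable_const_bound[where B = C] measurable_compose[OF Z_measurable fm]) auto
  show "integrable M' (\<lambda>\<omega>. f (Z' \<omega>))"
    using C Z'_cadlag by (intro limit.integrable_const_bound[where B = C] measurable_compose[OF Z'_measurable fm]) auto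
qed

text \<open>Evaluation at 0 is \<open>J\<^sub>1\<close> continuous, and \<open>D\<^sub>n\<close> starts at 0.\<close>

lemma D_at_0: "AE \<omega> in M'. D \<omega> 0 = 0"
proof -
  define f :: "(real \<Rightarrow> (real ^ 'm) \<times> real) \<Rightarrow> real" where "f x = min 1 \<bar>snd (x 0)\<bar>" for x
  have f: "continuous_map J1_topology euclideanreal f"
    unfolding J1_topology_def continuous_map_sequential_topology
  proof (intro ballI allI impI)
    fix x :: "real \<Rightarrow> (real ^ 'm) \<times> real" and xs
    assume "x \<in> cadlag_paths" "range xs \<subseteq> cadlag_paths \<and> J1_converges xs x"
    then have "(\<lambda>n. xs n 0) \<longlonglongrightarrow> x 0" by (intro J1_converges_at_0) (auto simp: cadlag_paths_iff)
    then show "(\<lambda>n. f (xs n)) \<longlonglongrightarrow> f x" unfolding f_def by (intro tendsto_intros)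
  qed
  have C: "\<bar>f x\<bar> \<le> 1" for x by (simp add: f_def)
  have "(\<integral>\<omega>. f (Z n \<omega>) \<partial>M) = 0" for n
  proof (rule integral_eq_zero_AE)
    show "AE \<omega> in M. f (Z n \<omega>) = 0"
      using Z_eq[of n] by eventually_elim (simp add: f_def walk_time_def)
  qed
  then have "(\<integral>\<omega>. f (Z' \<omega>) \<partial>M') = 0"
    using integral_tendsto[OF f C] by (simp add: LIMSEQ_const_iff)
  then have "AE \<omega> in M'. f (Z' \<omega>) = 0"
    using integral_nonneg_eq_0_iff_AE[OF integrable_Z'[OF f C]] by (simp add: f_def)
  then show ?thesis using Z'_eq by eventually_elim (auto simp: f_def min_def split: if_splits)
qed

lemma D_mono: "AE \<omega> in M'. \<forall>s\<ge>0. \<forall>t\<ge>s. 0 \<le> D \<omega> s \<and> D \<omega> s \<le> D \<omega> t"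
  using D_strict D_at_0
proof eventually_elim
  case (elim \<omega>)
  have le: "D \<omega> s \<le> D \<omega> t" if "0 \<le> s" "s \<le> t" for s t
    using that strict_mono_on_leD[OF elim(1), of s t] by auto
  then show ?case using le[of 0] elim(2) by auto
qed

definition step_laplace :: "nat \<Rightarrow> real" where
  "step_laplace n = expectation (\<lambda>\<omega>. exp (- (b n * J 1 \<omega>)))"

lemma step_laplace_range: "0 \<le> step_laplace n" "step_laplace n \<le> 1"
proof -
  have J: "J 1 \<in> borel_measurable M" by (rule J_measurable) simp
  have nn: "0 \<le> b n * J 1 \<omega>" if "\<omega> \<in> space M" for \<omega> using J_nonneg[of 1 \<omega>] that b_pos[of n] by simp
  show "0 \<le> step_laplace n" unfolding step_laplace_def by (rule Bochner_Integration.integral_nonneg) simp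
  show "step_laplace n \<le> 1" unfolding step_laplace_def
    using nn J by (intro integral_le_const integrable_const_bound[where B = 1]) auto
qed

text \<open>During the operational times \<open>[k, k + 1]\<close> the walk has made between \<open>n * k\<close> and \<open>n * (k + 1)\<close> steps.\<close>

lemma mean_laplace_window_bounds:
  "step_laplace n ^ (n * (k + 1)) \<le> (\<integral>\<omega>. laplace_window k (Z n \<omega>) \<partial>M)"
  "(\<integral>\<omega>. laplace_window k (Z n \<omega>) \<partial>M) \<le> step_laplace n ^ (n * k)"
proof -
  define F where "F k \<omega> = exp (- (b n * walk_time J (n * k) \<omega>))" for k \<omega>
  have int_F: "integrable M (F k)" for k
  proof (rule integrable_const_bound[where B = 1])
    show "F k \<in> borel_measurable M" unfolding F_def[abs_def] using walk_time_measurable by simp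
    show "AE \<omega> in M. norm (F k \<omega>) \<le> 1"
      using walk_time_nonneg b_pos[of n] by (intro AE_I2) (auto simp: F_def intro!: mult_nonneg_nonneg)
  qed
  have exp_F: "expectation (F k) = step_laplace n ^ (n * k)" for k
    unfolding F_def step_laplace_def using b_pos[of n] by (intro laplace_walk_time) simp
  have int_Z: "integrable M (\<lambda>\<omega>. laplace_window k (Z n \<omega>))"
    using laplace_window_range by (intro integrable_Z[where C = 1] continuous_map_laplace_window)
      (auto simp: cadlag_paths_iff abs_le_iff intro: order_trans[of _ 0])
  have bounds: "AE \<omega> in M. F (k + 1) \<omega> \<le> laplace_window k (Z n \<omega>) \<and> laplace_window k (Z n \<omega>) \<le> F k \<omega>"
    using Z_eq[of n] AE_space
  proof eventually_elim
    case (elim \<omega>)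
    have val: "snd (Z n \<omega> s) = b n * walk_time J (nat \<lfloor>real n * s\<rfloor>) \<omega>" if "0 \<le> s" for s
      using elim that by simp
    have mono: "b n * walk_time J i \<omega> \<le> b n * walk_time J j \<omega>" if "i \<le> j" for i j
      using walk_time_mono[OF elim(2) that] b_pos[of n] by simp
    have nonneg: "0 \<le> b n * walk_time J i \<omega>" for i
      using walk_time_nonneg[OF elim(2)] b_pos[of n] by simp
    have lo: "n * k \<le> nat \<lfloor>real n * s\<rfloor>" if "real k \<le> s" for s
    proof -
      have "real n * real k \<le> real n * s" using that by (intro mult_left_mono) auto
      then have "real (n * k) \<le> real n * s" by simp
      then show ?thesis by (rule le_nat_floor)
    qed
    have hi: "nat \<lfloor>real n * s\<rfloor> \<le> n * (k + 1)" if "s \<le> real k + 1" for s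
    proof -
      have "real n * s \<le> real n * (real k + 1)" using that by (intro mult_left_mono) auto
      also have "\<dots> = real (n * (k + 1))" by (simp add: distrib_left)
      finally have "nat \<lfloor>real n * s\<rfloor> \<le> nat \<lfloor>real (n * (k + 1))\<rfloor>"
        by (intro nat_mono floor_mono)
      then show ?thesis by (simp only: floor_of_nat nat_int)
    qed
    have "exp (- (b n * walk_time J (n * (k + 1)) \<omega>)) \<le> laplace_window k (Z n \<omega>)"
      "laplace_window k (Z n \<omega>) \<le> exp (- (b n * walk_time J (n * k) \<omega>))"
      using mono lo hi nonneg
      by (intro laplace_window_bounds[where l = "b n * walk_time J (n * k) \<omega>" and u = "b n * walk_time J (n * (k + 1)) \<omega>"]
          Z_cadlag elim; simp add: val)+
    then show ?case by (simp add: F_def)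
  qed
  have "expectation (F (k + 1)) \<le> (\<integral>\<omega>. laplace_window k (Z n \<omega>) \<partial>M)"
    using bounds by (intro integral_mono_AE int_F int_Z) (auto elim: eventually_mono)
  then show "step_laplace n ^ (n * (k + 1)) \<le> (\<integral>\<omega>. laplace_window k (Z n \<omega>) \<partial>M)" by (simp only: exp_F)
  have "(\<integral>\<omega>. laplace_window k (Z n \<omega>) \<partial>M) \<le> expectation (F k)"
    using bounds by (intro integral_mono_AE int_F int_Z) (auto elim: eventually_mono)
  then show "(\<integral>\<omega>. laplace_window k (Z n \<omega>) \<partial>M) \<le> step_laplace n ^ (n * k)" by (simp only: exp_F)
qed

lemma mean_laplace_window_tendsto:
  "(\<lambda>n. \<integral>\<omega>. laplace_window k (Z n \<omega>) \<partial>M) \<longlonglongrightarrow> (\<integral>\<omega>. laplace_window k (Z' \<omega>) \<partial>M')"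
  and integrable_laplace_window: "integrable M' (\<lambda>\<omega>. laplace_window k (Z' \<omega>))"
  using laplace_window_range
  by (intro integral_tendsto[where C = 1] integrable_Z'[where C = 1] continuous_map_laplace_window;
      auto simp: cadlag_paths_iff abs_le_iff intro: order_trans[of _ 0])+

definition window_mean :: real where "window_mean = (\<integral>\<omega>. laplace_window 1 (Z' \<omega>) \<partial>M')"

lemma window_mean_range: "0 \<le> window_mean" "window_mean < 1"
proof -
  show "0 \<le> window_mean"
    unfolding window_mean_def
  proof (rule integral_nonneg_AE)
    show "AE \<omega> in M'. 0 \<le> laplace_window 1 (Z' \<omega>)"
      using laplace_window_range(1) Z'_cadlag by (intro AE_I2) auto
  qed
  have "AE \<omega> in M'. laplace_window 1 (Z' \<omega>) < 1"
    using Z'_eq D_strict D_at_0 D_mono AE_space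
  proof eventually_elim
    case (elim \<omega>)
    have "D \<omega> 0 < D \<omega> 1" using strict_mono_onD[OF elim(2), of 0 1] by simp
    then have pos: "0 < D \<omega> 1" using elim(3) by simp
    have val: "snd (Z' \<omega> s) = D \<omega> s" if "0 \<le> s" for s using elim(1) that by simp
    have "laplace_window 1 (Z' \<omega>) \<le> exp (- D \<omega> 1)"
    proof (rule laplace_window_bounds(2)[OF Z'_cadlag(2)[OF elim(5)]])
      show "D \<omega> 1 \<le> max 0 (snd (Z' \<omega> s))" if "real 1 \<le> s" "s \<le> real 1 + 1" for s
        using elim(4)[rule_format, of 1 s] that val[of s] by simp
      show "max 0 (snd (Z' \<omega> s)) \<le> D \<omega> 2" if "real 1 \<le> s" "s \<le> real 1 + 1" for s
        using elim(4)[rule_format, of s 2] that val[of s] by simp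
    qed (use pos in simp)
    also have "\<dots> < 1" using pos by simp
    finally show ?case .
  qed
  then have "(\<integral>\<omega>. laplace_window 1 (Z' \<omega>) \<partial>M') < (\<integral>\<omega>. 1 \<partial>M')"
    using integrable_laplace_window by (intro limit.integral_less_AE_space) (auto simp: limit.emeasure_space_1)
  then show "window_mean < 1" by (simp add: window_mean_def limit.prob_space)
qed

text \<open>
  The mean over window 1 dominates the Laplace transform of \<open>2 * n\<close> steps, and the mean over window
  \<open>2 * j\<close> is dominated by that of \<open>2 * n * j\<close> steps, which is its \<open>j\<close>-th power. This comparison of means
  survives the limit.
\<close>

lemma mean_laplace_window_geometric: "(\<integral>\<omega>. laplace_window (2 * j) (Z' \<omega>) \<partial>M') \<le> window_mean ^ j"
proof (rule LIMSEQ_le)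
  show "(\<lambda>n. \<integral>\<omega>. laplace_window (2 * j) (Z n \<omega>) \<partial>M) \<longlonglongrightarrow> (\<integral>\<omega>. laplace_window (2 * j) (Z' \<omega>) \<partial>M')"
    by (rule mean_laplace_window_tendsto)
  show "(\<lambda>n. (\<integral>\<omega>. laplace_window 1 (Z n \<omega>) \<partial>M) ^ j) \<longlonglongrightarrow> window_mean ^ j"
    unfolding window_mean_def by (intro tendsto_power mean_laplace_window_tendsto)
  have "(\<integral>\<omega>. laplace_window (2 * j) (Z n \<omega>) \<partial>M) \<le> (\<integral>\<omega>. laplace_window 1 (Z n \<omega>) \<partial>M) ^ j" for n
  proof -
    have "(\<integral>\<omega>. laplace_window (2 * j) (Z n \<omega>) \<partial>M) \<le> step_laplace n ^ (n * (2 * j))"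
      by (rule mean_laplace_window_bounds(2))
    also have "\<dots> = (step_laplace n ^ (n * (1 + 1))) ^ j" by (simp only: power_mult[symmetric] one_add_one mult.assoc)
    also have "\<dots> \<le> (\<integral>\<omega>. laplace_window 1 (Z n \<omega>) \<partial>M) ^ j"
      by (intro power_mono mean_laplace_window_bounds(1) zero_le_power step_laplace_range)
    finally show ?thesis .
  qed
  then show "\<exists>N. \<forall>n\<ge>N. (\<integral>\<omega>. laplace_window (2 * j) (Z n \<omega>) \<partial>M) \<le> (\<integral>\<omega>. laplace_window 1 (Z n \<omega>) \<partial>M) ^ j"
    by blast
qed

text \<open>If \<open>D\<close> stayed below \<open>c\<close>, all windows would be at least \<open>exp (- c)\<close>.\<close>

lemma D_unbounded: "AE \<omega> in M'. \<forall>c. \<exists>t\<ge>0. c < D \<omega> t"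
proof -
  have nonneg: "AE \<omega> in M'. 0 \<le> laplace_window (2 * j) (Z' \<omega>)" for j
    using laplace_window_range(1) Z'_cadlag by (intro AE_I2) auto
  have "(\<lambda>j. \<integral>\<omega>. laplace_window (2 * j) (Z' \<omega>) \<partial>M') \<longlonglongrightarrow> 0"
  proof (rule tendsto_sandwich[of "\<lambda>_. 0" _ _ "\<lambda>j. window_mean ^ j"])
    show "(\<lambda>j. window_mean ^ j) \<longlonglongrightarrow> 0" using window_mean_range by (intro LIMSEQ_power_zero) simp
    show "(\<lambda>j. 0 :: real) \<longlonglongrightarrow> 0" by simp
    show "\<forall>\<^sub>F j in sequentially. 0 \<le> (\<integral>\<omega>. laplace_window (2 * j) (Z' \<omega>) \<partial>M')"
      by (intro always_eventually allI integral_nonneg_AE nonneg)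
    show "\<forall>\<^sub>F j in sequentially. (\<integral>\<omega>. laplace_window (2 * j) (Z' \<omega>) \<partial>M') \<le> window_mean ^ j"
      by (intro always_eventually allI mean_laplace_window_geometric)
  qed
  then have "AE \<omega> in M'. \<forall>c>0. \<exists>j. laplace_window (2 * j) (Z' \<omega>) < c"
    by (intro AE_small_of_mean_small integrable_laplace_window nonneg)
  then show ?thesis
    using Z'_eq D_mono AE_space
  proof eventually_elim
    case (elim \<omega>)
    show ?case
    proof
      fix c
      obtain j where j: "laplace_window (2 * j) (Z' \<omega>) < exp (- max 0 c)" using elim(1) by fastforce
      let ?T = "real (2 * j) + 1"
      have val: "snd (Z' \<omega> s) = D \<omega> s" if "0 \<le> s" for s using elim(2) that by simp
      have "exp (- D \<omega> ?T) \<le> laplace_window (2 * j) (Z' \<omega>)"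
      proof (rule laplace_window_bounds(1)[OF Z'_cadlag(2)[OF elim(4)], where l = 0])
        show "max 0 (snd (Z' \<omega> s)) \<le> D \<omega> ?T" if "real (2 * j) \<le> s" "s \<le> ?T" for s
          using elim(3)[rule_format, of s ?T] elim(3)[rule_format, of ?T ?T] that val[of s] by simp
      qed auto
      then have "max 0 c < D \<omega> ?T" using j by (metis exp_less_cancel_iff neg_less_iff_less order_le_less_trans)
      then show "\<exists>t\<ge>0. c < D \<omega> t" by (intro exI[of _ ?T]) auto
    qed
  qed
qed

text \<open>
  For a single \<open>n\<close> whose window mean is below 1, the moves are not almost surely zero, so the Laplace
  transform of the time of the \<open>k\<close>-th step tends to 0 as \<open>k\<close> grows.
\<close>

lemma walk_time_unbounded: "AE \<omega> in M. \<forall>c. \<exists>k. c < walk_time J k \<omega>"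
proof -
  have "\<forall>\<^sub>F n in sequentially. (\<integral>\<omega>. laplace_window 1 (Z n \<omega>) \<partial>M) < 1"
    using mean_laplace_window_tendsto[of 1] window_mean_range(2) unfolding window_mean_def by (intro order_tendstoD(2))
  then obtain n where n: "(\<integral>\<omega>. laplace_window 1 (Z n \<omega>) \<partial>M) < 1"
    by (auto simp: eventually_sequentially)
  have "step_laplace n ^ (n * (1 + 1)) < 1" using mean_laplace_window_bounds(1)[of n 1] n by simp
  then have "step_laplace n \<noteq> 1" by auto
  then have less: "step_laplace n < 1" using step_laplace_range(2)[of n] by simp
  have "AE \<omega> in M. \<forall>c>0. \<exists>k. exp (- (b n * walk_time J k \<omega>)) < c"
  proof (rule AE_small_of_mean_small)
    show "integrable M (\<lambda>\<omega>. exp (- (b n * walk_time J k \<omega>)))" for k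
    proof (rule integrable_const_bound[where B = 1])
      show "(\<lambda>\<omega>. exp (- (b n * walk_time J k \<omega>))) \<in> borel_measurable M" using walk_time_measurable by simp
      show "AE \<omega> in M. norm (exp (- (b n * walk_time J k \<omega>))) \<le> 1"
        using walk_time_nonneg b_pos[of n] by (intro AE_I2) (auto intro!: mult_nonneg_nonneg)
    qed
    show "(\<lambda>k. \<integral>\<omega>. exp (- (b n * walk_time J k \<omega>)) \<partial>M) \<longlonglongrightarrow> 0"
      unfolding laplace_walk_time[OF less_imp_le[OF b_pos]] step_laplace_def[symmetric]
      using less step_laplace_range(1)[of n] by (intro LIMSEQ_power_zero) simp
  qed auto
  then show ?thesis
  proof eventually_elim
    case (elim \<omega>)
    show ?case
    proof
      fix c
      obtain k where "exp (- (b n * walk_time J k \<omega>)) < exp (- (b n * c))"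
        using elim[rule_format, OF exp_gt_zero] by blast
      then show "\<exists>k. c < walk_time J k \<omega>" using b_pos[of n] by auto
    qed
  qed
qed

end

section \<open>Levy walks as spatial paths\<close>

lemma left_version_cong:
  assumes "\<And>s. 0 \<le> s \<Longrightarrow> x s = y s"
  shows "left_version x = left_version y"
proof
  fix t show "left_version x t = left_version y t"
  proof (cases "0 < t")
    case True
    then have "\<forall>\<^sub>F s in at_left t. s \<in> {0<..<t}"
      by (intro eventually_at_leftI[of 0]) auto
    then have "\<forall>\<^sub>F s in at_left t. x s = y s"
      by eventually_elim (auto intro: assms)
    then show ?thesis
      using True by (simp add: left_version_def Topological_Spaces.Lim_def tendsto_cong)
  qed (simp add: left_version_def assms)
qed

lemma limit_L_cong:
  assumes a: "\<And>s. 0 \<le> s \<Longrightarrow> a s = a' s" and d: "\<And>s. 0 \<le> s \<Longrightarrow> d s = d' s"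
    and t: "0 \<le> inverse_time d t"
  shows "limit_L a d t = limit_L a' d' t"
proof -
  have inv: "inverse_time d' = inverse_time d" using inverse_time_cong[of d d'] d by simp
  have range: "d' ` {0..} = d ` {0..}" using d by (intro image_cong) auto
  have left: "left_version a = left_version a'" "left_version d = left_version d'"
    using a d by (blast intro: left_version_cong)+
  show ?thesis
    unfolding limit_L_def limit_X_def limit_Y_def limit_G_def limit_H_def inv range left
    using a[OF t] d[OF t] by simp
qed

locale walk_outcome =
  fixes J :: "nat \<Rightarrow> 'w \<Rightarrow> real" and \<Lambda> :: "nat \<Rightarrow> 'w \<Rightarrow> real ^ 'm" and \<omega> :: 'w
  assumes J_nonneg: "\<And>i. 1 \<le> i \<Longrightarrow> 0 \<le> J i \<omega>" and unbounded: "\<And>c. \<exists>k. c < walk_time J k \<omega>"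
begin

lemma walk_time_Suc: "walk_time J (Suc k) \<omega> = walk_time J k \<omega> + J (Suc k) \<omega>"
  by (simp add: walk_time_def)

lemma walk_sum_Suc: "walk_sum J \<Lambda> (Suc k) \<omega> = walk_sum J \<Lambda> k \<omega> + J (Suc k) \<omega> *\<^sub>R \<Lambda> (Suc k) \<omega>"
  by (simp add: walk_sum_def)

lemma walk_time_le: "i \<le> j \<Longrightarrow> walk_time J i \<omega> \<le> walk_time J j \<omega>"
  by (rule lift_Suc_mono_le[of "\<lambda>k. walk_time J k \<omega>"]) (simp add: walk_time_Suc J_nonneg)

lemma walk_sum_eq_le:
  assumes "walk_time J i \<omega> = walk_time J j \<omega>" "i \<le> j"
  shows "walk_sum J \<Lambda> i \<omega> = walk_sum J \<Lambda> j \<omega>"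
  using assms(2,1)
proof (induction rule: dec_induct)
  case (step k)
  then have "walk_time J k \<omega> = walk_time J i \<omega>" "J (Suc k) \<omega> = 0"
    using walk_time_le[of i k] J_nonneg[of "Suc k"] by (auto simp: walk_time_Suc)
  then show ?case using step.IH by (simp add: walk_sum_Suc)
qed simp

lemma walk_sum_eq:
  assumes "walk_time J i \<omega> = walk_time J j \<omega>" shows "walk_sum J \<Lambda> i \<omega> = walk_sum J \<Lambda> j \<omega>"
proof (cases "i \<le> j")
  case True
  with assms show ?thesis by (rule walk_sum_eq_le)
next
  case False
  then have "j \<le> i" by simp
  with assms[symmetric] show ?thesis by (rule walk_sum_eq_le[symmetric])
qed

lemma walk_count:
  assumes "0 \<le> t"
  shows "walk_time J (walk_count J t \<omega>) \<omega> \<le> t" "t < walk_time J (Suc (walk_count J t \<omega>)) \<omega>"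
proof -
  define S where "S = {n. walk_time J n \<omega> \<le> t}"
  obtain k where k: "t < walk_time J k \<omega>" using unbounded by blast
  have "S \<subseteq> {..k}"
  proof
    fix n assume "n \<in> S"
    then show "n \<in> {..k}" using walk_time_le[of k n] k by (cases "n \<le> k") (auto simp: S_def)
  qed
  then have fin: "finite S" by (rule finite_subset) simp
  have "0 \<in> S" using assms by (simp add: S_def walk_time_def)
  then have "Max S \<in> S" using fin by (intro Max_in) auto
  then show "walk_time J (walk_count J t \<omega>) \<omega> \<le> t" by (simp add: walk_count_def S_def)
  have "Suc (Max S) \<notin> S" using Max_ge[OF fin, of "Suc (Max S)"] by auto
  then show "t < walk_time J (Suc (walk_count J t \<omega>)) \<omega>" by (simp add: walk_count_def S_def)
qed

context
  fixes x :: "real \<Rightarrow> (real ^ 'm) \<times> real" and n :: nat and \<beta> \<gamma> :: real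
  assumes x: "cadlag x" and n: "1 \<le> n" and pos: "0 < \<beta>" "0 < \<gamma>"
    and x_eq: "\<And>t. 0 \<le> t \<Longrightarrow> x t =
      (\<beta> *\<^sub>R walk_sum J \<Lambda> (nat \<lfloor>real n * t\<rfloor>) \<omega>, \<gamma> * walk_time J (nat \<lfloor>real n * t\<rfloor>) \<omega>)"
begin

lemma coupled_walk: "coupled x"
proof -
  have "\<exists>t\<ge>0. c < snd (x t)" for c
  proof -
    obtain k where "c / \<gamma> < walk_time J k \<omega>" using unbounded by blast
    then have "c < \<gamma> * walk_time J k \<omega>" using pos by (simp add: pos_divide_less_eq mult.commute)
    moreover have "real n * (real k / real n) = real k" using n by simp
    ultimately have "c < snd (x (real k / real n))" using x_eq[of "real k / real n"] by simp
    then show ?thesis by (intro exI[of _ "real k / real n"]) simp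
  qed
  moreover have "snd (x s) \<le> snd (x t)" if "0 \<le> s" "s \<le> t" for s t
  proof -
    have "nat \<lfloor>real n * s\<rfloor> \<le> nat \<lfloor>real n * t\<rfloor>"
      using that by (intro nat_mono floor_mono mult_left_mono) auto
    then show ?thesis using that x_eq[of s] x_eq[of t] walk_time_le pos by simp
  qed
  moreover have "snd (x 0) = 0" using x_eq[of 0] by (simp add: walk_time_def)
  ultimately have "clock (\<lambda>t. snd (x t))"
    using cadlag_snd[OF x] by (auto simp: clock_def mono_on_def)
  moreover have "x s = x t" if "0 \<le> s" "0 \<le> t" "snd (x s) = snd (x t)" for s t
  proof -
    have "walk_time J (nat \<lfloor>real n * s\<rfloor>) \<omega> = walk_time J (nat \<lfloor>real n * t\<rfloor>) \<omega>"
      using that x_eq[of s] x_eq[of t] pos by simp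
    moreover from this have "walk_sum J \<Lambda> (nat \<lfloor>real n * s\<rfloor>) \<omega> = walk_sum J \<Lambda> (nat \<lfloor>real n * t\<rfloor>) \<omega>"
      by (rule walk_sum_eq)
    ultimately show ?thesis using that x_eq[of s] x_eq[of t] by simp
  qed
  ultimately show ?thesis using x unfolding coupled_def by blast
qed

text \<open>
  During move \<open>N + 1\<close> the inverse of the step clock stays at \<open>(N + 1) / n\<close>, where the space-time path
  jumps from the end of move \<open>N\<close> to the end of move \<open>N + 1\<close>.
\<close>

lemma spatial_path_walk:
  assumes t: "0 \<le> t"
  shows "spatial_path x t = \<beta> *\<^sub>R walk J \<Lambda> (t / \<gamma>) \<omega>"
proof -
  define N where "N = walk_count J (t / \<gamma>) \<omega>"
  define r where "r = real (Suc N) / real n"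
  have n0: "0 < real n" using n by simp
  have r0: "0 \<le> r" "0 < r" using n0 by (auto simp: r_def)
  have N: "walk_time J N \<omega> \<le> t / \<gamma>" "t / \<gamma> < walk_time J (Suc N) \<omega>"
    unfolding N_def using walk_count[of "t / \<gamma>"] t pos by auto
  then have N': "\<gamma> * walk_time J N \<omega> \<le> t" "t < \<gamma> * walk_time J (Suc N) \<omega>"
    using pos by (auto simp: field_simps)
  have floor_below: "nat \<lfloor>real n * s\<rfloor> \<le> N" if "s < r" for s
  proof -
    have "real n * s < real (Suc N)" using that n0 by (simp add: r_def pos_less_divide_eq mult.commute)
    then have "\<lfloor>real n * s\<rfloor> < int (Suc N)" by (simp add: floor_less_iff)
    then show ?thesis by simp
  qed
  have floor_above: "k \<le> nat \<lfloor>real n * s\<rfloor>" if "real k / real n \<le> s" for k s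
    using that n0 by (intro le_nat_floor) (simp add: pos_divide_le_eq mult.commute)
  have inv: "inverse_time (\<lambda>s. snd (x s)) t = r"
  proof (rule inverse_time_eqI[OF r0(1)])
    show "snd (x r') \<le> t" if "0 \<le> r'" "r' < r" for r'
    proof -
      have "\<gamma> * walk_time J (nat \<lfloor>real n * r'\<rfloor>) \<omega> \<le> \<gamma> * walk_time J N \<omega>"
        using walk_time_le[OF floor_below[OF that(2)]] pos by simp
      then show ?thesis using N'(1) x_eq[OF that(1)] by simp
    qed
    show "t < snd (x r')" if "r < r'" for r'
    proof -
      have "Suc N \<le> nat \<lfloor>real n * r'\<rfloor>" using that by (intro floor_above) (simp add: r_def)
      then have "\<gamma> * walk_time J (Suc N) \<omega> \<le> \<gamma> * walk_time J (nat \<lfloor>real n * r'\<rfloor>) \<omega>"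
        using walk_time_le pos by simp
      then show ?thesis using N'(2) x_eq[of r'] that r0 by simp
    qed
  qed
  have "nat \<lfloor>real n * r\<rfloor> = Suc N" using n0 by (simp add: r_def)
  then have x_r: "x r = (\<beta> *\<^sub>R walk_sum J \<Lambda> (Suc N) \<omega>, \<gamma> * walk_time J (Suc N) \<omega>)"
    using x_eq[OF r0(1)] by simp
  have left: "left_version x r = (\<beta> *\<^sub>R walk_sum J \<Lambda> N \<omega>, \<gamma> * walk_time J N \<omega>)"
  proof (rule left_version_eqI[OF tendsto_eventually r0(2)])
    have "real N / real n < r" using n0 by (simp add: r_def divide_strict_right_mono)
    then show "\<forall>\<^sub>F s in at_left r. x s = (\<beta> *\<^sub>R walk_sum J \<Lambda> N \<omega>, \<gamma> * walk_time J N \<omega>)"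
    proof (rule eventually_at_leftI[rotated])
      fix s assume s: "s \<in> {real N / real n<..<r}"
      then have "nat \<lfloor>real n * s\<rfloor> = N" using floor_below[of s] floor_above[of N s] by force
      moreover have "0 \<le> s" using s n0 by (auto intro: order_trans[of 0 "real N / real n"])
      ultimately show "x s = (\<beta> *\<^sub>R walk_sum J \<Lambda> N \<omega>, \<gamma> * walk_time J N \<omega>)"
        using x_eq[of s] by simp
    qed
  qed
  have J_pos: "0 < J (Suc N) \<omega>" using N by (simp add: walk_time_Suc)
  have "spatial_path x t = \<beta> *\<^sub>R walk_sum J \<Lambda> N \<omega> +
      ((t - \<gamma> * walk_time J N \<omega>) / (\<gamma> * J (Suc N) \<omega>)) *\<^sub>R (\<beta> *\<^sub>R J (Suc N) \<omega> *\<^sub>R \<Lambda> (Suc N) \<omega>)"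
    using spatial_path_formula[OF coupled_walk t] N'(2)
    by (simp add: inv x_r left walk_time_Suc walk_sum_Suc algebra_simps)
  also have "\<dots> = \<beta> *\<^sub>R (walk_sum J \<Lambda> N \<omega> + (t / \<gamma> - walk_time J N \<omega>) *\<^sub>R \<Lambda> (Suc N) \<omega>)"
  proof -
    have "(t - \<gamma> * walk_time J N \<omega>) / (\<gamma> * J (Suc N) \<omega>) * (\<beta> * J (Suc N) \<omega>) = \<beta> * (t / \<gamma> - walk_time J N \<omega>)"
      using J_pos pos by (simp add: field_simps)
    then show ?thesis by (simp add: scaleR_add_right)
  qed
  finally show ?thesis
    by (simp add: walk_def walk_sum_def N_def)
qed

end

end

section \<open>Rescaling space and time\<close>

text \<open>
  For \<open>n = 0\<close> the space-time path is constantly 0 and does not determine the walk. A version of \<open>W\<^sub>0\<close> is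
  obtained from \<open>(A\<^sub>1, D\<^sub>1)\<close> by a change of units.
\<close>

definition rescale :: "real \<Rightarrow> real \<Rightarrow> (real \<Rightarrow> 'e::real_normed_vector \<times> real) \<Rightarrow> real \<Rightarrow> 'e \<times> real" where
  "rescale \<beta> \<gamma> x t = (\<beta> *\<^sub>R fst (x t), \<gamma> * snd (x t))"

lemma rescale_1 [simp]: "rescale 1 1 x = x"
  by (rule ext) (simp add: rescale_def)

lemma cadlag_rescale: "cadlag x \<Longrightarrow> cadlag (rescale \<beta> \<gamma> x)"
  unfolding rescale_def[abs_def]
  by (rule cadlag_compose(1)[where f = "\<lambda>z. (\<beta> *\<^sub>R fst z, \<gamma> * snd z)"]) (auto intro!: continuous_intros)

lemma coupled_rescale:
  assumes x: "coupled x" and pos: "0 < \<gamma>"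
  shows "coupled (rescale \<beta> \<gamma> x)"
proof -
  have c: "cadlag x" and d: "clock (\<lambda>t. snd (x t))" using x by (auto simp: coupled_def)
  have "\<exists>t\<ge>0. b < \<gamma> * snd (x t)" for b
  proof -
    obtain t where "0 \<le> t" "b / \<gamma> < snd (x t)" using d unfolding clock_def by blast
    then show ?thesis using pos by (auto simp: pos_divide_less_eq mult.commute)
  qed
  then have "clock (\<lambda>t. snd (rescale \<beta> \<gamma> x t))"
    using cadlag_snd[OF cadlag_rescale[OF c, of \<beta> \<gamma>]] d pos
    by (auto simp: clock_def mono_on_def rescale_def)
  moreover have "rescale \<beta> \<gamma> x s = rescale \<beta> \<gamma> x t"
    if "0 \<le> s" "0 \<le> t" "snd (rescale \<beta> \<gamma> x s) = snd (rescale \<beta> \<gamma> x t)" for s t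
  proof -
    have "snd (x s) = snd (x t)" using that(3) pos by (simp add: rescale_def)
    then have "x s = x t" using x that unfolding coupled_def by blast
    then show ?thesis by (simp add: rescale_def)
  qed
  ultimately show ?thesis using cadlag_rescale[OF c] unfolding coupled_def by blast
qed

lemma J1_dist_rescale_tendsto:
  assumes lim: "(\<lambda>n. J1_dist (xs n) x) \<longlonglongrightarrow> 0"
  shows "(\<lambda>n. J1_dist (rescale \<beta> \<gamma> (xs n)) (rescale \<beta> \<gamma> x)) \<longlonglongrightarrow> 0"
proof (rule tendstoI)
  fix \<epsilon> :: real assume \<epsilon>: "0 < \<epsilon>"
  define C where "C = 1 + \<bar>\<beta>\<bar> + \<bar>\<gamma>\<bar>"
  have C: "1 \<le> C" by (simp add: C_def)
  have "\<forall>\<^sub>F n in sequentially. J1_dist (xs n) x < min (\<epsilon> / C) 1"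
    using \<epsilon> C by (intro order_tendstoD(2)[OF lim]) auto
  then show "\<forall>\<^sub>F n in sequentially. dist (J1_dist (rescale \<beta> \<gamma> (xs n)) (rescale \<beta> \<gamma> x)) 0 < \<epsilon>"
  proof eventually_elim
    case (elim n)
    obtain e where e: "0 < e" "e < min (\<epsilon> / C) 1" "J1_near e (xs n) x"
      by (rule J1_dist_less[OF elim]) auto
    obtain h where h: "time_change h"
      "\<And>s. 0 \<le> s \<Longrightarrow> s \<le> 1 / e \<or> h s \<le> 1 / e \<Longrightarrow> \<bar>h s - s\<bar> \<le> e \<and> dist (xs n (h s)) (x s) \<le> e"
      using e(3) unfolding J1_near_def by blast
    have eC: "e \<le> C * e" using mult_right_mono[OF C, of e] e(1) by simp
    have "1 / (C * e) \<le> 1 / e" using eC e(1) by (intro divide_left_mono) auto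
    moreover have "dist (rescale \<beta> \<gamma> y s) (rescale \<beta> \<gamma> z s') \<le> C * e" if "dist (y s) (z s') \<le> e"
      for y z :: "real \<Rightarrow> 'a \<times> real" and s s'
    proof -
      have "dist (rescale \<beta> \<gamma> y s) (rescale \<beta> \<gamma> z s')
          \<le> \<bar>\<beta>\<bar> * dist (fst (y s)) (fst (z s')) + \<bar>\<gamma>\<bar> * dist (snd (y s)) (snd (z s'))"
        using norm_Pair_le[of "\<beta> *\<^sub>R fst (y s) - \<beta> *\<^sub>R fst (z s')" "\<gamma> * snd (y s) - \<gamma> * snd (z s')"]
        by (simp add: rescale_def dist_norm scaleR_diff_right[symmetric] right_diff_distrib[symmetric] abs_mult)
      also have "\<dots> \<le> \<bar>\<beta>\<bar> * e + \<bar>\<gamma>\<bar> * e"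
        using dist_fst_le[of "y s" "z s'"] dist_snd_le[of "y s" "z s'"] that
        by (intro add_mono mult_left_mono) auto
      also have "\<dots> \<le> C * e" using e(1) by (simp add: C_def algebra_simps)
      finally show ?thesis .
    qed
    ultimately have "J1_near (C * e) (rescale \<beta> \<gamma> (xs n)) (rescale \<beta> \<gamma> x)"
      unfolding J1_near_def using h eC by (intro exI[of _ h]) (meson order_trans)
    then have "J1_dist (rescale \<beta> \<gamma> (xs n)) (rescale \<beta> \<gamma> x) \<le> C * e"
      using e(1) C by (intro J1_dist_le) auto
    also have "C * e < \<epsilon>" using e(2) C by (simp add: pos_less_divide_eq mult.commute)
    finally show ?case using J1_dist_nonneg[of "rescale \<beta> \<gamma> (xs n)" "rescale \<beta> \<gamma> x"] by simp
  qed
qed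

section \<open>Convergence of the rescaled Levy walk\<close>

context walk_limit
begin

lemma walk_outcome_AE: "AE \<omega> in M. walk_outcome J \<omega>"
  using walk_time_unbounded AE_space by eventually_elim (auto simp: walk_outcome_def J_nonneg)

lemma Z_spatial_path:
  assumes n: "1 \<le> n" and pos: "0 < \<beta>" "0 < \<gamma>"
  shows "AE \<omega> in M. coupled (Z n \<omega>) \<and>
    (\<forall>t\<ge>0. spatial_path (rescale (\<beta> / B n) (\<gamma> / b n) (Z n \<omega>)) t = \<beta> *\<^sub>R walk J \<Lambda> (t / \<gamma>) \<omega>)"
  using walk_outcome_AE Z_eq[of n] AE_space
proof eventually_elim
  case (elim \<omega>)
  interpret walk_outcome J \<Lambda> \<omega> by (rule elim(1))
  have "coupled (Z n \<omega>)"
    by (rule coupled_walk[OF Z_cadlag(2)[OF elim(3)] n B_pos b_pos]) (use elim(2) in blast)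
  moreover have "spatial_path (rescale (\<beta> / B n) (\<gamma> / b n) (Z n \<omega>)) t = \<beta> *\<^sub>R walk J \<Lambda> (t / \<gamma>) \<omega>" if "0 \<le> t" for t
  proof (rule spatial_path_walk[OF cadlag_rescale[OF Z_cadlag(2)[OF elim(3)]] n pos _ that])
    show "rescale (\<beta> / B n) (\<gamma> / b n) (Z n \<omega>) s =
      (\<beta> *\<^sub>R walk_sum J \<Lambda> (nat \<lfloor>real n * s\<rfloor>) \<omega>, \<gamma> * walk_time J (nat \<lfloor>real n * s\<rfloor>) \<omega>)" if "0 \<le> s" for s
      using elim(2) that B_pos[of n] b_pos[of n] by (simp add: rescale_def)
  qed
  ultimately show ?case by blast
qed

lemma Z'_coupled: "AE \<omega> in M'. coupled (Z' \<omega>)"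
  using Z'_eq D_at_0 D_unbounded D_strict AE_space
proof eventually_elim
  case (elim \<omega>)
  have val: "snd (Z' \<omega> t) = D \<omega> t" if "0 \<le> t" for t using elim(1) that by simp
  have c: "cadlag (Z' \<omega>)" by (rule Z'_cadlag(2)[OF elim(5)])
  have "\<exists>t\<ge>0. b < snd (Z' \<omega> t)" for b using elim(3) val by metis
  then have "clock (\<lambda>t. snd (Z' \<omega> t))"
    using cadlag_snd[OF c] elim(2) strict_mono_on_leD[OF elim(4)] by (auto simp: clock_def mono_on_def val)
  moreover have "s = t" if "0 \<le> s" "0 \<le> t" "snd (Z' \<omega> s) = snd (Z' \<omega> t)" for s t
    using that strict_mono_on_imp_inj_on[OF elim(4)] by (auto simp: val inj_on_def)
  ultimately show ?case using c unfolding coupled_def by blast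
qed

lemma spatial_path_continuous_J1_M1:
  assumes "0 < \<gamma>"
  shows "J1_continuous {x \<in> cadlag_paths. coupled x} cadlag_paths M1_converges
    (\<lambda>x :: real \<Rightarrow> (real ^ 'm) \<times> real. spatial_path (rescale \<beta> \<gamma> x))"
proof
  have "\<exists>\<omega>. coupled (Z' \<omega>) \<and> \<omega> \<in> space M'"
    using eventually_happens'[of "ae_filter M'" "\<lambda>\<omega>. coupled (Z' \<omega>) \<and> \<omega> \<in> space M'"] Z'_coupled
    by (simp add: AE_space ae_filter_eq_bot_iff limit.emeasure_space_1)
  then show "{x :: real \<Rightarrow> (real ^ 'm) \<times> real. x \<in> cadlag_paths \<and> coupled x} \<noteq> {}"
    using Z'_cadlag by blast
next
  show "spatial_path (rescale \<beta> \<gamma> x) \<in> cadlag_paths"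
    if "x \<in> {x \<in> cadlag_paths. coupled x}" for x :: "real \<Rightarrow> (real ^ 'm) \<times> real"
    using that by (intro spatial_path_in_cadlag_paths coupled_rescale assms) simp
next
  fix x :: "real \<Rightarrow> (real ^ 'm) \<times> real" and xs
  assume x: "x \<in> {x \<in> cadlag_paths. coupled x}" "range xs \<subseteq> {x \<in> cadlag_paths. coupled x}"
    and lim: "(\<lambda>n. J1_dist (xs n) x) \<longlonglongrightarrow> 0"
  show "M1_converges (\<lambda>n. spatial_path (rescale \<beta> \<gamma> (xs n))) (spatial_path (rescale \<beta> \<gamma> x))"
    using x by (intro spatial_path_M1_converges coupled_rescale assms J1_dist_rescale_tendsto lim) auto
qed auto

lemma walk_process_converges:
  "process_converges M1_topology M (\<lambda>n \<omega> t. B n *\<^sub>R walk J \<Lambda> (t / b n) \<omega>) M' (\<lambda>\<omega> t. limit_L (A \<omega>) (D \<omega>) t)"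
proof -
  let ?S = "{x :: real \<Rightarrow> (real ^ 'm) \<times> real. x \<in> cadlag_paths \<and> coupled x}"
  interpret sp: J1_continuous ?S cadlag_paths M1_converges spatial_path
    using spatial_path_continuous_J1_M1[of 1 1] by simp
  have version: "\<exists>W. W \<in> measurable M (borel_sets_of M1_topology) \<and>
      (AE \<omega> in M. \<forall>t\<ge>0. W \<omega> t = B n *\<^sub>R walk J \<Lambda> (t / b n) \<omega>) \<and>
      (1 \<le> n \<longrightarrow> (AE \<omega> in M. Z n \<omega> \<in> ?S \<and> W \<omega> = spatial_path (Z n \<omega>)))" for n
  proof -
    \<comment> \<open>The index \<open>k\<close> differs from \<open>n\<close>, and the rescaling from the identity, only for \<open>n = 0\<close>.\<close>
    define k where "k = max n 1"
    have pos: "0 < b n / b k" using b_pos by simp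
    interpret sc: J1_continuous ?S cadlag_paths M1_converges
      "\<lambda>x. spatial_path (rescale (B n / B k) (b n / b k) x)"
      using spatial_path_continuous_J1_M1[OF pos] by simp
    have k: "AE \<omega> in M. coupled (Z k \<omega>) \<and>
      (\<forall>t\<ge>0. spatial_path (rescale (B n / B k) (b n / b k) (Z k \<omega>)) t = B n *\<^sub>R walk J \<Lambda> (t / b n) \<omega>)"
      by (rule Z_spatial_path[OF _ B_pos b_pos]) (simp add: k_def)
    have "AE \<omega> in M. Z k \<omega> \<in> ?S" using k AE_space by eventually_elim (auto intro: Z_cadlag)
    then obtain W where W: "W \<in> measurable M (borel_sets_of M1_topology)"
      "AE \<omega> in M. Z k \<omega> \<in> ?S \<and> W \<omega> = spatial_path (rescale (B n / B k) (b n / b k) (Z k \<omega>))"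
      unfolding M1_topology_def by (rule sc.measurable_image[OF Z_measurable])
    have "AE \<omega> in M. \<forall>t\<ge>0. W \<omega> t = B n *\<^sub>R walk J \<Lambda> (t / b n) \<omega>"
      using W(2) k by eventually_elim auto
    moreover have "AE \<omega> in M. Z n \<omega> \<in> ?S \<and> W \<omega> = spatial_path (Z n \<omega>)" if "1 \<le> n"
    proof -
      have "k = n" using that by (simp add: k_def)
      then show ?thesis using W(2) B_pos[of n] b_pos[of n] by (simp add: less_imp_neq[THEN not_sym])
    qed
    ultimately show ?thesis using W(1) by blast
  qed
  obtain W where W0: "\<forall>n. W n \<in> measurable M (borel_sets_of M1_topology) \<and>
      (AE \<omega> in M. \<forall>t\<ge>0. W n \<omega> t = B n *\<^sub>R walk J \<Lambda> (t / b n) \<omega>) \<and>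
      (1 \<le> n \<longrightarrow> (AE \<omega> in M. Z n \<omega> \<in> ?S \<and> W n \<omega> = spatial_path (Z n \<omega>)))"
    using choice[OF allI[OF version]] by (rule exE)
  have W: "W n \<in> measurable M (borel_sets_of M1_topology)" for n
    by (rule conjunct1[OF spec[OF W0]])
  have W_eq: "AE \<omega> in M. \<forall>t\<ge>0. W n \<omega> t = B n *\<^sub>R walk J \<Lambda> (t / b n) \<omega>" for n
    by (rule conjunct1[OF conjunct2[OF spec[OF W0]]])
  have WZ: "1 \<le> n \<longrightarrow> (AE \<omega> in M. Z n \<omega> \<in> ?S \<and> W n \<omega> = spatial_path (Z n \<omega>))" for n
    by (rule conjunct2[OF conjunct2[OF spec[OF W0]]])
  have "AE \<omega> in M'. Z' \<omega> \<in> ?S" using Z'_coupled AE_space by eventually_elim (auto intro: Z'_cadlag)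
  then obtain W' where W': "W' \<in> measurable M' (borel_sets_of M1_topology)"
    "AE \<omega> in M'. Z' \<omega> \<in> ?S \<and> W' \<omega> = spatial_path (Z' \<omega>)"
    unfolding M1_topology_def by (rule sp.measurable_image[OF Z'_measurable])
  have limit_eq: "AE \<omega> in M'. \<forall>t\<ge>0. W' \<omega> t = limit_L (A \<omega>) (D \<omega>) t"
    using W'(2) Z'_eq
  proof eventually_elim
    case (elim \<omega>)
    show ?case
    proof (intro allI impI)
      fix t :: real assume t: "0 \<le> t"
      have "clock (\<lambda>s. snd (Z' \<omega> s))" using elim(1) by (simp add: coupled_def)
      then have "0 \<le> inverse_time (\<lambda>s. snd (Z' \<omega> s)) t" using t by (rule inverse_time_nonneg)
      then have "limit_L (\<lambda>s. fst (Z' \<omega> s)) (\<lambda>s. snd (Z' \<omega> s)) t = limit_L (A \<omega>) (D \<omega>) t"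
        using elim(2) by (intro limit_L_cong) auto
      then show "W' \<omega> t = limit_L (A \<omega>) (D \<omega>) t" using elim(1) t by (simp add: spatial_path_def)
    qed
  qed
  have "\<forall>\<^sub>F n in sequentially. AE \<omega> in M. Z n \<omega> \<in> ?S \<and> W n \<omega> = spatial_path (Z n \<omega>)"
    unfolding eventually_sequentially using WZ by (intro exI[of _ 1] allI impI) (rule mp)
  then have "weakly_converges M1_topology (\<lambda>n. distr M (borel_sets_of M1_topology) (W n))
      (distr M' (borel_sets_of M1_topology) W')"
    using W W' unfolding M1_topology_def
    by (intro sp.mapping_theorem[OF prob_space_axioms limit.prob_space_axioms Z_measurable Z'_measurable weak])
  then show ?thesis
    unfolding process_converges_def path_version_def using W W_eq W'(1) limit_eq by blast
qed

end

theorem theorem4p8: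
  fixes M :: "'w measure" and M' :: "'v measure"
    and lam :: "(real ^ 'm) measure"
    and J :: "nat \<Rightarrow> 'w \<Rightarrow> real" and \<Lambda> :: "nat \<Rightarrow> 'w \<Rightarrow> real ^ 'm"
    and B b :: "nat \<Rightarrow> real"
    and A :: "'v \<Rightarrow> real \<Rightarrow> real ^ 'm" and D :: "'v \<Rightarrow> real \<Rightarrow> real"
  assumes "levy_walk M lam J \<Lambda>"
    and "prob_space M'"
    and "\<And>n. B n > 0" and "\<And>n. b n > 0"
    and "process_converges J1_topology
           M (\<lambda>n \<omega> t. (B n *\<^sub>R walk_sum J \<Lambda> (nat \<lfloor>real n * t\<rfloor>) \<omega>,
                       b n * walk_time J (nat \<lfloor>real n * t\<rfloor>) \<omega>))
           M' (\<lambda>\<omega> t. (A \<omega> t, D \<omega> t))"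
    and "AE \<omega> in M'. strict_mono_on {0..} (D \<omega>)"
  shows "process_converges M1_topology
           M (\<lambda>n \<omega> t. B n *\<^sub>R walk J \<Lambda> (t / b n) \<omega>)
           M' (\<lambda>\<omega> t. limit_L (A \<omega>) (D \<omega>) t)"
proof -
  obtain Z Z' where "\<And>n. path_version J1_topology M
      (\<lambda>\<omega> t. (B n *\<^sub>R walk_sum J \<Lambda> (nat \<lfloor>real n * t\<rfloor>) \<omega>, b n * walk_time J (nat \<lfloor>real n * t\<rfloor>) \<omega>)) (Z n)"
    and "path_version J1_topology M' (\<lambda>\<omega> t. (A \<omega> t, D \<omega> t)) Z'"
    and "weakly_converges J1_topology (\<lambda>n. distr M (borel_sets_of J1_topology) (Z n))
      (distr M' (borel_sets_of J1_topology) Z')"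
    using assms(5) unfolding process_converges_def by blast
  then have "walk_limit M lam J \<Lambda> M' B b A D Z Z'"
    using assms by (intro walk_limit.intro walk_limit_axioms.intro) (auto simp: path_version_def)
  then show ?thesis by (rule walk_limit.walk_process_converges)
qed

end
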